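(* Let $k$ be a field, $\Gamma$ an abelian group, and $R$ a PDCF $\Gamma$-graded $k$-algebra which is an integral domain, such that the graded maximal ideal $R_+=\bigoplus_{q>_Q0}R_q$ is generated by a regular sequence $(r_i\mid i\in\mathbb{N})$ of homogeneous elements of $R$. Then the group homomorphism $\Phi:K^{\mathrm{BDF}}_{\Gamma,0}(R)\to G^{\mathrm{BDF}}_{\Gamma,0}(R)$ which sends the class $[F]$ of a projective (equivalently free) BDF $\Gamma$-graded $R$-module $F$ to the class of $[F]$ in $G^{\mathrm{BDF}}_{\Gamma,0}(R)$ is an isomorphism.
   Context: Abelian groups and monoids are written additively. A $\Gamma$-graded $k$-algebra is a commutative $k$-algebra $R$ with $k$-subspaces $R_g$ ($g\in\Gamma$) such that $R=\bigoplus_{g\in\Gamma}R_g$ and $R_gR_h\subseteq R_{g+h}$. A $\Gamma$-graded $R$-module is an $R$-module $M$ with $k$-subspaces $M_g$ such that $M=\bigoplus_{g\in\Gamma}M_g$ and $R_gM_h\subseteq M_{g+h}$; elements of some $M_g$ are called homogeneous. An $R$-linear map $\varphi:M\to N$ is graded if $\varphi(M_g)\subseteq N_g$ for all $g$. Write $\mathrm{Supp}_\Gamma(M)=\{g\in\Gamma\mid M_g\neq 0\}$. Since $R$ is a domain, $Q:=\mathrm{Supp}_\Gamma(R)$ is a submonoid of $\Gamma$ (the image monoid). $Q$ is pointed if $p+q=0$ with $p,q\in Q$ implies $p=q=0$; then $g\le_Q h :\iff h-g\in Q$ is a partial order on $\Gamma$. A subset $U\subseteq\Gamma$ is downward finite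 if for every $g\in\Gamma$ the set $\{u\in U\mid u\le_Q g\}$ is finite; it is finitely bounded below if there are finitely many $p_1,\dots,p_n\in\Gamma$ such that every $u\in U$ satisfies $p_i\le_Q u$ for some $i$. $R$ is PDCF if $Q$ is pointed and downward finite, $R$ is connected ($R_0=k$), and $\dim_k R_g<\infty$ for all $g\in\Gamma$. A $\Gamma$-graded $R$-module $M$ is BDF if $\mathrm{Supp}_\Gamma(M)$ is finitely bounded below and downward finite and $\dim_k M_g<\infty$ for all $g\in\Gamma$. A family $(r_i\mid i\in\mathbb{N})$ ($\mathbb N=\{1,2,\dots\}$) in $R$ is a regular sequence if $(r_1,r_2,\dots)\neq R$ and for every $n\ge0$ the element $r_{n+1}$ is not a zero divisor on $R/(r_1,\dots,r_n)$. $K^{\mathrm{BDF}}_{\Gamma,0}(R)$ is the Grothendieck group (group completion) of the commutative monoid of graded isomorphism classes of BDF $\Gamma$-graded $R$-modules that are projective as $R$-modules (all such modules are in fact free), with operation $[M]+[N]=[M\oplus N]$. $G^{\mathrm{BDF}}_{\Gamma,0}(R)$ is the free abelian group on the set of graded isomorphism classes of all BDF $\Gamma$-graded $R$-modules, modulo the subgroup generated by the expressions $[L]-[M]+[N]$ for all short exact sequences $0\to L\to M\to N\to0$ of BDF $\Gamma$-graded $R$-modules and graded maps. *)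

theory Defs
  imports "HOL-Algebra.Module" "HOL-Algebra.QuotRing" "HOL-Algebra.Free_Abelian_Groups"
begin

section \<open>Graded vector spaces, algebras and modules\<close>

text \<open>
  One record serves for graded algebras and graded modules; modules ignore the fields for ring
  multiplication and unit, as in \<^theory>\<open>HOL-Algebra.Module\<close>.
\<close>

record ('a, 'b, 'g) graded_module = "('a, 'b) module" +
  component :: "'g \<Rightarrow> 'b set"

definition support :: "('a, 'b, 'g) graded_module \<Rightarrow> 'g set"
  where "support V = {g. component V g \<noteq> {\<zero>\<^bsub>V\<^esub>}}"

definition graded_space :: "'k ring \<Rightarrow> ('k, 'b, 'g) graded_module \<Rightarrow> bool"
  where "graded_space K V \<longleftrightarrow>
    module K V \<and>
    (\<forall>g. submodule (component V g) K V) \<and>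
    (\<forall>v\<in>carrier V. \<exists>!f. (\<forall>g. f g \<in> component V g) \<and> finite {g. f g \<noteq> \<zero>\<^bsub>V\<^esub>} \<and>
       v = (\<Oplus>\<^bsub>V\<^esub>g\<in>{g. f g \<noteq> \<zero>\<^bsub>V\<^esub>}. f g))"

definition finite_dimensional :: "'k ring \<Rightarrow> ('k, 'b, 'g) graded_module \<Rightarrow> 'b set \<Rightarrow> bool"
  where "finite_dimensional K V W \<longleftrightarrow>
    (\<exists>B. finite B \<and> B \<subseteq> W \<and>
       (\<forall>w\<in>W. \<exists>c\<in>B \<rightarrow> carrier K. w = (\<Oplus>\<^bsub>V\<^esub>b\<in>B. c b \<odot>\<^bsub>V\<^esub> b)))"

definition graded_algebra :: "'k ring \<Rightarrow> ('k, 'r, 'g::ab_group_add) graded_module \<Rightarrow> bool"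
  where "graded_algebra K R \<longleftrightarrow>
    algebra K R \<and> graded_space K R \<and>
    (\<forall>g h. \<forall>a\<in>component R g. \<forall>b\<in>component R h. a \<otimes>\<^bsub>R\<^esub> b \<in> component R (g + h))"

definition restrict_scalars ::
    "('k, 'r, 'g) graded_module \<Rightarrow> ('r, 'm, 'g) graded_module \<Rightarrow> ('k, 'm, 'g) graded_module"
  where "restrict_scalars R M =
    \<lparr>carrier = carrier M, mult = mult M, one = \<one>\<^bsub>M\<^esub>, ring.zero = \<zero>\<^bsub>M\<^esub>, add = add M,
     smult = (\<lambda>c m. (c \<odot>\<^bsub>R\<^esub> \<one>\<^bsub>R\<^esub>) \<odot>\<^bsub>M\<^esub> m), component = component M\<rparr>"

definition is_graded_module ::
    "'k ring \<Rightarrow> ('k, 'r, 'g::ab_group_add) graded_module \<Rightarrow> ('r, 'm, 'g) graded_module \<Rightarrow> bool"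
  where "is_graded_module K R M \<longleftrightarrow>
    module R M \<and> graded_space K (restrict_scalars R M) \<and>
    (\<forall>g h. \<forall>a\<in>component R g. \<forall>m\<in>component M h. a \<odot>\<^bsub>M\<^esub> m \<in> component M (g + h))"


section \<open>The image monoid and finiteness conditions\<close>

definition supp_le :: "('k, 'r, 'g::ab_group_add) graded_module \<Rightarrow> 'g \<Rightarrow> 'g \<Rightarrow> bool"
  where "supp_le R g h \<longleftrightarrow> h - g \<in> support R"

definition pointed :: "'g::ab_group_add set \<Rightarrow> bool"
  where "pointed Q \<longleftrightarrow> (\<forall>p\<in>Q. \<forall>q\<in>Q. p + q = 0 \<longrightarrow> p = 0 \<and> q = 0)"

definition downward_finite :: "('k, 'r, 'g::ab_group_add) graded_module \<Rightarrow> 'g set \<Rightarrow> bool"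
  where "downward_finite R U \<longleftrightarrow> (\<forall>g. finite {u\<in>U. supp_le R u g})"

definition finitely_bounded_below :: "('k, 'r, 'g::ab_group_add) graded_module \<Rightarrow> 'g set \<Rightarrow> bool"
  where "finitely_bounded_below R U \<longleftrightarrow> (\<exists>P. finite P \<and> (\<forall>u\<in>U. \<exists>p\<in>P. supp_le R p u))"

definition pdcf :: "'k ring \<Rightarrow> ('k, 'r, 'g::ab_group_add) graded_module \<Rightarrow> bool"
  where "pdcf K R \<longleftrightarrow>
    pointed (support R) \<and> downward_finite R (support R) \<and>
    component R 0 = (\<lambda>c. c \<odot>\<^bsub>R\<^esub> \<one>\<^bsub>R\<^esub>) ` carrier K \<and>
    (\<forall>g. finite_dimensional K R (component R g))"

definition bdf_module ::
    "'k ring \<Rightarrow> ('k, 'r, 'g::ab_group_add) graded_module \<Rightarrow> ('r, 'm, 'g) graded_module \<Rightarrow> bool"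
  where "bdf_module K R M \<longleftrightarrow>
    is_graded_module K R M \<and>
    finitely_bounded_below R (support M) \<and> downward_finite R (support M) \<and>
    (\<forall>g. finite_dimensional K (restrict_scalars R M) (component M g))"

definition irrelevant_ideal :: "('k, 'r, 'g::ab_group_add) graded_module \<Rightarrow> 'r set"
  where "irrelevant_ideal R =
    {(\<Oplus>\<^bsub>R\<^esub>q\<in>S. f q) | S f. finite S \<and> S \<subseteq> {q. supp_le R 0 q \<and> q \<noteq> 0} \<and>
       (\<forall>q\<in>S. f q \<in> component R q)}"

text \<open>The sequence is indexed from \<open>0\<close>, so \<open>r n\<close> is the \<open>(n + 1)\<close>-st element.\<close>

definition regular_sequence :: "('r, 'z) ring_scheme \<Rightarrow> (nat \<Rightarrow> 'r) \<Rightarrow> bool"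
  where "regular_sequence R r \<longleftrightarrow>
    range r \<subseteq> carrier R \<and> Idl\<^bsub>R\<^esub> (range r) \<noteq> carrier R \<and>
    (\<forall>n. let I = Idl\<^bsub>R\<^esub> (r ` {..<n}); A = R Quot I in
       \<forall>x\<in>carrier A. (I +>\<^bsub>R\<^esub> r n) \<otimes>\<^bsub>A\<^esub> x = \<zero>\<^bsub>A\<^esub> \<longrightarrow> x = \<zero>\<^bsub>A\<^esub>)"


section \<open>Homomorphisms, direct sums, projectivity\<close>

definition module_hom ::
    "('r, 's) ring_scheme \<Rightarrow> ('r, 'm, 'y) module_scheme \<Rightarrow> ('r, 'n, 'z) module_scheme \<Rightarrow> ('m \<Rightarrow> 'n) set"
  where "module_hom R M N =
    {\<phi> \<in> carrier M \<rightarrow> carrier N.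
       (\<forall>x\<in>carrier M. \<forall>y\<in>carrier M. \<phi> (x \<oplus>\<^bsub>M\<^esub> y) = \<phi> x \<oplus>\<^bsub>N\<^esub> \<phi> y) \<and>
       (\<forall>a\<in>carrier R. \<forall>x\<in>carrier M. \<phi> (a \<odot>\<^bsub>M\<^esub> x) = a \<odot>\<^bsub>N\<^esub> \<phi> x)}"

definition graded_hom ::
    "('r, 's) ring_scheme \<Rightarrow> ('r, 'm, 'g) graded_module \<Rightarrow> ('r, 'n, 'g) graded_module \<Rightarrow> ('m \<Rightarrow> 'n) set"
  where "graded_hom R M N = {\<phi> \<in> module_hom R M N. \<forall>g. \<phi> ` component M g \<subseteq> component N g}"

definition graded_isomorphic ::
    "('r, 's) ring_scheme \<Rightarrow> ('r, 'm, 'g) graded_module \<Rightarrow> ('r, 'n, 'g) graded_module \<Rightarrow> bool"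
  where "graded_isomorphic R M N \<longleftrightarrow> (\<exists>\<phi>\<in>graded_hom R M N. bij_betw \<phi> (carrier M) (carrier N))"

definition short_exact ::
    "('r, 's) ring_scheme \<Rightarrow> ('r, 'l, 'g) graded_module \<Rightarrow> ('l \<Rightarrow> 'm) \<Rightarrow> ('r, 'm, 'g) graded_module \<Rightarrow>
     ('m \<Rightarrow> 'n) \<Rightarrow> ('r, 'n, 'g) graded_module \<Rightarrow> bool"
  where "short_exact R L \<phi> M \<psi> N \<longleftrightarrow>
    \<phi> \<in> graded_hom R L M \<and> \<psi> \<in> graded_hom R M N \<and>
    inj_on \<phi> (carrier L) \<and> \<phi> ` carrier L = {m\<in>carrier M. \<psi> m = \<zero>\<^bsub>N\<^esub>} \<and>
    \<psi> ` carrier M = carrier N"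

definition direct_sum ::
    "('r, 'm, 'g) graded_module \<Rightarrow> ('r, 'n, 'g) graded_module \<Rightarrow> ('r, 'm \<times> 'n, 'g) graded_module"
  where "direct_sum M N =
    \<lparr>carrier = carrier M \<times> carrier N,
     mult = (\<lambda>(x, y) (x', y'). (x \<otimes>\<^bsub>M\<^esub> x', y \<otimes>\<^bsub>N\<^esub> y')), one = (\<one>\<^bsub>M\<^esub>, \<one>\<^bsub>N\<^esub>),
     ring.zero = (\<zero>\<^bsub>M\<^esub>, \<zero>\<^bsub>N\<^esub>), add = (\<lambda>(x, y) (x', y'). (x \<oplus>\<^bsub>M\<^esub> x', y \<oplus>\<^bsub>N\<^esub> y')),
     smult = (\<lambda>a (x, y). (a \<odot>\<^bsub>M\<^esub> x, a \<odot>\<^bsub>N\<^esub> y)),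
     component = (\<lambda>g. component M g \<times> component N g)\<rparr>"

text \<open>
  The lifting property. Quantification over types is not possible inside a definition, so the
  test modules live on the types \<open>'m \<Rightarrow> 'r\<close> and \<open>'m\<close>; the lemma \<open>projective_module_lift\<close> below
  shows that the lifting property for modules on arbitrary types follows.
\<close>

definition projective_module :: "('r, 's) ring_scheme \<Rightarrow> ('r, 'm, 'z) module_scheme \<Rightarrow> bool"
  where "projective_module R M \<longleftrightarrow>
    module R M \<and>
    (\<forall>(N :: ('r, 'm \<Rightarrow> 'r) module) (N' :: ('r, 'm) module) p f.
       module R N \<and> module R N' \<and> p \<in> module_hom R N N' \<and> p ` carrier N = carrier N' \<and>
       f \<in> module_hom R M N' \<longrightarrow>
       (\<exists>h\<in>module_hom R M N. \<forall>x\<in>carrier M. p (h x) = f x))"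


section \<open>Isomorphism classes and the two Grothendieck groups\<close>

text \<open>
  A module with finite-dimensional homogeneous components has coordinates in \<open>K\<close> indexed by a degree
  and a natural number, so up to graded isomorphism it is carried by a subset of \<open>'g \<times> nat \<Rightarrow> 'k\<close>;
  see the lemma \<open>bdf_module_model\<close>. Isomorphism classes are therefore formed on this type.
\<close>

type_synonym ('k, 'r, 'g) model = "('r, 'g \<times> nat \<Rightarrow> 'k, 'g) graded_module"

definition bdf_class ::
    "'k ring \<Rightarrow> ('k, 'r, 'g::ab_group_add) graded_module \<Rightarrow> ('r, 'm, 'g) graded_module \<Rightarrow>
     ('k, 'r, 'g) model set"
  where "bdf_class K R M = {N. bdf_module K R N \<and> graded_isomorphic R M N}"

definition bdf_projective_monoid ::
    "'k ring \<Rightarrow> ('k, 'r, 'g::ab_group_add) graded_module \<Rightarrow> ('k, 'r, 'g) model set monoid"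
  where "bdf_projective_monoid K R =
    \<lparr>carrier = {bdf_class K R M | M :: ('k, 'r, 'g) model. bdf_module K R M \<and> projective_module R M},
     mult = (\<lambda>X Y. \<Union>M\<in>X. \<Union>N\<in>Y. bdf_class K R (direct_sum M N)),
     one = {M. bdf_module K R M \<and> carrier M = {\<zero>\<^bsub>M\<^esub>}}\<rparr>"

text \<open>The class of a pair \<open>(a, b)\<close> is the formal difference of \<open>a\<close> and \<open>b\<close>.\<close>

definition completion_rel :: "('a, 'z) monoid_scheme \<Rightarrow> (('a \<times> 'a) \<times> ('a \<times> 'a)) set"
  where "completion_rel A =
    {((a, b), (c, d)). a \<in> carrier A \<and> b \<in> carrier A \<and> c \<in> carrier A \<and> d \<in> carrier A \<and>
       (\<exists>e\<in>carrier A. a \<otimes>\<^bsub>A\<^esub> d \<otimes>\<^bsub>A\<^esub> e = c \<otimes>\<^bsub>A\<^esub> b \<otimes>\<^bsub>A\<^esub> e)}"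

definition group_completion :: "('a, 'z) monoid_scheme \<Rightarrow> ('a \<times> 'a) set monoid"
  where "group_completion A =
    \<lparr>carrier = (carrier A \<times> carrier A) // completion_rel A,
     mult = (\<lambda>X Y. \<Union>(a, b)\<in>X. \<Union>(c, d)\<in>Y. completion_rel A `` {(a \<otimes>\<^bsub>A\<^esub> c, b \<otimes>\<^bsub>A\<^esub> d)}),
     one = completion_rel A `` {(\<one>\<^bsub>A\<^esub>, \<one>\<^bsub>A\<^esub>)}\<rparr>"

definition completion_class :: "('a, 'z) monoid_scheme \<Rightarrow> 'a \<Rightarrow> ('a \<times> 'a) set"
  where "completion_class A a = completion_rel A `` {(a, \<one>\<^bsub>A\<^esub>)}"

definition K0_BDF ::
    "'k ring \<Rightarrow> ('k, 'r, 'g::ab_group_add) graded_module \<Rightarrow>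
     (('k, 'r, 'g) model set \<times> ('k, 'r, 'g) model set) set monoid"
  where "K0_BDF K R = group_completion (bdf_projective_monoid K R)"

definition K0_class ::
    "'k ring \<Rightarrow> ('k, 'r, 'g::ab_group_add) graded_module \<Rightarrow> ('r, 'm, 'g) graded_module \<Rightarrow>
     (('k, 'r, 'g) model set \<times> ('k, 'r, 'g) model set) set"
  where "K0_class K R F = completion_class (bdf_projective_monoid K R) (bdf_class K R F)"

definition bdf_free_group ::
    "'k ring \<Rightarrow> ('k, 'r, 'g::ab_group_add) graded_module \<Rightarrow> (('k, 'r, 'g) model set \<Rightarrow>\<^sub>0 int) monoid"
  where "bdf_free_group K R =
    free_Abelian_group {bdf_class K R M | M :: ('k, 'r, 'g) model. bdf_module K R M}"

definition exact_relations ::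
    "'k ring \<Rightarrow> ('k, 'r, 'g::ab_group_add) graded_module \<Rightarrow> (('k, 'r, 'g) model set \<Rightarrow>\<^sub>0 int) set"
  where "exact_relations K R = generate (bdf_free_group K R)
    {frag_of (bdf_class K R L) - frag_of (bdf_class K R M) + frag_of (bdf_class K R N) |
       (L :: ('k, 'r, 'g) model) (M :: ('k, 'r, 'g) model) (N :: ('k, 'r, 'g) model) \<phi> \<psi>.
       bdf_module K R L \<and> bdf_module K R M \<and> bdf_module K R N \<and> short_exact R L \<phi> M \<psi> N}"

definition G0_BDF ::
    "'k ring \<Rightarrow> ('k, 'r, 'g::ab_group_add) graded_module \<Rightarrow> (('k, 'r, 'g) model set \<Rightarrow>\<^sub>0 int) set monoid"
  where "G0_BDF K R = bdf_free_group K R Mod exact_relations K R"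

definition G0_class ::
    "'k ring \<Rightarrow> ('k, 'r, 'g::ab_group_add) graded_module \<Rightarrow> ('r, 'm, 'g) graded_module \<Rightarrow>
     (('k, 'r, 'g) model set \<Rightarrow>\<^sub>0 int) set"
  where "G0_class K R M = exact_relations K R #>\<^bsub>bdf_free_group K R\<^esub> frag_of (bdf_class K R M)"

text \<open>
  The classes \<open>[F]\<close> generate \<open>K0_BDF K R\<close>, so two members of this set agree on its carrier; they may
  differ only off the carrier, where HOL functions are unconstrained.
\<close>

definition cartan_maps ::
    "'k ring \<Rightarrow> ('k, 'r, 'g::ab_group_add) graded_module \<Rightarrow>
     ((('k, 'r, 'g) model set \<times> ('k, 'r, 'g) model set) set \<Rightarrow>
      (('k, 'r, 'g) model set \<Rightarrow>\<^sub>0 int) set) set"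
  where "cartan_maps K R =
    {\<Phi> \<in> hom (K0_BDF K R) (G0_BDF K R).
       \<forall>F :: ('k, 'r, 'g) model. bdf_module K R F \<and> projective_module R F \<longrightarrow>
         \<Phi> (K0_class K R F) = G0_class K R F}"


section \<open>Independence of the chosen carrier types\<close>

subsection \<open>Projectivity\<close>

lemma module_hom_closed: "\<lbrakk>f \<in> module_hom R M N; x \<in> carrier M\<rbrakk> \<Longrightarrow> f x \<in> carrier N"
  by (auto simp: module_hom_def)

lemma module_hom_zero:
  assumes "module R M" "module R N" "f \<in> module_hom R M N"
  shows "f \<zero>\<^bsub>M\<^esub> = \<zero>\<^bsub>N\<^esub>"
proof -
  interpret M: module R M by fact
  interpret N: module R N by fact
  have *: "f \<zero>\<^bsub>M\<^esub> \<in> carrier N"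
    using assms(3) by (auto simp: module_hom_def)
  have "f (\<zero>\<^bsub>M\<^esub> \<oplus>\<^bsub>M\<^esub> \<zero>\<^bsub>M\<^esub>) = f \<zero>\<^bsub>M\<^esub> \<oplus>\<^bsub>N\<^esub> f \<zero>\<^bsub>M\<^esub>"
    using assms(3) unfolding module_hom_def by blast
  then show ?thesis using * by (simp add: N.M.add.r_cancel_one')
qed

lemma module_hom_finsum:
  assumes "module R M" "module R N" "f \<in> module_hom R M N"
    and "finite A" "g \<in> A \<rightarrow> carrier M"
  shows "f (\<Oplus>\<^bsub>M\<^esub>a\<in>A. g a) = (\<Oplus>\<^bsub>N\<^esub>a\<in>A. f (g a))"
  using assms(4,5)
proof induction
  interpret M: module R M by fact
  interpret N: module R N by fact
  case empty
  then show ?case by (simp add: module_hom_zero[OF assms(1-3)])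
next
  interpret M: module R M by fact
  interpret N: module R N by fact
  case (insert a A)
  have *: "f (x \<oplus>\<^bsub>M\<^esub> y) = f x \<oplus>\<^bsub>N\<^esub> f y" if "x \<in> carrier M" "y \<in> carrier M" for x y
    using assms(3) that unfolding module_hom_def by blast
  have "(\<lambda>x. f (g x)) \<in> A \<rightarrow> carrier N" "f (g a) \<in> carrier N"
    using insert.prems module_hom_closed[OF assms(3)] by auto
  with insert show ?case by (simp add: * Pi_def)
qed

definition free_module :: "('r, 's) ring_scheme \<Rightarrow> 'm set \<Rightarrow> ('r, 'm \<Rightarrow> 'r) module"
  where "free_module R A =
    \<lparr>carrier = {c. finite {m. c m \<noteq> \<zero>\<^bsub>R\<^esub>} \<and> {m. c m \<noteq> \<zero>\<^bsub>R\<^esub>} \<subseteq> A \<and> range c \<subseteq> carrier R},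
     mult = undefined, one = undefined, ring.zero = (\<lambda>_. \<zero>\<^bsub>R\<^esub>),
     add = (\<lambda>c d m. c m \<oplus>\<^bsub>R\<^esub> d m), smult = (\<lambda>a c m. a \<otimes>\<^bsub>R\<^esub> c m)\<rparr>"

lemma module_free_module:
  assumes "cring R"
  shows "module R (free_module R A)"
proof -
  interpret R: cring R by fact
  let ?F = "free_module R A"
  have mem: "c \<in> carrier ?F \<longleftrightarrow> finite {m. c m \<noteq> \<zero>\<^bsub>R\<^esub>} \<and> {m. c m \<noteq> \<zero>\<^bsub>R\<^esub>} \<subseteq> A \<and> (\<forall>m. c m \<in> carrier R)" for c
    by (auto simp: free_module_def)
  have add: "c \<oplus>\<^bsub>?F\<^esub> d = (\<lambda>m. c m \<oplus>\<^bsub>R\<^esub> d m)" and smult: "a \<odot>\<^bsub>?F\<^esub> c = (\<lambda>m. a \<otimes>\<^bsub>R\<^esub> c m)"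
    and zero: "\<zero>\<^bsub>?F\<^esub> = (\<lambda>m. \<zero>\<^bsub>R\<^esub>)" for a c d
    by (auto simp: free_module_def)
  have add_closed: "c \<oplus>\<^bsub>?F\<^esub> d \<in> carrier ?F" if "c \<in> carrier ?F" "d \<in> carrier ?F" for c d
  proof -
    have *: "{m. c m \<oplus>\<^bsub>R\<^esub> d m \<noteq> \<zero>\<^bsub>R\<^esub>} \<subseteq> {m. c m \<noteq> \<zero>\<^bsub>R\<^esub>} \<union> {m. d m \<noteq> \<zero>\<^bsub>R\<^esub>}" by auto
    have "finite ({m. c m \<noteq> \<zero>\<^bsub>R\<^esub>} \<union> {m. d m \<noteq> \<zero>\<^bsub>R\<^esub>})"
      "{m. c m \<noteq> \<zero>\<^bsub>R\<^esub>} \<union> {m. d m \<noteq> \<zero>\<^bsub>R\<^esub>} \<subseteq> A" "\<forall>m. c m \<oplus>\<^bsub>R\<^esub> d m \<in> carrier R"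
      using that unfolding mem by simp_all
    then show ?thesis unfolding mem add by (intro conjI finite_subset[OF *] order.trans[OF *])
  qed
  have smult_closed: "a \<odot>\<^bsub>?F\<^esub> c \<in> carrier ?F" if "a \<in> carrier R" "c \<in> carrier ?F" for a c
  proof -
    have *: "{m. a \<otimes>\<^bsub>R\<^esub> c m \<noteq> \<zero>\<^bsub>R\<^esub>} \<subseteq> {m. c m \<noteq> \<zero>\<^bsub>R\<^esub>}" using that by auto
    have "finite {m. c m \<noteq> \<zero>\<^bsub>R\<^esub>}" "{m. c m \<noteq> \<zero>\<^bsub>R\<^esub>} \<subseteq> A" "\<forall>m. a \<otimes>\<^bsub>R\<^esub> c m \<in> carrier R"
      using that unfolding mem by simp_all
    then show ?thesis unfolding mem smult by (intro conjI finite_subset[OF *] order.trans[OF *])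
  qed
  have ev: "c m \<in> carrier R" if "c \<in> carrier ?F" for c m
    using that by (simp add: mem)
  have neg: "\<exists>d\<in>carrier ?F. d \<oplus>\<^bsub>?F\<^esub> c = \<zero>\<^bsub>?F\<^esub>" if "c \<in> carrier ?F" for c
  proof (rule bexI)
    show "(\<ominus>\<^bsub>R\<^esub> \<one>\<^bsub>R\<^esub>) \<odot>\<^bsub>?F\<^esub> c \<in> carrier ?F" using that by (intro smult_closed) auto
    show "((\<ominus>\<^bsub>R\<^esub> \<one>\<^bsub>R\<^esub>) \<odot>\<^bsub>?F\<^esub> c) \<oplus>\<^bsub>?F\<^esub> c = \<zero>\<^bsub>?F\<^esub>"
      unfolding add smult zero using ev[OF that] by (simp add: R.l_minus R.l_neg)
  qed
  have "abelian_group ?F"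
  proof (rule abelian_groupI)
    show "\<zero>\<^bsub>?F\<^esub> \<in> carrier ?F" by (simp add: mem zero)
    show "x \<oplus>\<^bsub>?F\<^esub> y \<oplus>\<^bsub>?F\<^esub> z = x \<oplus>\<^bsub>?F\<^esub> (y \<oplus>\<^bsub>?F\<^esub> z)"
      if "x \<in> carrier ?F" "y \<in> carrier ?F" "z \<in> carrier ?F" for x y z
      using ev[OF that(1)] ev[OF that(2)] ev[OF that(3)] by (simp add: add R.a_assoc)
    show "x \<oplus>\<^bsub>?F\<^esub> y = y \<oplus>\<^bsub>?F\<^esub> x" if "x \<in> carrier ?F" "y \<in> carrier ?F" for x y
      using ev[OF that(1)] ev[OF that(2)] by (simp add: add R.a_comm)
    show "\<zero>\<^bsub>?F\<^esub> \<oplus>\<^bsub>?F\<^esub> x = x" if "x \<in> carrier ?F" for x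
      using ev[OF that] by (simp add: add zero)
  qed (fact add_closed neg)+
  then show ?thesis
    by (intro moduleI assms smult_closed)
      (simp_all add: add smult ev R.l_distr R.r_distr R.m_assoc)
qed

definition free_lin :: "('r, 's) ring_scheme \<Rightarrow> ('r, 'n, 'z) module_scheme \<Rightarrow> ('m \<Rightarrow> 'n) \<Rightarrow> ('m \<Rightarrow> 'r) \<Rightarrow> 'n"
  where "free_lin R N n c = (\<Oplus>\<^bsub>N\<^esub>m\<in>{m. c m \<noteq> \<zero>\<^bsub>R\<^esub>}. c m \<odot>\<^bsub>N\<^esub> n m)"

lemma free_lin_superset:
  assumes "module R N" "c \<in> carrier (free_module R A)" "n \<in> A \<rightarrow> carrier N"
    and "finite S" "S \<subseteq> A" "{m. c m \<noteq> \<zero>\<^bsub>R\<^esub>} \<subseteq> S"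
  shows "free_lin R N n c = (\<Oplus>\<^bsub>N\<^esub>m\<in>S. c m \<odot>\<^bsub>N\<^esub> n m)"
proof -
  interpret N: module R N by fact
  have ev: "c m \<in> carrier R" for m
    using assms(2) by (auto simp: free_module_def)
  have n: "n m \<in> carrier N" if "m \<in> S" for m
    using that assms(3,5) by blast
  show ?thesis unfolding free_lin_def
    using assms(4,6) ev n by (intro N.M.add.finprod_mono_neutral_cong_left) auto
qed

lemma free_lin_hom:
  assumes "module R N" "n \<in> A \<rightarrow> carrier N"
  shows "free_lin R N n \<in> module_hom R (free_module R A) N"
proof -
  interpret N: module R N by fact
  note * = module_free_module[OF N.R.is_cring, of A]
  interpret F: module R "free_module R A" by fact
  have ev: "c m \<in> carrier R" if "c \<in> carrier (free_module R A)" for c m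
    using that by (auto simp: free_module_def)
  have supp: "finite {m. c m \<noteq> \<zero>\<^bsub>R\<^esub>}" "{m. c m \<noteq> \<zero>\<^bsub>R\<^esub>} \<subseteq> A"
    if "c \<in> carrier (free_module R A)" for c
    using that by (auto simp: free_module_def)
  have "free_lin R N n c \<in> carrier N" if c: "c \<in> carrier (free_module R A)" for c
    unfolding free_lin_def using ev[OF c] supp[OF c] assms(2)
    by (intro N.M.finsum_closed) (auto simp: Pi_def)
  moreover have "free_lin R N n (c \<oplus>\<^bsub>free_module R A\<^esub> d) = free_lin R N n c \<oplus>\<^bsub>N\<^esub> free_lin R N n d"
    if c: "c \<in> carrier (free_module R A)" and d: "d \<in> carrier (free_module R A)" for c d
  proof -
    let ?S = "{m. c m \<noteq> \<zero>\<^bsub>R\<^esub>} \<union> {m. d m \<noteq> \<zero>\<^bsub>R\<^esub>}"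
    have S: "finite ?S" "?S \<subseteq> A" using supp[OF c] supp[OF d] by auto
    have n: "n m \<in> carrier N" if "m \<in> ?S" for m using that S(2) assms(2) by blast
    have "free_lin R N n (c \<oplus>\<^bsub>free_module R A\<^esub> d)
        = (\<Oplus>\<^bsub>N\<^esub>m\<in>?S. (c \<oplus>\<^bsub>free_module R A\<^esub> d) m \<odot>\<^bsub>N\<^esub> n m)"
      by (rule free_lin_superset[OF assms(1) F.M.a_closed[OF c d] assms(2) S]) (auto simp: free_module_def)
    also have "\<dots> = (\<Oplus>\<^bsub>N\<^esub>m\<in>?S. c m \<odot>\<^bsub>N\<^esub> n m \<oplus>\<^bsub>N\<^esub> d m \<odot>\<^bsub>N\<^esub> n m)"
      using ev[OF c] ev[OF d] n
      by (intro N.M.finsum_cong') (auto simp: free_module_def N.smult_l_distr)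
    also have "\<dots> = (\<Oplus>\<^bsub>N\<^esub>m\<in>?S. c m \<odot>\<^bsub>N\<^esub> n m) \<oplus>\<^bsub>N\<^esub> (\<Oplus>\<^bsub>N\<^esub>m\<in>?S. d m \<odot>\<^bsub>N\<^esub> n m)"
      using ev[OF c] ev[OF d] n by (intro N.M.finsum_addf) auto
    also have "\<dots> = free_lin R N n c \<oplus>\<^bsub>N\<^esub> free_lin R N n d"
      using free_lin_superset[OF assms(1) c assms(2) S] free_lin_superset[OF assms(1) d assms(2) S] by auto
    finally show ?thesis .
  qed
  moreover have "free_lin R N n (a \<odot>\<^bsub>free_module R A\<^esub> c) = a \<odot>\<^bsub>N\<^esub> free_lin R N n c"
    if a: "a \<in> carrier R" and c: "c \<in> carrier (free_module R A)" for a c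
  proof -
    let ?S = "{m. c m \<noteq> \<zero>\<^bsub>R\<^esub>}"
    have n: "n m \<in> carrier N" if "m \<in> ?S" for m using that supp[OF c] assms(2) by blast
    have "free_lin R N n (a \<odot>\<^bsub>free_module R A\<^esub> c)
        = (\<Oplus>\<^bsub>N\<^esub>m\<in>?S. (a \<odot>\<^bsub>free_module R A\<^esub> c) m \<odot>\<^bsub>N\<^esub> n m)"
      by (rule free_lin_superset[OF assms(1) F.smult_closed[OF a c] assms(2) supp[OF c]])
        (use a in \<open>auto simp: free_module_def\<close>)
    also have "\<dots> = (\<Oplus>\<^bsub>N\<^esub>m\<in>?S. a \<odot>\<^bsub>N\<^esub> (c m \<odot>\<^bsub>N\<^esub> n m))"
      using ev[OF c] n a by (intro N.M.finsum_cong') (auto simp: free_module_def N.smult_assoc1)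
    also have "\<dots> = a \<odot>\<^bsub>N\<^esub> free_lin R N n c"
      unfolding free_lin_def using ev[OF c] n a supp[OF c] by (subst N.finsum_smult_ldistr) auto
    finally show ?thesis .
  qed
  ultimately show ?thesis by (auto simp: module_hom_def)
qed

lemma projective_module_lift:
  assumes "projective_module R M" "module R N" "module R N'"
    and p: "p \<in> module_hom R N N'" and surj: "p ` carrier N = carrier N'"
    and f: "f \<in> module_hom R M N'"
  shows "\<exists>h\<in>module_hom R M N. \<forall>x\<in>carrier M. p (h x) = f x"
proof -
  have M: "module R M" using assms(1) by (simp add: projective_module_def)
  interpret M: module R M by fact
  interpret N: module R N by fact
  interpret N': module R N' by fact
  let ?F = "free_module R (carrier M)"
  note F = module_free_module[OF M.R.is_cring, of "carrier M"]
  interpret F: module R ?F by fact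
  let ?M = "\<lparr>carrier = carrier M, mult = mult M, one = \<one>\<^bsub>M\<^esub>, ring.zero = \<zero>\<^bsub>M\<^esub>,
    add = add M, smult = smult M\<rparr>"
  have "abelian_group ?M"
  proof (rule abelian_groupI)
    fix x assume "x \<in> carrier ?M"
    then show "\<exists>y\<in>carrier ?M. y \<oplus>\<^bsub>?M\<^esub> x = \<zero>\<^bsub>?M\<^esub>"
      using M.M.l_neg[of x] M.M.a_inv_closed[of x] by auto
  qed (auto simp: M.M.a_ac)
  then have M': "module R ?M"
    by (intro moduleI M.R.is_cring) (auto simp: M.smult_l_distr M.smult_r_distr M.smult_assoc1)
  have id: "(\<lambda>x. x) \<in> module_hom R M ?M" by (auto simp: module_hom_def)
  let ?\<pi> = "free_lin R M (\<lambda>x. x)"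
  have \<pi>: "?\<pi> \<in> module_hom R ?F M" by (rule free_lin_hom[OF M]) auto
  then have \<pi>': "?\<pi> \<in> module_hom R ?F ?M" by (auto simp: module_hom_def)
  have "x \<in> ?\<pi> ` carrier ?F" if x: "x \<in> carrier M" for x
  proof (rule image_eqI)
    let ?c = "\<lambda>y. if y = x then \<one>\<^bsub>R\<^esub> else \<zero>\<^bsub>R\<^esub>"
    have "{y. ?c y \<noteq> \<zero>\<^bsub>R\<^esub>} \<subseteq> {x}" by auto
    then show c: "?c \<in> carrier ?F"
      using x finite_subset[of _ "{x}"] by (auto simp: free_module_def)
    show "x = ?\<pi> ?c"
      by (subst free_lin_superset[OF M c, of _ "{x}"]) (use x in auto)
  qed
  then have "?\<pi> ` carrier ?F = carrier ?M"
    using module_hom_closed[OF \<pi>] by auto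
  then obtain s where s: "s \<in> module_hom R M ?F" and \<pi>s: "\<And>x. x \<in> carrier M \<Longrightarrow> ?\<pi> (s x) = x"
    using assms(1) F M' \<pi>' id unfolding projective_module_def by blast
  have "\<forall>x\<in>carrier M. \<exists>y\<in>carrier N. p y = f x"
    using surj module_hom_closed[OF f] by (metis imageE)
  then obtain n where n: "\<And>x. x \<in> carrier M \<Longrightarrow> n x \<in> carrier N" "\<And>x. x \<in> carrier M \<Longrightarrow> p (n x) = f x"
    by metis
  have h: "free_lin R N n \<in> module_hom R ?F N" by (rule free_lin_hom) (use n assms in auto)
  have ph: "p (free_lin R N n c) = f (?\<pi> c)" if c: "c \<in> carrier ?F" for c
  proof -
    have ev: "c m \<in> carrier R" for m using c by (auto simp: free_module_def)
    have fin: "finite {m. c m \<noteq> \<zero>\<^bsub>R\<^esub>}" and sub: "\<And>m. c m \<noteq> \<zero>\<^bsub>R\<^esub> \<Longrightarrow> m \<in> carrier M"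
      using c by (auto simp: free_module_def)
    have pl: "p (a \<odot>\<^bsub>N\<^esub> x) = a \<odot>\<^bsub>N'\<^esub> p x" if "a \<in> carrier R" "x \<in> carrier N" for a x
      using p that by (auto simp: module_hom_def)
    have fl: "f (a \<odot>\<^bsub>M\<^esub> x) = a \<odot>\<^bsub>N'\<^esub> f x" if "a \<in> carrier R" "x \<in> carrier M" for a x
      using f that by (auto simp: module_hom_def)
    have "p (free_lin R N n c) = (\<Oplus>\<^bsub>N'\<^esub>m\<in>{m. c m \<noteq> \<zero>\<^bsub>R\<^esub>}. p (c m \<odot>\<^bsub>N\<^esub> n m))"
      unfolding free_lin_def using ev sub n fin
      by (intro module_hom_finsum[OF assms(2,3) p]) auto
    also have "\<dots> = (\<Oplus>\<^bsub>N'\<^esub>m\<in>{m. c m \<noteq> \<zero>\<^bsub>R\<^esub>}. f (c m \<odot>\<^bsub>M\<^esub> m))"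
      using ev sub n module_hom_closed[OF f] by (intro N'.M.finsum_cong') (auto simp: pl fl)
    also have "\<dots> = f (?\<pi> c)"
      unfolding free_lin_def using ev sub fin
      by (intro module_hom_finsum[OF M assms(3) f, symmetric]) auto
    finally show ?thesis .
  qed
  show ?thesis
  proof (rule bexI)
    show "\<forall>x\<in>carrier M. p ((free_lin R N n \<circ> s) x) = f x"
      using ph \<pi>s module_hom_closed[OF s] by auto
    show "free_lin R N n \<circ> s \<in> module_hom R M N"
      using s h module_hom_closed[OF s] by (auto simp: module_hom_def Pi_iff)
  qed
qed


subsection \<open>Every BDF module has a model on the chosen type\<close>

definition transport :: "('m \<Rightarrow> 'n) \<Rightarrow> ('a, 'm, 'g) graded_module \<Rightarrow> ('a, 'n, 'g) graded_module"
  where "transport \<phi> M = (let \<psi> = inv_into (carrier M) \<phi> in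
    \<lparr>carrier = \<phi> ` carrier M, mult = (\<lambda>x y. \<phi> (\<psi> x \<otimes>\<^bsub>M\<^esub> \<psi> y)), one = \<phi> \<one>\<^bsub>M\<^esub>,
     ring.zero = \<phi> \<zero>\<^bsub>M\<^esub>, add = (\<lambda>x y. \<phi> (\<psi> x \<oplus>\<^bsub>M\<^esub> \<psi> y)),
     smult = (\<lambda>a x. \<phi> (a \<odot>\<^bsub>M\<^esub> \<psi> x)), component = (\<lambda>g. \<phi> ` component M g)\<rparr>)"

lemma restrict_scalars_transport:
  "restrict_scalars R (transport \<phi> M) = transport \<phi> (restrict_scalars R M)"
  by (simp add: restrict_scalars_def transport_def Let_def)

lemma transport_simps:
  "carrier (transport \<phi> M) = \<phi> ` carrier M" "\<zero>\<^bsub>transport \<phi> M\<^esub> = \<phi> \<zero>\<^bsub>M\<^esub>"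
  "component (transport \<phi> M) g = \<phi> ` component M g"
  by (simp_all add: transport_def Let_def)

lemma transport_ops:
  assumes "inj_on \<phi> (carrier M)"
  shows "\<lbrakk>x \<in> carrier M; y \<in> carrier M\<rbrakk> \<Longrightarrow> \<phi> x \<oplus>\<^bsub>transport \<phi> M\<^esub> \<phi> y = \<phi> (x \<oplus>\<^bsub>M\<^esub> y)"
    and "x \<in> carrier M \<Longrightarrow> a \<odot>\<^bsub>transport \<phi> M\<^esub> \<phi> x = \<phi> (a \<odot>\<^bsub>M\<^esub> x)"
  using assms by (simp_all add: transport_def Let_def)

lemma module_transport:
  assumes "module R M" "inj_on \<phi> (carrier M)"
  shows "module R (transport \<phi> M)"
proof -
  interpret M: module R M by fact
  note ops = transport_ops[OF assms(2)]
  have "abelian_group (transport \<phi> M)"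
  proof (rule abelian_groupI)
    fix x assume "x \<in> carrier (transport \<phi> M)"
    then obtain u where u: "u \<in> carrier M" "x = \<phi> u" by (auto simp: transport_simps)
    show "\<exists>y\<in>carrier (transport \<phi> M). y \<oplus>\<^bsub>transport \<phi> M\<^esub> x = \<zero>\<^bsub>transport \<phi> M\<^esub>"
      by (rule bexI[of _ "\<phi> (\<ominus>\<^bsub>M\<^esub> u)"]) (use u in \<open>simp_all add: transport_simps ops M.M.l_neg\<close>)
  qed (auto simp: transport_simps ops M.M.a_ac)
  then show ?thesis
    by (intro moduleI M.R.is_cring)
      (auto simp: transport_simps ops M.smult_l_distr M.smult_r_distr M.smult_assoc1)
qed

lemma transport_hom:
  assumes "module R M" "inj_on \<phi> (carrier M)"
  shows "\<phi> \<in> module_hom R M (transport \<phi> M)"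
  using transport_ops[OF assms(2)] by (auto simp: module_hom_def transport_simps)

lemma transport_hom_inv:
  assumes "module R M" "inj_on \<phi> (carrier M)"
  shows "inv_into (carrier M) \<phi> \<in> module_hom R (transport \<phi> M) M"
proof -
  interpret M: module R M by fact
  show ?thesis
    using transport_ops[OF assms(2)] assms(2) by (auto simp: module_hom_def transport_simps)
qed

lemma submodule_transport:
  assumes "module K V" "inj_on \<phi> (carrier V)" "submodule H K V"
  shows "submodule (\<phi> ` H) K (transport \<phi> V)"
proof -
  interpret V: module K V by fact
  interpret N: module K "transport \<phi> V" by (rule module_transport) fact+
  interpret H: submodule H K V by fact
  note E = V.submoduleE[OF assms(3)]
  note ops = transport_ops[OF assms(2)]
  have H: "x \<in> carrier V" if "x \<in> H" for x using that E(1) by blast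
  have inv: "\<ominus>\<^bsub>transport \<phi> V\<^esub> \<phi> x = \<phi> (\<ominus>\<^bsub>V\<^esub> x)" if "x \<in> carrier V" for x
    by (rule N.M.minus_equality) (use that in \<open>auto simp: ops transport_simps V.M.l_neg\<close>)
  have "\<zero>\<^bsub>V\<^esub> \<in> H" using H.one_closed by simp
  then show ?thesis
    by (intro N.submoduleI) (auto simp: transport_simps ops inv H intro!: imageI E)
qed

lemma graded_space_component_closed:
  assumes "graded_space K V" "x \<in> component V g"
  shows "x \<in> carrier V"
proof -
  interpret V: module K V using assms(1) by (simp add: graded_space_def)
  show ?thesis using assms V.submoduleE(1)[of "component V g"] by (auto simp: graded_space_def)
qed

lemma graded_space_transport:
  assumes V: "graded_space K V" and inj: "inj_on \<phi> (carrier V)"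
  shows "graded_space K (transport \<phi> V)"
proof -
  let ?N = "transport \<phi> V" and ?\<psi> = "inv_into (carrier V) \<phi>"
  have mod: "module K V" using V by (simp add: graded_space_def)
  have modN: "module K ?N" by (rule module_transport) fact+
  interpret V: module K V by fact
  interpret N: module K ?N by fact
  note comp = graded_space_component_closed[OF V]
  note hom = transport_hom[OF mod inj] and homi = transport_hom_inv[OF mod inj]
  have "\<exists>!f. (\<forall>g. f g \<in> component ?N g) \<and> finite {g. f g \<noteq> \<zero>\<^bsub>?N\<^esub>} \<and>
       v = (\<Oplus>\<^bsub>?N\<^esub>g\<in>{g. f g \<noteq> \<zero>\<^bsub>?N\<^esub>}. f g)" if v: "v \<in> carrier ?N" for v
  proof -
    obtain u where u: "u \<in> carrier V" "v = \<phi> u" using v by (auto simp: transport_simps)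
    then obtain f where f: "\<And>g. f g \<in> component V g" "finite {g. f g \<noteq> \<zero>\<^bsub>V\<^esub>}"
        "u = (\<Oplus>\<^bsub>V\<^esub>g\<in>{g. f g \<noteq> \<zero>\<^bsub>V\<^esub>}. f g)"
      and uniq: "\<And>f'. (\<And>g. f' g \<in> component V g) \<Longrightarrow> finite {g. f' g \<noteq> \<zero>\<^bsub>V\<^esub>} \<Longrightarrow>
        u = (\<Oplus>\<^bsub>V\<^esub>g\<in>{g. f' g \<noteq> \<zero>\<^bsub>V\<^esub>}. f' g) \<Longrightarrow> f' = f"
      using V unfolding graded_space_def by metis
    have z: "\<phi> x = \<phi> \<zero>\<^bsub>V\<^esub> \<longleftrightarrow> x = \<zero>\<^bsub>V\<^esub>" if "x \<in> carrier V" for x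
      using inj that by (auto simp: inj_on_def)
    show ?thesis
    proof (rule ex1I[of _ "\<lambda>g. \<phi> (f g)"])
      have S: "{g. \<phi> (f g) \<noteq> \<zero>\<^bsub>?N\<^esub>} = {g. f g \<noteq> \<zero>\<^bsub>V\<^esub>}"
        using z comp[OF f(1)] by (auto simp: transport_simps)
      show "(\<forall>g. \<phi> (f g) \<in> component ?N g) \<and> finite {g. \<phi> (f g) \<noteq> \<zero>\<^bsub>?N\<^esub>} \<and>
        v = (\<Oplus>\<^bsub>?N\<^esub>g\<in>{g. \<phi> (f g) \<noteq> \<zero>\<^bsub>?N\<^esub>}. \<phi> (f g))"
        unfolding S u(2)
        using module_hom_finsum[OF mod modN hom f(2), of f] f comp[OF f(1)]
        by (auto simp: transport_simps)
    next
      fix h assume h: "(\<forall>g. h g \<in> component ?N g) \<and> finite {g. h g \<noteq> \<zero>\<^bsub>?N\<^esub>} \<and>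
        v = (\<Oplus>\<^bsub>?N\<^esub>g\<in>{g. h g \<noteq> \<zero>\<^bsub>?N\<^esub>}. h g)"
      have "\<forall>g. \<exists>y\<in>component V g. h g = \<phi> y" using h by (auto simp: transport_simps)
      then obtain f' where f': "\<And>g. f' g \<in> component V g" "\<And>g. h g = \<phi> (f' g)" by metis
      note c = comp[OF f'(1)]
      have S: "{g. h g \<noteq> \<zero>\<^bsub>?N\<^esub>} = {g. f' g \<noteq> \<zero>\<^bsub>V\<^esub>}"
        using z c by (auto simp: f'(2) transport_simps)
      have fin: "finite {g. f' g \<noteq> \<zero>\<^bsub>V\<^esub>}" using h S by simp
      have "\<phi> u = (\<Oplus>\<^bsub>?N\<^esub>g\<in>{g. f' g \<noteq> \<zero>\<^bsub>V\<^esub>}. \<phi> (f' g))"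
        using h unfolding S u(2) by (simp add: f'(2))
      also have "\<dots> = \<phi> (\<Oplus>\<^bsub>V\<^esub>g\<in>{g. f' g \<noteq> \<zero>\<^bsub>V\<^esub>}. f' g)"
        using module_hom_finsum[OF mod modN hom fin, of f'] c by auto
      finally have "u = (\<Oplus>\<^bsub>V\<^esub>g\<in>{g. f' g \<noteq> \<zero>\<^bsub>V\<^esub>}. f' g)"
        using inj u(1) c by (auto simp: inj_on_def Pi_def)
      then have "f' = f" by (intro uniq f' fin)
      then show "h = (\<lambda>g. \<phi> (f g))" using f'(2) by auto
    qed
  qed
  moreover have "\<forall>g. submodule (component ?N g) K ?N"
    using submodule_transport[OF mod inj] V by (auto simp: transport_simps graded_space_def)
  ultimately show ?thesis using modN by (auto simp: graded_space_def)
qed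

lemma finite_dimensional_transport:
  assumes mod: "module K V" and inj: "inj_on \<phi> (carrier V)" and "W \<subseteq> carrier V"
    and "finite_dimensional K V W"
  shows "finite_dimensional K (transport \<phi> V) (\<phi> ` W)"
proof -
  let ?N = "transport \<phi> V" and ?\<psi> = "inv_into (carrier V) \<phi>"
  have modN: "module K ?N" by (rule module_transport) fact+
  interpret V: module K V by fact
  interpret N: module K ?N by fact
  obtain B where B: "finite B" "B \<subseteq> W"
    "\<And>w. w \<in> W \<Longrightarrow> \<exists>c\<in>B \<rightarrow> carrier K. w = (\<Oplus>\<^bsub>V\<^esub>b\<in>B. c b \<odot>\<^bsub>V\<^esub> b)"
    using assms(4) unfolding finite_dimensional_def by blast
  have Bc: "b \<in> carrier V" if "b \<in> B" for b using that B(2) assms(3) by blast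
  have injB: "inj_on \<phi> B" using inj Bc by (meson inj_on_subset subsetI)
  have "\<exists>c\<in>\<phi> ` B \<rightarrow> carrier K. \<phi> w = (\<Oplus>\<^bsub>?N\<^esub>b\<in>\<phi> ` B. c b \<odot>\<^bsub>?N\<^esub> b)" if "w \<in> W" for w
  proof -
    obtain c where c: "c \<in> B \<rightarrow> carrier K" "w = (\<Oplus>\<^bsub>V\<^esub>b\<in>B. c b \<odot>\<^bsub>V\<^esub> b)"
      using B(3)[OF \<open>w \<in> W\<close>] by blast
    have cc: "c b \<in> carrier K" if "b \<in> B" for b using that c(1) by blast
    have psi: "?\<psi> (\<phi> b) = b" if "b \<in> B" for b using that inj Bc by simp
    have "\<phi> w = (\<Oplus>\<^bsub>?N\<^esub>b\<in>B. \<phi> (c b \<odot>\<^bsub>V\<^esub> b))"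
      unfolding c(2) using cc Bc
      by (intro module_hom_finsum[OF mod modN transport_hom[OF mod inj] B(1)]) auto
    also have "\<dots> = (\<Oplus>\<^bsub>?N\<^esub>b\<in>B. c (?\<psi> (\<phi> b)) \<odot>\<^bsub>?N\<^esub> \<phi> b)"
      using cc Bc by (intro N.M.finsum_cong') (auto simp: psi transport_ops[OF inj] transport_simps)
    also have "\<dots> = (\<Oplus>\<^bsub>?N\<^esub>b\<in>\<phi> ` B. c (?\<psi> b) \<odot>\<^bsub>?N\<^esub> b)"
    proof (rule N.M.finsum_reindex[OF _ injB, symmetric])
      show "(\<lambda>b. c (?\<psi> b) \<odot>\<^bsub>?N\<^esub> b) \<in> \<phi> ` B \<rightarrow> carrier ?N"
        using cc Bc by (auto simp: psi transport_ops[OF inj] transport_simps)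
    qed
    finally have "\<phi> w = (\<Oplus>\<^bsub>?N\<^esub>b\<in>\<phi> ` B. c (?\<psi> b) \<odot>\<^bsub>?N\<^esub> b)" .
    moreover have "(\<lambda>b. c (?\<psi> b)) \<in> \<phi> ` B \<rightarrow> carrier K" using cc psi by auto
    ultimately show ?thesis by (rule bexI)
  qed
  then show ?thesis unfolding finite_dimensional_def
    using B(1,2) by (intro exI[of _ "\<phi> ` B"]) auto
qed

lemma bdf_module_transport:
  assumes M: "bdf_module K R M" and inj: "inj_on \<phi> (carrier M)"
  shows "bdf_module K R (transport \<phi> M)" "graded_isomorphic R M (transport \<phi> M)"
proof -
  let ?V = "restrict_scalars R M"
  have gm: "is_graded_module K R M" using M by (simp add: bdf_module_def)
  then have mod: "module R M" and gs: "graded_space K ?V" by (auto simp: is_graded_module_def)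
  interpret M: module R M by fact
  have rs: "carrier ?V = carrier M" "component ?V = component M" "\<zero>\<^bsub>?V\<^esub> = \<zero>\<^bsub>M\<^esub>"
    by (simp_all add: restrict_scalars_def)
  have injV: "inj_on \<phi> (carrier ?V)" using inj by (simp add: rs)
  have modV: "module K ?V" using gs by (simp add: graded_space_def)
  have comp: "x \<in> carrier M" if "x \<in> component M g" for x g
    using graded_space_component_closed[OF gs, of x g] that by (simp add: rs)
  have "\<phi> ` component M g = {\<phi> \<zero>\<^bsub>M\<^esub>} \<longleftrightarrow> component M g = {\<zero>\<^bsub>M\<^esub>}" for g
    using inj_on_image_eq_iff[OF inj, of "component M g" "{\<zero>\<^bsub>M\<^esub>}"] comp by auto
  then have supp: "support (transport \<phi> M) = support M"
    by (simp add: support_def transport_simps)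
  have "a \<odot>\<^bsub>transport \<phi> M\<^esub> m \<in> component (transport \<phi> M) (g + h)"
    if "a \<in> component R g" "m \<in> component (transport \<phi> M) h" for a m g h
    using that gm comp by (auto simp: transport_simps transport_ops[OF inj] is_graded_module_def)
  then have "is_graded_module K R (transport \<phi> M)"
    unfolding is_graded_module_def restrict_scalars_transport
    using module_transport[OF mod inj] graded_space_transport[OF gs injV] by blast
  moreover have "finite_dimensional K (transport \<phi> ?V) (\<phi> ` component M g)" for g
    using M comp by (intro finite_dimensional_transport[OF modV injV]) (auto simp: rs bdf_module_def)
  ultimately show "bdf_module K R (transport \<phi> M)"
    using M unfolding bdf_module_def supp restrict_scalars_transport transport_simps by blast
  show "graded_isomorphic R M (transport \<phi> M)"
    unfolding graded_isomorphic_def graded_hom_def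
    using transport_hom[OF mod inj] inj by (auto simp: transport_simps bij_betw_def intro!: bexI[of _ \<phi>])
qed

lemma bdf_module_model:
  fixes R :: "('k, 'r, 'g::ab_group_add) graded_module" and M :: "('r, 'm, 'g) graded_module"
  assumes "bdf_module K R M"
  shows "\<exists>N :: ('k, 'r, 'g) model. bdf_module K R N \<and> graded_isomorphic R M N"
proof -
  let ?V = "restrict_scalars R M"
  have gs: "graded_space K ?V" and fd: "\<And>g. finite_dimensional K ?V (component M g)"
    using assms by (auto simp: bdf_module_def is_graded_module_def)
  have rs: "carrier ?V = carrier M" "component ?V = component M"
    by (simp_all add: restrict_scalars_def)
  obtain B where B: "\<And>g. finite (B g)"
    "\<And>g. \<forall>w\<in>component M g. \<exists>c\<in>B g \<rightarrow> carrier K. w = (\<Oplus>\<^bsub>?V\<^esub>b\<in>B g. c b \<odot>\<^bsub>?V\<^esub> b)"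
    and Bc: "\<And>g. B g \<subseteq> component M g"
  proof -
    have "\<forall>g. \<exists>B. finite B \<and> B \<subseteq> component M g \<and>
        (\<forall>w\<in>component M g. \<exists>c\<in>B \<rightarrow> carrier K. w = (\<Oplus>\<^bsub>?V\<^esub>b\<in>B. c b \<odot>\<^bsub>?V\<^esub> b))"
      using fd by (simp add: finite_dimensional_def)
    from choice[OF this] that show thesis by blast
  qed
  have "\<forall>g. \<exists>e :: 'm \<Rightarrow> nat. inj_on e (B g)"
    using finite_imp_inj_to_nat_seg[OF B(1)] by blast
  from choice[OF this] obtain e :: "'g \<Rightarrow> 'm \<Rightarrow> nat" where e: "\<And>g. inj_on (e g) (B g)" by blast
  obtain c where c: "\<And>g w. w \<in> component M g \<Longrightarrow> c g w \<in> B g \<rightarrow> carrier K"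
    "\<And>g w. w \<in> component M g \<Longrightarrow> w = (\<Oplus>\<^bsub>?V\<^esub>b\<in>B g. c g w b \<odot>\<^bsub>?V\<^esub> b)"
  proof -
    have "\<forall>g w. \<exists>c. w \<in> component M g \<longrightarrow>
        c \<in> B g \<rightarrow> carrier K \<and> w = (\<Oplus>\<^bsub>?V\<^esub>b\<in>B g. c b \<odot>\<^bsub>?V\<^esub> b)"
      using B(2) by blast
    then have "\<exists>c. \<forall>g w. w \<in> component M g \<longrightarrow>
        c g w \<in> B g \<rightarrow> carrier K \<and> w = (\<Oplus>\<^bsub>?V\<^esub>b\<in>B g. c g w b \<odot>\<^bsub>?V\<^esub> b)"
      by (simp only: choice_iff)
    then show thesis using that by blast
  qed
  have "\<forall>m\<in>carrier M. \<exists>f. (\<forall>g. f g \<in> component M g) \<and>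
      m = (\<Oplus>\<^bsub>?V\<^esub>g\<in>{g. f g \<noteq> \<zero>\<^bsub>?V\<^esub>}. f g)"
    using gs unfolding graded_space_def rs by blast
  from bchoice[OF this] obtain D where
      D': "\<forall>m\<in>carrier M. (\<forall>g. D m g \<in> component M g) \<and>
        m = (\<Oplus>\<^bsub>?V\<^esub>g\<in>{g. D m g \<noteq> \<zero>\<^bsub>?V\<^esub>}. D m g)" ..
  have D: "\<And>m g. m \<in> carrier M \<Longrightarrow> D m g \<in> component M g"
    "\<And>m. m \<in> carrier M \<Longrightarrow> m = (\<Oplus>\<^bsub>?V\<^esub>g\<in>{g. D m g \<noteq> \<zero>\<^bsub>?V\<^esub>}. D m g)"
    using bspec[OF D'] by auto
  define \<phi> where "\<phi> m = (\<lambda>(g, i). c g (D m g) (inv_into (B g) (e g) i))" for m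
  interpret V: module K ?V using gs by (simp add: graded_space_def)
  have "inj_on \<phi> (carrier M)"
  proof (rule inj_onI)
    fix x y assume x: "x \<in> carrier M" and y: "y \<in> carrier M" and eq: "\<phi> x = \<phi> y"
    have "D x g = D y g" for g
    proof -
      have cb: "c g (D x g) b = c g (D y g) b" if "b \<in> B g" for b
        using fun_cong[OF eq, of "(g, e g b)"] that e[of g] by (simp add: \<phi>_def)
      have "b \<in> carrier ?V" if "b \<in> B g" for b
        using that Bc graded_space_component_closed[OF gs, of b g] by (auto simp: rs)
      then have "(\<Oplus>\<^bsub>?V\<^esub>b\<in>B g. c g (D x g) b \<odot>\<^bsub>?V\<^esub> b) = (\<Oplus>\<^bsub>?V\<^esub>b\<in>B g. c g (D y g) b \<odot>\<^bsub>?V\<^esub> b)"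
        using c(1)[OF D(1)[OF y]] cb by (intro V.M.finsum_cong') auto
      then show ?thesis using c(2)[OF D(1)[OF x, of g]] c(2)[OF D(1)[OF y, of g]] by simp
    qed
    then have "D x = D y" by auto
    then show "x = y" using D(2)[OF x] D(2)[OF y] by simp
  qed
  from bdf_module_transport[OF assms this] show ?thesis by blast
qed

end

(*
The class of a BDF module M in G_0 depends only on its Hilbert function. Let ht(g) be the number of
degrees u <= g of M, let M_i be the submodule of degrees of height at least i, and let T be the direct sum of the M_i over i >= 0. Every degree
occurs in only finitely many M_i, so T is BDF. Both M_0 = M and the direct sum of the quotients M_i / M_(i+1)
are quotients of T by a copy of the direct sum of the M_i over i >= 1, hence they have the same class. Since
R_+ raises the height, it annihilates the second one, which is therefore determined by dimensions.

The Hilbert function of R has value 1 at 0, so the Hilbert function of M is the convolution of it with a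
unique integer-valued function c; the positive and negative parts of c are the multiplicities of two free
modules whose difference is [M]. Conversely, projective BDF modules are free by a graded Nakayama argument,
and a free module is determined by its Hilbert function, which is additive on short exact sequences.
*)
theory Submission
  imports Defs
begin

section \<open>Finite-dimensional linear algebra\<close>

text \<open>The obstacle is that the height filtration of M can be infinite, while the relations of
  G_0 only add up finitely many layers. Counting the support below a degree gives a height that is
  finite in every degree and rises strictly whenever R_+ carries an element to a nonzero one.
  Finiteness lets all steps be stacked in one BDF module, so that two short exact sequences with the
  same middle term replace an infinite telescoping sum; strictness makes the projection onto the
  layers linear over R. The same finiteness below each degree drives the remaining arguments.
  Multiplicities and Hilbert functions of free modules are related by a triangular system whose
  diagonal entry is dim R_0 = 1; this is why it can be solved over the integers by recursion on the
  degree. Thus the Hilbert function is a complete invariant both of classes in G_0 and of projective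
  BDF modules. The modules built on the way live on types of tuples and pairs, whereas classes
  consist of modules on one model type. Statements about classes are therefore proved for modules on
  arbitrary types, with \<open>bdf_module_model\<close> as the bridge.\<close>

locale kspace = fixes K :: "('k, 'x) ring_scheme" and V :: "('k, 'v, 'y) module_scheme"
  assumes field_K: "field K" and module_V: "module K V"
begin

sublocale K: field K by (rule field_K)
sublocale V: module K V by (rule module_V)

text \<open>Bookkeeping for the elimination in \<open>dependent_of_card_gt\<close>, with
  \<open>x\<close> the pivot: a relation among the shifted vectors becomes a relation among the
  original ones, the shifts being collected in the coefficient of \<open>x\<close>.\<close>

lemma finsum_smult_shift:
  assumes "finite A" "c \<in> A \<rightarrow> carrier K" "s \<in> A \<rightarrow> carrier K" "v \<in> A \<rightarrow> carrier V" "x \<in> carrier V"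
  shows "(\<Oplus>\<^bsub>V\<^esub>j\<in>A. c j \<odot>\<^bsub>V\<^esub> (v j \<oplus>\<^bsub>V\<^esub> s j \<odot>\<^bsub>V\<^esub> x)) =
    (\<Oplus>\<^bsub>V\<^esub>j\<in>A. c j \<odot>\<^bsub>V\<^esub> v j) \<oplus>\<^bsub>V\<^esub> (\<Oplus>\<^bsub>K\<^esub>j\<in>A. c j \<otimes>\<^bsub>K\<^esub> s j) \<odot>\<^bsub>V\<^esub> x"
  using assms
proof (induction A)
  case (insert a A)
  have [simp]: "(\<Oplus>\<^bsub>V\<^esub>j\<in>A. c j \<odot>\<^bsub>V\<^esub> v j) \<in> carrier V" "(\<Oplus>\<^bsub>K\<^esub>j\<in>A. c j \<otimes>\<^bsub>K\<^esub> s j) \<in> carrier K"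
    using insert.prems by (auto intro!: V.M.finsum_closed K.finsum_closed)
  have "(\<Oplus>\<^bsub>V\<^esub>j\<in>insert a A. c j \<odot>\<^bsub>V\<^esub> (v j \<oplus>\<^bsub>V\<^esub> s j \<odot>\<^bsub>V\<^esub> x)) =
     c a \<odot>\<^bsub>V\<^esub> (v a \<oplus>\<^bsub>V\<^esub> s a \<odot>\<^bsub>V\<^esub> x) \<oplus>\<^bsub>V\<^esub> (\<Oplus>\<^bsub>V\<^esub>j\<in>A. c j \<odot>\<^bsub>V\<^esub> (v j \<oplus>\<^bsub>V\<^esub> s j \<odot>\<^bsub>V\<^esub> x))"
    using insert by (subst V.M.finsum_insert) (auto simp: Pi_iff)
  also have "\<dots> = (c a \<odot>\<^bsub>V\<^esub> v a \<oplus>\<^bsub>V\<^esub> (c a \<otimes>\<^bsub>K\<^esub> s a) \<odot>\<^bsub>V\<^esub> x) \<oplus>\<^bsub>V\<^esub>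
     ((\<Oplus>\<^bsub>V\<^esub>j\<in>A. c j \<odot>\<^bsub>V\<^esub> v j) \<oplus>\<^bsub>V\<^esub> (\<Oplus>\<^bsub>K\<^esub>j\<in>A. c j \<otimes>\<^bsub>K\<^esub> s j) \<odot>\<^bsub>V\<^esub> x)"
    using insert by (simp add: V.smult_r_distr V.smult_assoc1)
  also have "\<dots> = (\<Oplus>\<^bsub>V\<^esub>j\<in>insert a A. c j \<odot>\<^bsub>V\<^esub> v j) \<oplus>\<^bsub>V\<^esub> (\<Oplus>\<^bsub>K\<^esub>j\<in>insert a A. c j \<otimes>\<^bsub>K\<^esub> s j) \<odot>\<^bsub>V\<^esub> x"
    using insert by (simp add: V.smult_l_distr V.M.a_ac Pi_iff)
  finally show ?case .
qed (simp)

text \<open>Families are indexed by an initial segment of the naturals and may repeat vectors; this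
  lets vectors be split off at the end by \<open>comb_Suc\<close> and families be concatenated by
  \<open>comb_split\<close>.\<close>

definition comb :: "nat \<Rightarrow> (nat \<Rightarrow> 'k) \<Rightarrow> (nat \<Rightarrow> 'v) \<Rightarrow> 'v"
  where "comb n c b = (\<Oplus>\<^bsub>V\<^esub>i\<in>{..<n}. c i \<odot>\<^bsub>V\<^esub> b i)"

lemma comb_closed [simp, intro]:
  "\<lbrakk>\<And>i. i < n \<Longrightarrow> c i \<in> carrier K; \<And>i. i < n \<Longrightarrow> b i \<in> carrier V\<rbrakk> \<Longrightarrow> comb n c b \<in> carrier V"
  by (auto simp: comb_def intro!: V.M.finsum_closed)

lemma comb_cong:
  assumes "\<And>i. i < n \<Longrightarrow> c i = c' i" "\<And>i. i < n \<Longrightarrow> b i = b' i"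
    and "\<And>i. i < n \<Longrightarrow> c i \<in> carrier K" "\<And>i. i < n \<Longrightarrow> b i \<in> carrier V"
  shows "comb n c b = comb n c' b'"
  unfolding comb_def using assms by (intro V.M.finsum_cong') auto

lemma comb_Suc:
  "\<lbrakk>\<And>i. i < Suc n \<Longrightarrow> c i \<in> carrier K; \<And>i. i < Suc n \<Longrightarrow> b i \<in> carrier V\<rbrakk> \<Longrightarrow>
    comb (Suc n) c b = comb n c b \<oplus>\<^bsub>V\<^esub> c n \<odot>\<^bsub>V\<^esub> b n"
  unfolding comb_def lessThan_Suc by (subst V.M.finsum_insert) (auto simp: V.M.a_comm intro!: V.M.a_comm V.M.finsum_closed)

lemma comb_zero [simp]: "comb 0 c b = \<zero>\<^bsub>V\<^esub>"
  by (simp add: comb_def)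

lemma comb_add:
  assumes "\<And>i. i < n \<Longrightarrow> c i \<in> carrier K" "\<And>i. i < n \<Longrightarrow> d i \<in> carrier K" "\<And>i. i < n \<Longrightarrow> b i \<in> carrier V"
  shows "comb n (\<lambda>i. c i \<oplus>\<^bsub>K\<^esub> d i) b = comb n c b \<oplus>\<^bsub>V\<^esub> comb n d b"
proof -
  have "comb n (\<lambda>i. c i \<oplus>\<^bsub>K\<^esub> d i) b = (\<Oplus>\<^bsub>V\<^esub>i\<in>{..<n}. c i \<odot>\<^bsub>V\<^esub> b i \<oplus>\<^bsub>V\<^esub> d i \<odot>\<^bsub>V\<^esub> b i)"
    unfolding comb_def using assms by (intro V.M.finsum_cong') (auto simp: V.smult_l_distr)
  also have "\<dots> = comb n c b \<oplus>\<^bsub>V\<^esub> comb n d b"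
    unfolding comb_def using assms by (intro V.M.finsum_addf) auto
  finally show ?thesis .
qed

lemma comb_smult:
  assumes "a \<in> carrier K" "\<And>i. i < n \<Longrightarrow> c i \<in> carrier K" "\<And>i. i < n \<Longrightarrow> b i \<in> carrier V"
  shows "comb n (\<lambda>i. a \<otimes>\<^bsub>K\<^esub> c i) b = a \<odot>\<^bsub>V\<^esub> comb n c b"
proof -
  have "comb n (\<lambda>i. a \<otimes>\<^bsub>K\<^esub> c i) b = (\<Oplus>\<^bsub>V\<^esub>i\<in>{..<n}. a \<odot>\<^bsub>V\<^esub> (c i \<odot>\<^bsub>V\<^esub> b i))"
    unfolding comb_def using assms by (intro V.M.finsum_cong') (auto simp: V.smult_assoc1)
  also have "\<dots> = a \<odot>\<^bsub>V\<^esub> comb n c b"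
    unfolding comb_def using assms by (intro V.finsum_smult_ldistr[symmetric]) auto
  finally show ?thesis .
qed

lemma comb_minus:
  assumes "\<And>i. i < n \<Longrightarrow> c i \<in> carrier K" "\<And>i. i < n \<Longrightarrow> b i \<in> carrier V"
  shows "comb n (\<lambda>i. \<ominus>\<^bsub>K\<^esub> c i) b = \<ominus>\<^bsub>V\<^esub> comb n c b"
proof -
  have "comb n (\<lambda>i. \<ominus>\<^bsub>K\<^esub> c i) b \<oplus>\<^bsub>V\<^esub> comb n c b = comb n (\<lambda>i. \<ominus>\<^bsub>K\<^esub> c i \<oplus>\<^bsub>K\<^esub> c i) b"
    using assms by (subst comb_add) auto
  also have "\<dots> = comb n (\<lambda>i. \<zero>\<^bsub>K\<^esub> \<otimes>\<^bsub>K\<^esub> c i) b"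
    using assms by (intro comb_cong) (auto simp: K.l_neg)
  also have "\<dots> = \<zero>\<^bsub>V\<^esub>" using assms by (subst comb_smult) auto
  finally have "comb n (\<lambda>i. \<ominus>\<^bsub>K\<^esub> c i) b \<oplus>\<^bsub>V\<^esub> comb n c b = \<zero>\<^bsub>V\<^esub>" .
  then show ?thesis using assms by (intro V.M.minus_equality[symmetric]) auto
qed

lemma comb_unit_vector:
  assumes "i < n" "\<And>j. j < n \<Longrightarrow> b j \<in> carrier V"
  shows "comb n (\<lambda>j. if j = i then \<one>\<^bsub>K\<^esub> else \<zero>\<^bsub>K\<^esub>) b = b i"
proof -
  have "comb n (\<lambda>j. if j = i then \<one>\<^bsub>K\<^esub> else \<zero>\<^bsub>K\<^esub>) b = (\<Oplus>\<^bsub>V\<^esub>j\<in>{..<n}. if i = j then b j else \<zero>\<^bsub>V\<^esub>)"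
    unfolding comb_def using assms by (intro V.M.finsum_cong') auto
  also have "\<dots> = b i"
    using assms by (intro V.M.finsum_singleton) auto
  finally show ?thesis .
qed

lemma comb_in_submodule:
  assumes W: "submodule W K V" and "\<And>i. i < n \<Longrightarrow> c i \<in> carrier K" "\<And>i. i < n \<Longrightarrow> b i \<in> W"
  shows "comb n c b \<in> W"
  using assms(2,3)
proof (induction n)
  case 0
  then show ?case using subgroup.one_closed[OF submodule.axioms(1)[OF W]] by simp
next
  case (Suc n)
  note E = V.submoduleE[OF W]
  have "b i \<in> carrier V" if "i < Suc n" for i using Suc.prems that E(1) by blast
  then show ?case using Suc E(4,5) by (subst comb_Suc) auto
qed

text \<open>Gaussian elimination by induction on \<open>n\<close>. If no \<open>v j\<close> involves
  the last generator, one generator fewer suffices; otherwise a pivot \<open>v k\<close> clears it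
  from all the others, and \<open>J - {k}\<close> still has too many elements for the remaining
  generators. The index set \<open>J\<close> is arbitrary because any of its members may be the
  pivot.\<close>

lemma dependent_of_card_gt:
  assumes "finite J" "n < card J" "\<And>i. i < n \<Longrightarrow> b i \<in> carrier V"
    and "\<And>j. j \<in> J \<Longrightarrow> \<exists>c. (\<forall>i<n. c i \<in> carrier K) \<and> v j = comb n c b"
  shows "\<exists>c\<in>J \<rightarrow> carrier K. (\<exists>j\<in>J. c j \<noteq> \<zero>\<^bsub>K\<^esub>) \<and> (\<Oplus>\<^bsub>V\<^esub>j\<in>J. c j \<odot>\<^bsub>V\<^esub> v j) = \<zero>\<^bsub>V\<^esub>"
  using assms
proof (induction n arbitrary: J v)
  case 0
  then have v: "\<And>j. j \<in> J \<Longrightarrow> v j = \<zero>\<^bsub>V\<^esub>" by auto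
  obtain j where "j \<in> J" using 0 by fastforce
  have "(\<Oplus>\<^bsub>V\<^esub>j\<in>J. \<one>\<^bsub>K\<^esub> \<odot>\<^bsub>V\<^esub> v j) = (\<Oplus>\<^bsub>V\<^esub>j\<in>J. \<zero>\<^bsub>V\<^esub>)"
    using v by (intro V.M.finsum_cong') auto
  then show ?case using \<open>j \<in> J\<close> by (intro bexI[of _ "\<lambda>_. \<one>\<^bsub>K\<^esub>"]) auto
next
  case (Suc n)
  have b: "\<And>i. i < Suc n \<Longrightarrow> b i \<in> carrier V" by (rule Suc.prems)
  from Suc.prems(4) have "\<forall>j\<in>J. \<exists>c. (\<forall>i<Suc n. c i \<in> carrier K) \<and> v j = comb (Suc n) c b" by blast
  from bchoice[OF this] obtain C where
    C: "\<And>j i. j \<in> J \<Longrightarrow> i < Suc n \<Longrightarrow> C j i \<in> carrier K" "\<And>j. j \<in> J \<Longrightarrow> v j = comb (Suc n) (C j) b" by blast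
  have v: "v j = comb n (C j) b \<oplus>\<^bsub>V\<^esub> C j n \<odot>\<^bsub>V\<^esub> b n" if "j \<in> J" for j
    using C that b by (simp add: comb_Suc)
  have vc: "v j \<in> carrier V" if "j \<in> J" for j
    using C(2)[OF that] C(1)[OF that] b by auto
  show ?case
  proof (cases "\<forall>j\<in>J. C j n = \<zero>\<^bsub>K\<^esub>")
    case True
    have "\<exists>c. (\<forall>i<n. c i \<in> carrier K) \<and> v j = comb n c b" if "j \<in> J" for j
      using v[OF that] True that C(1) b by (intro exI[of _ "C j"]) auto
    moreover have "\<And>i. i < n \<Longrightarrow> b i \<in> carrier V" using b by simp
    ultimately show ?thesis using Suc.IH[OF Suc.prems(1) Suc_lessD[OF Suc.prems(2)], of v] by blast
  next
    case False
    then obtain k where k: "k \<in> J" "C k n \<noteq> \<zero>\<^bsub>K\<^esub>" by blast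
    \<comment> \<open>With this factor the coefficient of \<open>b n\<close> in \<open>v j\<close>
      plus \<open>s j\<close> times \<open>v k\<close> is zero, as \<open>kill\<close>
      records.\<close>
    define s where "s j = \<ominus>\<^bsub>K\<^esub> (C j n \<otimes>\<^bsub>K\<^esub> inv\<^bsub>K\<^esub> C k n)" for j
    have u: "C k n \<in> Units K" using k C(1) by (simp add: K.field_Units)
    have s: "s j \<in> carrier K" if "j \<in> J" for j using that C(1) u by (auto simp: s_def)
    have kill: "s j \<otimes>\<^bsub>K\<^esub> C k n \<oplus>\<^bsub>K\<^esub> C j n = \<zero>\<^bsub>K\<^esub>" if "j \<in> J" for j
      using that C(1)[OF that, of n] C(1)[OF k(1), of n] u
      by (simp add: s_def K.l_minus K.m_assoc K.l_neg)
    let ?J = "J - {k}"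
    have "\<exists>c\<in>?J \<rightarrow> carrier K. (\<exists>j\<in>?J. c j \<noteq> \<zero>\<^bsub>K\<^esub>) \<and> (\<Oplus>\<^bsub>V\<^esub>j\<in>?J. c j \<odot>\<^bsub>V\<^esub> (v j \<oplus>\<^bsub>V\<^esub> s j \<odot>\<^bsub>V\<^esub> v k)) = \<zero>\<^bsub>V\<^esub>"
    proof (rule Suc.IH)
      fix j assume j: "j \<in> ?J"
      let ?c = "\<lambda>i. C j i \<oplus>\<^bsub>K\<^esub> s j \<otimes>\<^bsub>K\<^esub> C k i"
      have "comb n ?c b = comb n (C j) b \<oplus>\<^bsub>V\<^esub> s j \<odot>\<^bsub>V\<^esub> comb n (C k) b"
        using j k C(1) s b by (subst comb_add) (auto simp: comb_smult)
      moreover have "v j \<oplus>\<^bsub>V\<^esub> s j \<odot>\<^bsub>V\<^esub> v k =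
        (comb n (C j) b \<oplus>\<^bsub>V\<^esub> s j \<odot>\<^bsub>V\<^esub> comb n (C k) b) \<oplus>\<^bsub>V\<^esub> (s j \<otimes>\<^bsub>K\<^esub> C k n \<oplus>\<^bsub>K\<^esub> C j n) \<odot>\<^bsub>V\<^esub> b n"
      proof -
        have [simp]: "comb n (C j) b \<in> carrier V" "comb n (C k) b \<in> carrier V" "b n \<in> carrier V"
          "C j n \<in> carrier K" "C k n \<in> carrier K" "s j \<in> carrier K"
          using j k C(1) b s by auto
        show ?thesis using v[of j] v[OF k(1)] j
          by (simp add: V.smult_r_distr V.smult_l_distr V.smult_assoc1 V.M.a_ac)
      qed
      moreover have "comb n ?c b \<in> carrier V" using j k C(1) s b by (intro comb_closed) auto
      ultimately have "v j \<oplus>\<^bsub>V\<^esub> s j \<odot>\<^bsub>V\<^esub> v k = comb n ?c b" using kill[of j] j b by simp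
      then show "\<exists>c. (\<forall>i<n. c i \<in> carrier K) \<and> v j \<oplus>\<^bsub>V\<^esub> s j \<odot>\<^bsub>V\<^esub> v k = comb n c b"
        using j k C(1) s by (intro exI[of _ ?c]) auto
    qed (use Suc.prems k in auto)
    then obtain c where c: "c \<in> ?J \<rightarrow> carrier K" "\<exists>j\<in>?J. c j \<noteq> \<zero>\<^bsub>K\<^esub>"
        "(\<Oplus>\<^bsub>V\<^esub>j\<in>?J. c j \<odot>\<^bsub>V\<^esub> (v j \<oplus>\<^bsub>V\<^esub> s j \<odot>\<^bsub>V\<^esub> v k)) = \<zero>\<^bsub>V\<^esub>" by blast
    have cJ: "c j \<in> carrier K" if "j \<in> J" "j \<noteq> k" for j using c(1) that by blast
    \<comment> \<open>Undoing the shifts moves their total to the pivot. Some \<open>d j\<close>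
      with \<open>j\<close> different from \<open>k\<close> is a nonzero \<open>c j\<close>, so the
      relation stays nontrivial.\<close>
    define d where "d = c(k := \<Oplus>\<^bsub>K\<^esub>j\<in>?J. c j \<otimes>\<^bsub>K\<^esub> s j)"
    have cs: "(\<Oplus>\<^bsub>K\<^esub>j\<in>?J. c j \<otimes>\<^bsub>K\<^esub> s j) \<in> carrier K" using c(1) s by (intro K.finsum_closed) auto
    have "(\<Oplus>\<^bsub>V\<^esub>j\<in>insert k ?J. d j \<odot>\<^bsub>V\<^esub> v j) = d k \<odot>\<^bsub>V\<^esub> v k \<oplus>\<^bsub>V\<^esub> (\<Oplus>\<^bsub>V\<^esub>j\<in>?J. d j \<odot>\<^bsub>V\<^esub> v j)"
      using cJ cs vc k Suc.prems(1) by (subst V.M.finsum_insert) (auto simp: d_def)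
    also have "(\<Oplus>\<^bsub>V\<^esub>j\<in>?J. d j \<odot>\<^bsub>V\<^esub> v j) = (\<Oplus>\<^bsub>V\<^esub>j\<in>?J. c j \<odot>\<^bsub>V\<^esub> v j)"
      using cJ vc by (intro V.M.finsum_cong') (auto simp: d_def)
    also have "d k \<odot>\<^bsub>V\<^esub> v k \<oplus>\<^bsub>V\<^esub> (\<Oplus>\<^bsub>V\<^esub>j\<in>?J. c j \<odot>\<^bsub>V\<^esub> v j) =
        (\<Oplus>\<^bsub>V\<^esub>j\<in>?J. c j \<odot>\<^bsub>V\<^esub> (v j \<oplus>\<^bsub>V\<^esub> s j \<odot>\<^bsub>V\<^esub> v k))"
      using c(1) cJ cs vc k s Suc.prems(1)
      by (subst finsum_smult_shift) (auto simp: d_def intro!: V.M.a_comm V.M.finsum_closed)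
    finally have "(\<Oplus>\<^bsub>V\<^esub>j\<in>J. d j \<odot>\<^bsub>V\<^esub> v j) = \<zero>\<^bsub>V\<^esub>" using k c(3) by (simp add: insert_absorb)
    moreover have "d \<in> J \<rightarrow> carrier K" using cJ cs by (auto simp: d_def)
    moreover have "\<exists>j\<in>J. d j \<noteq> \<zero>\<^bsub>K\<^esub>" using c(2) by (auto simp: d_def)
    ultimately show ?thesis by blast
  qed
qed

text \<open>A family in \<open>W\<close> that is a basis modulo \<open>U\<close>. With
  \<open>U\<close> zero it is an ordinary basis of \<open>W\<close>; with \<open>U = irr M g\<close>
  it is a minimal family of generators of \<open>M\<close> in degree \<open>g\<close>. Only the
  subspace \<open>W\<close> is measured, since the ambient space will be a whole graded module,
  possibly of infinite dimension.\<close>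

definition rel_basis :: "'v set \<Rightarrow> 'v set \<Rightarrow> nat \<Rightarrow> (nat \<Rightarrow> 'v) \<Rightarrow> bool"
  where "rel_basis U W n b \<longleftrightarrow> (\<forall>i<n. b i \<in> W) \<and>
    (\<forall>w\<in>W. \<exists>c. (\<forall>i<n. c i \<in> carrier K) \<and> (\<exists>u\<in>U. w = u \<oplus>\<^bsub>V\<^esub> comb n c b)) \<and>
    (\<forall>c. (\<forall>i<n. c i \<in> carrier K) \<longrightarrow> comb n c b \<in> U \<longrightarrow> (\<forall>i<n. c i = \<zero>\<^bsub>K\<^esub>))"

lemma rel_basis_independent:
  "\<lbrakk>rel_basis U W n b; \<And>i. i < n \<Longrightarrow> c i \<in> carrier K; comb n c b \<in> U; i < n\<rbrakk> \<Longrightarrow> c i = \<zero>\<^bsub>K\<^esub>"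
  by (simp add: rel_basis_def)

definition has_dim :: "'v set \<Rightarrow> nat \<Rightarrow> bool"
  where "has_dim W n \<longleftrightarrow> (\<exists>b. rel_basis {\<zero>\<^bsub>V\<^esub>} W n b)"

definition vdim :: "'v set \<Rightarrow> nat"
  where "vdim W = (THE n. has_dim W n)"

lemma has_dim_le:
  assumes "W \<subseteq> carrier V" "has_dim W n" "has_dim W m"
  shows "m \<le> n"
proof (rule ccontr)
  assume "\<not> m \<le> n"
  obtain b b' where b: "rel_basis {\<zero>\<^bsub>V\<^esub>} W n b" and b': "rel_basis {\<zero>\<^bsub>V\<^esub>} W m b'"
    using assms by (auto simp: has_dim_def)
  have bc: "b i \<in> carrier V" if "i < n" for i using b that assms(1) by (auto simp: rel_basis_def)
  have "\<exists>c. (\<forall>i<n. c i \<in> carrier K) \<and> b' j = comb n c b" if j: "j \<in> {..<m}" for j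
  proof -
    have "b' j \<in> W" using b' j by (auto simp: rel_basis_def)
    then obtain c where c: "\<forall>i<n. c i \<in> carrier K" "b' j = \<zero>\<^bsub>V\<^esub> \<oplus>\<^bsub>V\<^esub> comb n c b"
      using b by (auto simp: rel_basis_def)
    then have "comb n c b \<in> carrier V" using bc by auto
    with c show ?thesis by auto
  qed
  then have "\<exists>c\<in>{..<m} \<rightarrow> carrier K. (\<exists>j\<in>{..<m}. c j \<noteq> \<zero>\<^bsub>K\<^esub>) \<and> (\<Oplus>\<^bsub>V\<^esub>j\<in>{..<m}. c j \<odot>\<^bsub>V\<^esub> b' j) = \<zero>\<^bsub>V\<^esub>"
    using \<open>\<not> m \<le> n\<close> bc by (intro dependent_of_card_gt[of _ n b]) auto
  then obtain c where "c \<in> {..<m} \<rightarrow> carrier K" "\<exists>j<m. c j \<noteq> \<zero>\<^bsub>K\<^esub>" "comb m c b' = \<zero>\<^bsub>V\<^esub>"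
    by (auto simp: comb_def)
  then show False using b' by (auto simp: rel_basis_def)
qed

lemma vdim_eq: "W \<subseteq> carrier V \<Longrightarrow> has_dim W n \<Longrightarrow> vdim W = n"
  unfolding vdim_def by (intro the_equality) (auto dest: has_dim_le intro: antisym)

end

text \<open>The family is taken of minimal length among those that span \<open>W\<close> modulo \<open>U\<close>.\<close>

lemma (in kspace) rel_basis_exists:
  fixes m :: nat
  assumes U: "submodule U K V" and W: "submodule W K V"
    and spanb: "\<And>i. i < m \<Longrightarrow> b0 i \<in> W" "\<And>w. w \<in> W \<Longrightarrow> \<exists>c. (\<forall>i<m. c i \<in> carrier K) \<and> w = comb m c b0"
  shows "\<exists>n b. rel_basis U W n b"
proof -
  define P where "P n b \<longleftrightarrow> (\<forall>i<n. b i \<in> W) \<and>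
    (\<forall>w\<in>W. \<exists>c. (\<forall>i<n. c i \<in> carrier K) \<and> (\<exists>u\<in>U. w = u \<oplus>\<^bsub>V\<^esub> comb n c b))" for n b
  note UE = V.submoduleE[OF U] and WE = V.submoduleE[OF W]
  have U0: "\<zero>\<^bsub>V\<^esub> \<in> U" using subgroup.one_closed[OF submodule.axioms(1)[OF U]] by simp
  have "P m b0" unfolding P_def
  proof safe
    fix w assume w: "w \<in> W"
    obtain c where "\<forall>i<m. c i \<in> carrier K" "w = comb m c b0" using spanb(2)[OF w] by blast
    moreover have "w \<in> carrier V" using w WE(1) by blast
    ultimately show "\<exists>c. (\<forall>i<m. c i \<in> carrier K) \<and> (\<exists>u\<in>U. w = u \<oplus>\<^bsub>V\<^esub> comb m c b0)"
      using U0 by (metis V.M.l_zero)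
  qed (use spanb in auto)
  then have "\<exists>n. \<exists>b. P n b" by blast
  define n where "n = (LEAST n. \<exists>b. P n b)"
  have "\<exists>b. P n b" unfolding n_def using \<open>\<exists>n. \<exists>b. P n b\<close> by (rule LeastI_ex)
  then obtain b where Pb: "P n b" by blast
  have min: "n \<le> k" if "P k b'" for k b' unfolding n_def using that by (intro Least_le) blast
  have bW: "b i \<in> W" if "i < n" for i using Pb that by (auto simp: P_def)
  have bc: "b i \<in> carrier V" if "i < n" for i using bW[OF that] WE(1) by blast
  have "c j = \<zero>\<^bsub>K\<^esub>" if c: "\<forall>i<n. c i \<in> carrier K" "comb n c b \<in> U" and j: "j < n" for c j
  proof (rule ccontr)
    assume nz: "c j \<noteq> \<zero>\<^bsub>K\<^esub>"
    define N where "N = n - 1"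
    have n: "n = Suc N" using j by (simp add: N_def)
    \<comment> \<open>The redundant index \<open>j\<close> is exchanged with the last one, so that
      deleting \<open>b j\<close> means cutting the family to length \<open>N\<close>, against the
      minimality of \<open>n\<close>.\<close>
    define \<tau> where "\<tau> i = (if i = j then N else if i = N then j else i)" for i
    have \<tau>: "bij_betw \<tau> {..<n} {..<n}"
      by (rule bij_betw_byWitness[where f' = \<tau>]) (use j n in \<open>auto simp: \<tau>_def\<close>)
    have \<tau>lt: "\<tau> i < n" if "i < n" for i using that j n by (auto simp: \<tau>_def)
    have comb\<tau>: "comb n (d \<circ> \<tau>) (b \<circ> \<tau>) = comb n d b" if "\<forall>i<n. d i \<in> carrier K" for d
    proof -
      have "(\<Oplus>\<^bsub>V\<^esub>i\<in>\<tau> ` {..<n}. d i \<odot>\<^bsub>V\<^esub> b i) = (\<Oplus>\<^bsub>V\<^esub>i\<in>{..<n}. d (\<tau> i) \<odot>\<^bsub>V\<^esub> b (\<tau> i))"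
        using that bc \<tau> \<tau>lt by (intro V.M.finsum_reindex) (auto simp: bij_betw_def)
      then show ?thesis using \<tau> by (simp add: comb_def bij_betw_def)
    qed
    let ?b = "b \<circ> \<tau>"
    have "P N ?b" unfolding P_def
    proof (intro conjI ballI allI impI)
      fix i assume "i < N" then show "?b i \<in> W" using \<tau>lt[of i] bW n by auto
    next
      fix w assume w: "w \<in> W"
      obtain d u where d: "\<forall>i<n. d i \<in> carrier K" "u \<in> U" "w = u \<oplus>\<^bsub>V\<^esub> comb n d b"
        using Pb w by (auto simp: P_def)
      \<comment> \<open>Adding \<open>t\<close> times the offending relation kills the coefficient
        of \<open>b j\<close>; the change, \<open>t\<close> times \<open>comb n c b\<close>, lies in
        \<open>U\<close> and is absorbed by \<open>u\<close>.\<close>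
      define t where "t = \<ominus>\<^bsub>K\<^esub> (d j \<otimes>\<^bsub>K\<^esub> inv\<^bsub>K\<^esub> c j)"
      have unit: "c j \<in> Units K" using nz c(1) j by (simp add: K.field_Units)
      have t: "t \<in> carrier K" using unit d j by (auto simp: t_def)
      let ?e = "\<lambda>i. d i \<oplus>\<^bsub>K\<^esub> t \<otimes>\<^bsub>K\<^esub> c i"
      have ec: "\<forall>i<n. ?e i \<in> carrier K" using d c t by auto
      have ej: "?e j = \<zero>\<^bsub>K\<^esub>"
      proof -
        have "t \<otimes>\<^bsub>K\<^esub> c j = \<ominus>\<^bsub>K\<^esub> d j"
          using unit d(1) c(1) j by (simp add: t_def K.l_minus K.m_assoc)
        then show ?thesis using d(1) j by (simp add: K.r_neg)
      qed
      have cb: "comb n ?e b = comb n d b \<oplus>\<^bsub>V\<^esub> t \<odot>\<^bsub>V\<^esub> comb n c b"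
        using d c t bc by (subst comb_add) (auto simp: comb_smult)
      have [simp]: "comb n d b \<in> carrier V" "comb n c b \<in> carrier V" "u \<in> carrier V"
        using d c bc UE(1) by auto
      have "w = (u \<ominus>\<^bsub>V\<^esub> t \<odot>\<^bsub>V\<^esub> comb n c b) \<oplus>\<^bsub>V\<^esub> comb n ?e b"
      proof -
        have "(u \<ominus>\<^bsub>V\<^esub> t \<odot>\<^bsub>V\<^esub> comb n c b) \<oplus>\<^bsub>V\<^esub> (comb n d b \<oplus>\<^bsub>V\<^esub> t \<odot>\<^bsub>V\<^esub> comb n c b) = u \<oplus>\<^bsub>V\<^esub> comb n d b"
          using t by (simp add: a_minus_def V.M.a_ac V.M.r_neg1 V.M.r_neg2 V.M.r_neg V.M.l_neg)
        then show ?thesis unfolding cb d(3) by simp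
      qed
      also have "comb n ?e b = comb n (?e \<circ> \<tau>) ?b" using comb\<tau>[OF ec] by simp
      also have "\<dots> = comb N (?e \<circ> \<tau>) ?b \<oplus>\<^bsub>V\<^esub> (?e \<circ> \<tau>) N \<odot>\<^bsub>V\<^esub> ?b N"
        unfolding n using ec bc \<tau>lt n by (intro comb_Suc) (auto simp del: o_apply, auto)
      also have "(?e \<circ> \<tau>) N = \<zero>\<^bsub>K\<^esub>" using ej n j by (auto simp: \<tau>_def)
      also have "comb N (?e \<circ> \<tau>) ?b \<oplus>\<^bsub>V\<^esub> \<zero>\<^bsub>K\<^esub> \<odot>\<^bsub>V\<^esub> ?b N = comb N (?e \<circ> \<tau>) ?b"
        using ec bc \<tau>lt n by (subst V.smult_l_null) (auto intro!: V.M.r_zero comb_closed)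
      finally have "w = (u \<ominus>\<^bsub>V\<^esub> t \<odot>\<^bsub>V\<^esub> comb n c b) \<oplus>\<^bsub>V\<^esub> comb N (?e \<circ> \<tau>) ?b" .
      moreover have "u \<ominus>\<^bsub>V\<^esub> t \<odot>\<^bsub>V\<^esub> comb n c b \<in> U"
        using d(2) c(2) t UE unfolding a_minus_def by blast
      moreover have "\<forall>i<N. (?e \<circ> \<tau>) i \<in> carrier K" using ec \<tau>lt n by auto
      ultimately show "\<exists>c. (\<forall>i<N. c i \<in> carrier K) \<and> (\<exists>u\<in>U. w = u \<oplus>\<^bsub>V\<^esub> comb N c ?b)" by blast
    qed
    from min[OF this] show False using n by simp
  qed
  then have "rel_basis U W n b" using Pb by (auto simp: P_def rel_basis_def)
  then show ?thesis by blast
qed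


context kspace
begin

lemma submoduleI':
  assumes "W \<subseteq> carrier V" "\<zero>\<^bsub>V\<^esub> \<in> W" "\<And>x y. x \<in> W \<Longrightarrow> y \<in> W \<Longrightarrow> x \<oplus>\<^bsub>V\<^esub> y \<in> W"
    and "\<And>c x. c \<in> carrier K \<Longrightarrow> x \<in> W \<Longrightarrow> c \<odot>\<^bsub>V\<^esub> x \<in> W"
  shows "submodule W K V"
proof (rule V.submoduleI)
  fix a assume a: "a \<in> W"
  have "(\<ominus>\<^bsub>K\<^esub> \<one>\<^bsub>K\<^esub>) \<odot>\<^bsub>V\<^esub> a \<in> W" using a by (intro assms(4)) auto
  then show "\<ominus>\<^bsub>V\<^esub> a \<in> W" using a assms(1) by (auto simp: V.smult_l_minus)
qed (use assms in auto)

lemma submodule_zero: "submodule {\<zero>\<^bsub>V\<^esub>} K V"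
  by (rule submoduleI') auto

lemma has_dim_zero_iff: "has_dim W 0 \<longleftrightarrow> W \<subseteq> {\<zero>\<^bsub>V\<^esub>}"
  by (auto simp: has_dim_def rel_basis_def)

lemma submodule_subset: "submodule W K V \<Longrightarrow> w \<in> W \<Longrightarrow> w \<in> carrier V"
  using V.submoduleE(1) by blast

lemma submodule_zero_mem: "submodule W K V \<Longrightarrow> \<zero>\<^bsub>V\<^esub> \<in> W"
  using subgroup.one_closed[OF submodule.axioms(1)] by fastforce

text \<open>Coordinates are chosen once for all vectors of \<open>W\<close>. The uniqueness clause
  comes from applying independence to the difference of two coordinate vectors; it makes the
  coordinate map linear in \<open>has_dim_bij\<close>.\<close>

lemma has_dim_coordinates:
  assumes W: "W \<subseteq> carrier V" and "rel_basis {\<zero>\<^bsub>V\<^esub>} W n b"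
  obtains X where "\<And>w i. w \<in> W \<Longrightarrow> i < n \<Longrightarrow> X w i \<in> carrier K" "\<And>w. w \<in> W \<Longrightarrow> comb n (X w) b = w"
    "\<And>w c i. \<lbrakk>w \<in> W; \<And>i. i < n \<Longrightarrow> c i \<in> carrier K; comb n c b = w; i < n\<rbrakk> \<Longrightarrow> X w i = c i"
proof -
  note B = assms(2)[unfolded rel_basis_def]
  have bc: "b i \<in> carrier V" if "i < n" for i using B W that by blast
  have "\<exists>c. (\<forall>i<n. c i \<in> carrier K) \<and> comb n c b = w" if "w \<in> W" for w
  proof -
    obtain c where "\<forall>i<n. c i \<in> carrier K" "w = \<zero>\<^bsub>V\<^esub> \<oplus>\<^bsub>V\<^esub> comb n c b" using B \<open>w \<in> W\<close> by blast
    with bc show ?thesis by (intro exI[of _ c]) auto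
  qed
  then obtain X where X: "\<And>w i. w \<in> W \<Longrightarrow> i < n \<Longrightarrow> X w i \<in> carrier K" "\<And>w. w \<in> W \<Longrightarrow> comb n (X w) b = w"
    by metis
  have "X w i = c i" if "w \<in> W" and c: "\<And>i. i < n \<Longrightarrow> c i \<in> carrier K" and "comb n c b = w" "i < n" for w c i
  proof -
    have "comb n (\<lambda>i. c i \<oplus>\<^bsub>K\<^esub> \<ominus>\<^bsub>K\<^esub> X w i) b = comb n c b \<oplus>\<^bsub>V\<^esub> comb n (\<lambda>i. \<ominus>\<^bsub>K\<^esub> X w i) b"
      using X \<open>w \<in> W\<close> c bc by (intro comb_add) auto
    also have "comb n (\<lambda>i. \<ominus>\<^bsub>K\<^esub> X w i) b = \<ominus>\<^bsub>V\<^esub> w"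
      using comb_minus[of n "X w" b] X \<open>w \<in> W\<close> bc by auto
    also have "comb n c b \<oplus>\<^bsub>V\<^esub> \<ominus>\<^bsub>V\<^esub> w = \<zero>\<^bsub>V\<^esub>"
      using that W by (auto simp: V.M.r_neg)
    finally have "comb n (\<lambda>i. c i \<oplus>\<^bsub>K\<^esub> \<ominus>\<^bsub>K\<^esub> X w i) b = \<zero>\<^bsub>V\<^esub>" .
    then have "c i \<oplus>\<^bsub>K\<^esub> \<ominus>\<^bsub>K\<^esub> X w i = \<zero>\<^bsub>K\<^esub>"
      using X \<open>w \<in> W\<close> c \<open>i < n\<close> by (intro rel_basis_independent[OF assms(2), of "\<lambda>i. c i \<oplus>\<^bsub>K\<^esub> \<ominus>\<^bsub>K\<^esub> X w i"]) auto
    then show ?thesis using \<open>i < n\<close> X \<open>w \<in> W\<close> c by (simp add: K.add.inv_solve_right')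
  qed
  with X show thesis by (rule that)
qed

lemma comb_split:
  "\<lbrakk>\<And>i. i < m + n \<Longrightarrow> c i \<in> carrier K; \<And>i. i < m + n \<Longrightarrow> b i \<in> carrier V\<rbrakk> \<Longrightarrow>
    comb (m + n) c b = comb m c b \<oplus>\<^bsub>V\<^esub> comb n (\<lambda>i. c (m + i)) (\<lambda>i. b (m + i))"
proof (induction n)
  case 0
  then show ?case by simp
next
  case (Suc n)
  have *: "comb m c b \<in> carrier V" "comb n (\<lambda>i. c (m + i)) (\<lambda>i. b (m + i)) \<in> carrier V" using Suc.prems by auto
  have "comb (m + Suc n) c b = comb (m + n) c b \<oplus>\<^bsub>V\<^esub> c (m + n) \<odot>\<^bsub>V\<^esub> b (m + n)"
    using Suc.prems by (simp only: add_Suc_right comb_Suc)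
  also have "\<dots> = comb m c b \<oplus>\<^bsub>V\<^esub> (comb n (\<lambda>i. c (m + i)) (\<lambda>i. b (m + i)) \<oplus>\<^bsub>V\<^esub> c (m + n) \<odot>\<^bsub>V\<^esub> b (m + n))"
    using Suc * by (simp add: V.M.a_assoc)
  also have "comb n (\<lambda>i. c (m + i)) (\<lambda>i. b (m + i)) \<oplus>\<^bsub>V\<^esub> c (m + n) \<odot>\<^bsub>V\<^esub> b (m + n) =
      comb (Suc n) (\<lambda>i. c (m + i)) (\<lambda>i. b (m + i))"
    using Suc.prems by (subst comb_Suc) auto
  finally show ?case .
qed

end

text \<open>Linearity is asked on \<open>W\<close> only: maps prescribed degree by degree are linear
  on one component at a time.\<close>

locale kspace_map = A: kspace K V + B: kspace K V'
  for K :: "('k, 'x) ring_scheme" and V :: "('k, 'v, 'y) module_scheme"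
    and V' :: "('k, 'w, 'z) module_scheme" +
  fixes W :: "'v set" and f :: "'v \<Rightarrow> 'w"
  assumes W: "submodule W K V" and f_closed: "\<And>x. x \<in> W \<Longrightarrow> f x \<in> carrier V'"
    and f_add: "\<And>x y. x \<in> W \<Longrightarrow> y \<in> W \<Longrightarrow> f (x \<oplus>\<^bsub>V\<^esub> y) = f x \<oplus>\<^bsub>V'\<^esub> f y"
    and f_smult: "\<And>c x. c \<in> carrier K \<Longrightarrow> x \<in> W \<Longrightarrow> f (c \<odot>\<^bsub>V\<^esub> x) = c \<odot>\<^bsub>V'\<^esub> f x"
begin

lemma f_zero: "f \<zero>\<^bsub>V\<^esub> = \<zero>\<^bsub>V'\<^esub>"
proof -
  have "\<zero>\<^bsub>V\<^esub> \<in> W" using W by (rule A.submodule_zero_mem)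
  then have "f (\<zero>\<^bsub>K\<^esub> \<odot>\<^bsub>V\<^esub> \<zero>\<^bsub>V\<^esub>) = \<zero>\<^bsub>K\<^esub> \<odot>\<^bsub>V'\<^esub> f \<zero>\<^bsub>V\<^esub>" by (intro f_smult) auto
  then show ?thesis using f_closed[OF \<open>\<zero>\<^bsub>V\<^esub> \<in> W\<close>] by simp
qed

lemma f_minus:
  assumes "x \<in> W"
  shows "f (\<ominus>\<^bsub>V\<^esub> x) = \<ominus>\<^bsub>V'\<^esub> f x"
proof -
  have x: "x \<in> carrier V" "f x \<in> carrier V'" using A.submodule_subset[OF W assms] f_closed[OF assms] by auto
  have "\<ominus>\<^bsub>V\<^esub> x = (\<ominus>\<^bsub>K\<^esub> \<one>\<^bsub>K\<^esub>) \<odot>\<^bsub>V\<^esub> x" using x by (simp add: A.V.smult_l_minus)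
  also have "f \<dots> = (\<ominus>\<^bsub>K\<^esub> \<one>\<^bsub>K\<^esub>) \<odot>\<^bsub>V'\<^esub> f x" using assms by (intro f_smult) auto
  also have "\<dots> = \<ominus>\<^bsub>V'\<^esub> f x" using x by (simp add: B.V.smult_l_minus)
  finally show ?thesis .
qed

lemma f_comb:
  assumes "\<And>i. i < n \<Longrightarrow> c i \<in> carrier K" "\<And>i. i < n \<Longrightarrow> b i \<in> W"
  shows "f (A.comb n c b) = B.comb n c (\<lambda>i. f (b i))"
  using assms
proof (induction n)
  case 0
  then show ?case using f_zero by simp
next
  case (Suc n)
  have "A.comb n c b \<in> W" using W Suc.prems by (intro A.comb_in_submodule) auto
  moreover have "c n \<odot>\<^bsub>V\<^esub> b n \<in> W" using Suc.prems A.V.submoduleE(4)[OF W] by auto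
  ultimately show ?case
    using Suc A.submodule_subset[OF W] f_closed
    by (simp add: A.comb_Suc B.comb_Suc f_add f_smult)
qed

text \<open>Rank-nullity. A basis of the kernel followed by preimages of a basis of the image is a
  basis of \<open>W\<close>: to expand \<open>w\<close>, match \<open>f w\<close> by a combination
  of the preimages and expand the remainder, which lies in the kernel.\<close>

lemma has_dim_exact:
  assumes m: "A.has_dim {w \<in> W. f w = \<zero>\<^bsub>V'\<^esub>} m" and n: "B.has_dim (f ` W) n"
  shows "A.has_dim W (m + n)"
proof -
  let ?W1 = "{w \<in> W. f w = \<zero>\<^bsub>V'\<^esub>}"
  obtain a b where a: "A.rel_basis {\<zero>\<^bsub>V\<^esub>} ?W1 m a" and b: "B.rel_basis {\<zero>\<^bsub>V'\<^esub>} (f ` W) n b"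
    using m n by (auto simp: A.has_dim_def B.has_dim_def)
  note Wc = A.submodule_subset[OF W] and E = A.V.submoduleE[OF W]
  have "\<exists>x\<in>W. f x = b i" if "i < n" for i
  proof -
    have "b i \<in> f ` W" using b that by (simp add: B.rel_basis_def)
    then show ?thesis by auto
  qed
  then obtain b' where b': "\<And>i. i < n \<Longrightarrow> b' i \<in> W" "\<And>i. i < n \<Longrightarrow> f (b' i) = b i" by metis
  have aW: "a i \<in> W" "f (a i) = \<zero>\<^bsub>V'\<^esub>" if "i < m" for i using a that by (auto simp: A.rel_basis_def)
  have bc: "b i \<in> carrier V'" if "i < n" for i using b'[OF that] f_closed by metis
  define e where "e i = (if i < m then a i else b' (i - m))" for i
  have eW: "e i \<in> W" if "i < m + n" for i using that aW b' by (auto simp: e_def)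
  have ec: "A.comb (m + n) c e = A.comb m c a \<oplus>\<^bsub>V\<^esub> A.comb n (\<lambda>i. c (m + i)) b'"
    if "\<And>i. i < m + n \<Longrightarrow> c i \<in> carrier K" for c
  proof -
    have "A.comb m c e = A.comb m c a" "A.comb n (\<lambda>i. c (m + i)) (\<lambda>i. e (m + i)) = A.comb n (\<lambda>i. c (m + i)) b'"
      using that aW b' Wc by (auto intro!: A.comb_cong simp: e_def)
    then show ?thesis using that eW Wc by (simp add: A.comb_split)
  qed
  have caW: "A.comb m c a \<in> W" "f (A.comb m c a) = \<zero>\<^bsub>V'\<^esub>" if "\<And>i. i < m \<Longrightarrow> c i \<in> carrier K" for c
  proof -
    show "A.comb m c a \<in> W" using that aW by (intro A.comb_in_submodule W) auto
    have "f (A.comb m c a) = B.comb m c (\<lambda>i. f (a i))" using that aW by (intro f_comb) auto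
    also have "\<dots> = B.comb m c (\<lambda>i. \<zero>\<^bsub>V'\<^esub>)" using that aW by (intro B.comb_cong) auto
    also have "\<dots> = \<zero>\<^bsub>V'\<^esub>" unfolding B.comb_def
      using that by (intro B.V.M.add.finprod_one_eqI) auto
    finally show "f (A.comb m c a) = \<zero>\<^bsub>V'\<^esub>" .
  qed
  have cbW: "A.comb n c b' \<in> W" "f (A.comb n c b') = B.comb n c b" if "\<And>i. i < n \<Longrightarrow> c i \<in> carrier K" for c
  proof -
    show "A.comb n c b' \<in> W" using that b' by (intro A.comb_in_submodule W) auto
    have "f (A.comb n c b') = B.comb n c (\<lambda>i. f (b' i))" using that b' by (intro f_comb) auto
    also have "\<dots> = B.comb n c b" using that b' bc by (intro B.comb_cong) auto
    finally show "f (A.comb n c b') = B.comb n c b" .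
  qed
  have "\<exists>c. (\<forall>i<m + n. c i \<in> carrier K) \<and> w = \<zero>\<^bsub>V\<^esub> \<oplus>\<^bsub>V\<^esub> A.comb (m + n) c e" if w: "w \<in> W" for w
  proof -
    obtain c2 where c2: "\<forall>i<n. c2 i \<in> carrier K" "f w = \<zero>\<^bsub>V'\<^esub> \<oplus>\<^bsub>V'\<^esub> B.comb n c2 b"
      using b w unfolding B.rel_basis_def by blast
    let ?y = "A.comb n c2 b'"
    have y: "?y \<in> W" "f ?y = f w" using cbW[of c2] c2 f_closed[OF w] bc by auto
    have "f (w \<oplus>\<^bsub>V\<^esub> \<ominus>\<^bsub>V\<^esub> ?y) = f w \<oplus>\<^bsub>V'\<^esub> \<ominus>\<^bsub>V'\<^esub> f ?y"
      using w y E(3) f_minus[OF y(1)] by (subst f_add) auto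
    also have "\<dots> = \<zero>\<^bsub>V'\<^esub>" using y f_closed[OF w] by (simp add: B.V.M.r_neg)
    finally have "w \<oplus>\<^bsub>V\<^esub> \<ominus>\<^bsub>V\<^esub> ?y \<in> ?W1" using w y E(3,5) by auto
    then obtain c1 where c1: "\<forall>i<m. c1 i \<in> carrier K" "w \<oplus>\<^bsub>V\<^esub> \<ominus>\<^bsub>V\<^esub> ?y = \<zero>\<^bsub>V\<^esub> \<oplus>\<^bsub>V\<^esub> A.comb m c1 a"
      using a unfolding A.rel_basis_def by blast
    let ?c = "\<lambda>i. if i < m then c1 i else c2 (i - m)"
    have c: "?c i \<in> carrier K" if "i < m + n" for i using c1 c2 that by auto
    have "A.comb m ?c a = A.comb m c1 a" using c1 aW Wc by (intro A.comb_cong) auto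
    then have "A.comb (m + n) ?c e = (w \<oplus>\<^bsub>V\<^esub> \<ominus>\<^bsub>V\<^esub> ?y) \<oplus>\<^bsub>V\<^esub> ?y"
      using c1 caW(1)[of c1] Wc by (subst ec) (use c in auto)
    also have "\<dots> = w" using w y Wc by (simp add: A.V.M.a_assoc A.V.M.l_neg)
    finally show ?thesis using c Wc[OF w] by (intro exI[of _ ?c]) auto
  qed
  moreover have "\<forall>i<m + n. c i = \<zero>\<^bsub>K\<^esub>"
    if c: "\<forall>i<m + n. c i \<in> carrier K" and z: "A.comb (m + n) c e = \<zero>\<^bsub>V\<^esub>" for c
  proof -
    have ca: "A.comb m c a \<in> W" "f (A.comb m c a) = \<zero>\<^bsub>V'\<^esub>" using caW[of c] c by auto
    have cb: "A.comb n (\<lambda>i. c (m + i)) b' \<in> W" "f (A.comb n (\<lambda>i. c (m + i)) b') = B.comb n (\<lambda>i. c (m + i)) b"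
      using cbW[of "\<lambda>i. c (m + i)"] c by auto
    have Bc: "B.comb n (\<lambda>i. c (m + i)) b \<in> carrier V'" using c bc by auto
    have "\<zero>\<^bsub>V'\<^esub> = f (A.comb m c a \<oplus>\<^bsub>V\<^esub> A.comb n (\<lambda>i. c (m + i)) b')"
      using ec[of c] c z f_zero by simp
    also have "\<dots> = B.comb n (\<lambda>i. c (m + i)) b" using ca cb Bc by (simp add: f_add)
    finally have "B.comb n (\<lambda>i. c (m + i)) b = \<zero>\<^bsub>V'\<^esub>" by simp
    then have 2: "\<forall>i<n. c (m + i) = \<zero>\<^bsub>K\<^esub>"
      using c by (auto intro!: B.rel_basis_independent[OF b, of "\<lambda>i. c (m + i)"])
    have "A.comb n (\<lambda>i. c (m + i)) b' = A.comb n (\<lambda>i. \<zero>\<^bsub>K\<^esub>) b'"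
      using 2 c b' Wc by (intro A.comb_cong) auto
    also have "\<dots> = \<zero>\<^bsub>V\<^esub>" unfolding A.comb_def
      using b' Wc by (intro A.V.M.add.finprod_one_eqI) auto
    finally have "A.comb m c a = \<zero>\<^bsub>V\<^esub>" using ec[of c] c z ca Wc by auto
    then have "\<forall>i<m. c i = \<zero>\<^bsub>K\<^esub>" using c by (auto intro!: A.rel_basis_independent[OF a, of c])
    then show ?thesis using 2 by (metis le_add_diff_inverse nat_add_left_cancel_less not_less)
  qed
  ultimately have "A.rel_basis {\<zero>\<^bsub>V\<^esub>} W (m + n) e"
    unfolding A.rel_basis_def using eW by simp
  then show ?thesis by (auto simp: A.has_dim_def)
qed

end

text \<open>Vectors with equal coordinates correspond to each other. Applied in each degree
  separately, this compares two trivialised modules with the same Hilbert function.\<close>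

lemma has_dim_bij:
  assumes "kspace K V" "kspace K V'" and W: "submodule W K V" "submodule W' K V'"
    and "kspace.has_dim K V W n" "kspace.has_dim K V' W' n"
  obtains f where "kspace_map K V V' W f" "bij_betw f W W'"
proof -
  interpret A: kspace K V by fact
  interpret B: kspace K V' by fact
  obtain a b where a: "A.rel_basis {\<zero>\<^bsub>V\<^esub>} W n a" and b: "B.rel_basis {\<zero>\<^bsub>V'\<^esub>} W' n b"
    using assms by (auto simp: A.has_dim_def B.has_dim_def)
  note Ac = A.submodule_subset[OF W(1)] and Bc = B.submodule_subset[OF W(2)]
  have ab: "a i \<in> W" "b i \<in> W'" "a i \<in> carrier V" "b i \<in> carrier V'" if "i < n" for i
    using that a b Ac Bc by (auto simp: A.rel_basis_def B.rel_basis_def)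
  obtain X where X: "\<And>w i. w \<in> W \<Longrightarrow> i < n \<Longrightarrow> X w i \<in> carrier K" "\<And>w. w \<in> W \<Longrightarrow> A.comb n (X w) a = w"
    and Xu: "\<And>w c i. \<lbrakk>w \<in> W; \<And>i. i < n \<Longrightarrow> c i \<in> carrier K; A.comb n c a = w; i < n\<rbrakk> \<Longrightarrow> X w i = c i"
    using A.has_dim_coordinates[OF A.V.submoduleE(1)[OF W(1)] a] by metis
  obtain Y where Y: "\<And>w i. w \<in> W' \<Longrightarrow> i < n \<Longrightarrow> Y w i \<in> carrier K" "\<And>w. w \<in> W' \<Longrightarrow> B.comb n (Y w) b = w"
    and Yu: "\<And>w c i. \<lbrakk>w \<in> W'; \<And>i. i < n \<Longrightarrow> c i \<in> carrier K; B.comb n c b = w; i < n\<rbrakk> \<Longrightarrow> Y w i = c i"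
    using B.has_dim_coordinates[OF B.V.submoduleE(1)[OF W(2)] b] by metis
  let ?f = "\<lambda>w. B.comb n (X w) b" and ?g = "\<lambda>w. A.comb n (Y w) a"
  have fW: "?f w \<in> W'" if "w \<in> W" for w using that X ab by (intro B.comb_in_submodule W) auto
  have gW: "?g w \<in> W" if "w \<in> W'" for w using that Y ab by (intro A.comb_in_submodule W) auto
  have gf: "?g (?f w) = w" if "w \<in> W" for w
  proof -
    have "?g (?f w) = A.comb n (X w) a"
      using Yu[OF fW[OF that], of "X w"] X(1)[OF that] Y(1)[OF fW[OF that]] ab
      by (intro A.comb_cong) auto
    then show ?thesis using X that by simp
  qed
  have fg: "?f (?g w) = w" if "w \<in> W'" for w
  proof -
    have "?f (?g w) = B.comb n (Y w) b"
      using Xu[OF gW[OF that], of "Y w"] Y(1)[OF that] X(1)[OF gW[OF that]] ab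
      by (intro B.comb_cong) auto
    then show ?thesis using Y that by simp
  qed
  have "kspace_map K V V' W ?f"
  proof (intro kspace_map.intro kspace_map_axioms.intro assms W)
    show "?f x \<in> carrier V'" if "x \<in> W" for x using fW[OF that] Bc by blast
    show "?f (x \<oplus>\<^bsub>V\<^esub> y) = ?f x \<oplus>\<^bsub>V'\<^esub> ?f y" if xy: "x \<in> W" "y \<in> W" for x y
    proof -
      have s: "x \<oplus>\<^bsub>V\<^esub> y \<in> W" using A.V.submoduleE(5)[OF W(1)] xy by blast
      have "A.comb n (\<lambda>i. X x i \<oplus>\<^bsub>K\<^esub> X y i) a = x \<oplus>\<^bsub>V\<^esub> y"
        using X xy ab by (subst A.comb_add) auto
      then have "?f (x \<oplus>\<^bsub>V\<^esub> y) = B.comb n (\<lambda>i. X x i \<oplus>\<^bsub>K\<^esub> X y i) b"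
        using Xu[OF s, of "\<lambda>i. X x i \<oplus>\<^bsub>K\<^esub> X y i"] X(1)[OF s] X(1)[OF xy(1)] X(1)[OF xy(2)] ab
        by (intro B.comb_cong) auto
      then show ?thesis using X xy ab by (subst (asm) B.comb_add) auto
    qed
    show "?f (c \<odot>\<^bsub>V\<^esub> x) = c \<odot>\<^bsub>V'\<^esub> ?f x" if cx: "c \<in> carrier K" "x \<in> W" for c x
    proof -
      have s: "c \<odot>\<^bsub>V\<^esub> x \<in> W" using A.V.submoduleE(4)[OF W(1)] cx by blast
      have "A.comb n (\<lambda>i. c \<otimes>\<^bsub>K\<^esub> X x i) a = c \<odot>\<^bsub>V\<^esub> x"
        using X cx ab by (subst A.comb_smult) auto
      then have "?f (c \<odot>\<^bsub>V\<^esub> x) = B.comb n (\<lambda>i. c \<otimes>\<^bsub>K\<^esub> X x i) b"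
        using Xu[OF s, of "\<lambda>i. c \<otimes>\<^bsub>K\<^esub> X x i"] X(1)[OF s] X(1)[OF cx(2)] cx ab
        by (intro B.comb_cong) auto
      then show ?thesis using X cx ab by (subst (asm) B.comb_smult) auto
    qed
  qed
  moreover have "bij_betw ?f W W'"
    by (rule bij_betw_byWitness[where f' = ?g]) (use fW gW fg gf in auto)
  ultimately show thesis by (rule that)
qed

text \<open>\<open>F\<close> will be a module of tuples whose carrier need not contain all
  functions, so its operations are only known to be pointwise on the carrier. Adding an index
  \<open>a\<close> applies rank-nullity to evaluation at \<open>a\<close>, whose kernel is the space
  for the smaller index set and whose image is \<open>W a\<close>.\<close>

lemma has_dim_functions:
  fixes V :: "('k, 'v, 'y) module_scheme" and F :: "('k, 'i \<Rightarrow> 'v, 'z) module_scheme"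
  assumes "kspace K V" "kspace K F"
    and add: "\<And>t u i. \<lbrakk>t \<in> carrier F; u \<in> carrier F\<rbrakk> \<Longrightarrow> (t \<oplus>\<^bsub>F\<^esub> u) i = t i \<oplus>\<^bsub>V\<^esub> u i"
    and smult: "\<And>c t i. \<lbrakk>c \<in> carrier K; t \<in> carrier F\<rbrakk> \<Longrightarrow> (c \<odot>\<^bsub>F\<^esub> t) i = c \<odot>\<^bsub>V\<^esub> t i"
    and zero: "\<zero>\<^bsub>F\<^esub> = (\<lambda>_. \<zero>\<^bsub>V\<^esub>)"
    and "finite I" "\<And>i. i \<in> I \<Longrightarrow> submodule (W i) K V" "\<And>i. i \<in> I \<Longrightarrow> kspace.has_dim K V (W i) (d i)"
    and "{t. (\<forall>i\<in>I. t i \<in> W i) \<and> (\<forall>i. i \<notin> I \<longrightarrow> t i = \<zero>\<^bsub>V\<^esub>)} \<subseteq> carrier F"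
  shows "submodule {t. (\<forall>i\<in>I. t i \<in> W i) \<and> (\<forall>i. i \<notin> I \<longrightarrow> t i = \<zero>\<^bsub>V\<^esub>)} K F \<and>
    kspace.has_dim K F {t. (\<forall>i\<in>I. t i \<in> W i) \<and> (\<forall>i. i \<notin> I \<longrightarrow> t i = \<zero>\<^bsub>V\<^esub>)} (\<Sum>i\<in>I. d i)"
  using assms(6-)
proof (induction I)
  interpret A: kspace K V by fact
  interpret F: kspace K F by fact
  case empty
  have "{t. (\<forall>i\<in>{}. t i \<in> W i) \<and> (\<forall>i. i \<notin> {} \<longrightarrow> t i = \<zero>\<^bsub>V\<^esub>)} = {\<zero>\<^bsub>F\<^esub>}" by (auto simp: zero)
  then show ?case using F.submodule_zero by (simp add: F.has_dim_zero_iff)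
next
  interpret A: kspace K V by fact
  interpret F: kspace K F by fact
  case (insert a I)
  let ?P = "\<lambda>I. {t. (\<forall>i\<in>I. t i \<in> W i) \<and> (\<forall>i. i \<notin> I \<longrightarrow> t i = \<zero>\<^bsub>V\<^esub>)}"
  note Wa = insert.prems(1)
  have P: "t \<in> carrier F" if "t \<in> ?P (insert a I)" for t using that insert.prems(3) by blast
  have W0: "\<zero>\<^bsub>V\<^esub> \<in> W i" if "i \<in> insert a I" for i using Wa[OF that] A.submodule_zero_mem by blast
  have sub: "?P I \<subseteq> ?P (insert a I)" using W0[of a] insert.hyps by auto
  have IH: "submodule (?P I) K F \<and> F.has_dim (?P I) (\<Sum>i\<in>I. d i)"
    using insert.prems sub by (intro insert.IH) auto
  have S: "submodule (?P (insert a I)) K F"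
  proof (rule F.submoduleI')
    show "?P (insert a I) \<subseteq> carrier F" using insert.prems(3) .
    show "\<zero>\<^bsub>F\<^esub> \<in> ?P (insert a I)" using W0 by (auto simp: zero)
    show "x \<oplus>\<^bsub>F\<^esub> y \<in> ?P (insert a I)" if xy: "x \<in> ?P (insert a I)" "y \<in> ?P (insert a I)" for x y
    proof -
      have "(x \<oplus>\<^bsub>F\<^esub> y) i \<in> W i" if i: "i \<in> insert a I" for i
        using A.V.submoduleE(5)[OF Wa[OF i], of "x i" "y i"] xy P i by (auto simp: add)
      then show ?thesis using xy P by (auto simp: add)
    qed
    show "c \<odot>\<^bsub>F\<^esub> x \<in> ?P (insert a I)" if cx: "c \<in> carrier K" "x \<in> ?P (insert a I)" for x c
    proof -
      have "(c \<odot>\<^bsub>F\<^esub> x) i \<in> W i" if i: "i \<in> insert a I" for i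
        using A.V.submoduleE(4)[OF Wa[OF i], of c "x i"] cx P i by (auto simp: smult)
      then show ?thesis using cx P by (auto simp: smult)
    qed
  qed
  interpret f: kspace_map K F V "?P (insert a I)" "\<lambda>t. t a"
  proof (intro kspace_map.intro kspace_map_axioms.intro assms(1,2) S)
    show "t a \<in> carrier V" if "t \<in> ?P (insert a I)" for t
      using that A.submodule_subset[OF Wa[of a]] by auto
  qed (rule add[OF P P] smult[OF _ P]; assumption)+
  have "{t \<in> ?P (insert a I). t a = \<zero>\<^bsub>V\<^esub>} = ?P I"
    using insert.hyps W0[of a] by auto
  then have 1: "F.has_dim {t \<in> ?P (insert a I). t a = \<zero>\<^bsub>V\<^esub>} (\<Sum>i\<in>I. d i)" using IH by simp
  have "w \<in> (\<lambda>t. t a) ` ?P (insert a I)" if "w \<in> W a" for w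
    by (rule image_eqI[of _ _ "\<lambda>i. if i = a then w else \<zero>\<^bsub>V\<^esub>"]) (use that W0 in auto)
  then have "(\<lambda>t. t a) ` ?P (insert a I) = W a" by auto
  then have "F.has_dim (?P (insert a I)) ((\<Sum>i\<in>I. d i) + d a)"
    using insert.prems(2) by (intro f.has_dim_exact 1) auto
  then show ?case using S insert.hyps by (simp add: add.commute)
qed

section \<open>Comparison with \<open>finite_dimensional\<close>\<close>

lemma finite_dimensional_spanning:
  assumes "kspace K V" "finite_dimensional K V W" "W \<subseteq> carrier V"
  obtains m b where "\<And>i. i < (m::nat) \<Longrightarrow> b i \<in> W"
    "\<And>w. w \<in> W \<Longrightarrow> \<exists>c. (\<forall>i<m. c i \<in> carrier K) \<and> w = kspace.comb V m c b"
proof -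
  interpret kspace K V by fact
  obtain B where B: "finite B" "B \<subseteq> W" "\<And>w. w \<in> W \<Longrightarrow> \<exists>c\<in>B \<rightarrow> carrier K. w = (\<Oplus>\<^bsub>V\<^esub>b\<in>B. c b \<odot>\<^bsub>V\<^esub> b)"
    using assms(2) by (auto simp: finite_dimensional_def)
  obtain e where e: "bij_betw e {..<card B} B"
    using B(1) ex_bij_betw_nat_finite lessThan_atLeast0 by metis
  have "\<exists>c. (\<forall>i<card B. c i \<in> carrier K) \<and> w = comb (card B) c e" if w: "w \<in> W" for w
  proof -
    obtain c where c: "c \<in> B \<rightarrow> carrier K" "w = (\<Oplus>\<^bsub>V\<^esub>b\<in>B. c b \<odot>\<^bsub>V\<^esub> b)" using B(3)[OF w] by blast
    have "c b \<odot>\<^bsub>V\<^esub> b \<in> carrier V" if "b \<in> B" for b using that c(1) B(2) assms(3) by blast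
    then have "(\<Oplus>\<^bsub>V\<^esub>b\<in>e ` {..<card B}. c b \<odot>\<^bsub>V\<^esub> b) = (\<Oplus>\<^bsub>V\<^esub>i\<in>{..<card B}. c (e i) \<odot>\<^bsub>V\<^esub> e i)"
      using e by (intro V.M.finsum_reindex) (auto simp: bij_betw_def)
    then have "w = comb (card B) (c \<circ> e) e" using c e by (simp add: comb_def bij_betw_def)
    moreover have "\<forall>i<card B. (c \<circ> e) i \<in> carrier K" using e c by (auto simp: bij_betw_def)
    ultimately show ?thesis by blast
  qed
  moreover have "e i \<in> W" if "i < card B" for i using that e B(2) by (auto simp: bij_betw_def)
  ultimately show thesis using that by blast
qed

text \<open>\<open>finite_dimensional\<close> speaks of a finite set of vectors instead of a family,
  so the basis is shown to be injective before its sum is reindexed.\<close>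

lemma has_dim_finite_dimensional:
  assumes "kspace K V" "kspace.has_dim K V W n" "W \<subseteq> carrier V"
  shows "finite_dimensional K V W"
proof -
  interpret kspace K V by fact
  obtain b where b: "rel_basis {\<zero>\<^bsub>V\<^esub>} W n b" using assms by (auto simp: has_dim_def)
  obtain X where X: "\<And>w i. w \<in> W \<Longrightarrow> i < n \<Longrightarrow> X w i \<in> carrier K" "\<And>w. w \<in> W \<Longrightarrow> comb n (X w) b = w"
    using has_dim_coordinates[OF assms(3) b] by metis
  have bW: "b i \<in> W" if "i < n" for i using b that by (auto simp: rel_basis_def)
  have bc: "b i \<in> carrier V" if "i < n" for i using bW[OF that] assms(3) by blast
  have inj: "inj_on b {..<n}"
  proof (rule inj_onI, rule ccontr)
    fix i j assume ij: "i \<in> {..<n}" "j \<in> {..<n}" "b i = b j" "i \<noteq> j"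
    \<comment> \<open>Equal basis vectors at distinct places would give a nontrivial relation, whose
      coefficients are one unit vector minus another.\<close>
    define u where "u i = (\<lambda>j. if j = i then \<one>\<^bsub>K\<^esub> else \<zero>\<^bsub>K\<^esub>)" for i :: nat
    have u: "u i k \<in> carrier K" for i k by (simp add: u_def)
    have "comb n (\<lambda>k. u i k \<oplus>\<^bsub>K\<^esub> \<ominus>\<^bsub>K\<^esub> u j k) b = comb n (u i) b \<oplus>\<^bsub>V\<^esub> \<ominus>\<^bsub>V\<^esub> comb n (u j) b"
      using bc u by (subst comb_add) (auto simp: comb_minus)
    also have "\<dots> = \<zero>\<^bsub>V\<^esub>"
      using ij bc comb_unit_vector[of _ n b] by (simp add: u_def V.M.r_neg)
    finally have "comb n (\<lambda>k. u i k \<oplus>\<^bsub>K\<^esub> \<ominus>\<^bsub>K\<^esub> u j k) b = \<zero>\<^bsub>V\<^esub>" .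
    then have "u i i \<oplus>\<^bsub>K\<^esub> \<ominus>\<^bsub>K\<^esub> u j i = \<zero>\<^bsub>K\<^esub>"
      using u ij by (intro rel_basis_independent[OF b, of "\<lambda>k. u i k \<oplus>\<^bsub>K\<^esub> \<ominus>\<^bsub>K\<^esub> u j k"]) auto
    then show False using ij by (simp add: u_def)
  qed
  have "\<exists>c\<in>b ` {..<n} \<rightarrow> carrier K. w = (\<Oplus>\<^bsub>V\<^esub>v\<in>b ` {..<n}. c v \<odot>\<^bsub>V\<^esub> v)" if w: "w \<in> W" for w
  proof (rule bexI)
    let ?c = "\<lambda>v. X w (inv_into {..<n} b v)"
    show c: "?c \<in> b ` {..<n} \<rightarrow> carrier K" using X(1)[OF w] inj by auto
    have "(\<Oplus>\<^bsub>V\<^esub>v\<in>b ` {..<n}. ?c v \<odot>\<^bsub>V\<^esub> v) = (\<Oplus>\<^bsub>V\<^esub>i\<in>{..<n}. ?c (b i) \<odot>\<^bsub>V\<^esub> b i)"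
      using inj X(1)[OF w] bc by (intro V.M.finsum_reindex) auto
    also have "\<dots> = comb n (X w) b" unfolding comb_def
      using inj X(1)[OF w] bc by (intro V.M.finsum_cong') auto
    finally show "w = (\<Oplus>\<^bsub>V\<^esub>v\<in>b ` {..<n}. ?c v \<odot>\<^bsub>V\<^esub> v)" using X(2)[OF w] by simp
  qed
  then show ?thesis unfolding finite_dimensional_def using bW
    by (intro exI[of _ "b ` {..<n}"]) auto
qed

lemma finite_dimensional_has_dim:
  assumes "kspace K V" "finite_dimensional K V W" "submodule W K V"
  shows "kspace.has_dim K V W (kspace.vdim K V W)"
proof -
  interpret kspace K V by fact
  have Wc: "W \<subseteq> carrier V" using V.submoduleE(1)[OF assms(3)] .
  obtain m b where mb: "\<And>i. i < (m::nat) \<Longrightarrow> b i \<in> W"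
    "\<And>w. w \<in> W \<Longrightarrow> \<exists>c. (\<forall>i<m. c i \<in> carrier K) \<and> w = comb m c b"
    using finite_dimensional_spanning[OF assms(1,2) Wc] by metis
  obtain n where "has_dim W n"
    using rel_basis_exists[OF submodule_zero assms(3) mb] by (auto simp: has_dim_def)
  then show ?thesis using vdim_eq[OF Wc] by simp
qed

section \<open>Homogeneous parts\<close>

text \<open>The homogeneous parts of \<open>m\<close>, as supplied by the unique decomposition in
  \<open>graded_space\<close>; for \<open>m\<close> outside the carrier of a graded module the value
  is unspecified.\<close>

definition hp :: "('a, 'm, 'g) graded_module \<Rightarrow> 'm \<Rightarrow> 'g \<Rightarrow> 'm"
  where "hp M m = (THE f. (\<forall>g. f g \<in> component M g) \<and> finite {g. f g \<noteq> \<zero>\<^bsub>M\<^esub>} \<and>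
    m = (\<Oplus>\<^bsub>M\<^esub>g\<in>{g. f g \<noteq> \<zero>\<^bsub>M\<^esub>}. f g))"

text \<open>The \<open>smult\<close> field of the record \<open>R\<close> holds the action of
  \<open>K\<close>. Here it is replaced by the ring multiplication, so that results on graded
  modules apply to \<open>R\<close>.\<close>

definition self_module :: "('k, 'r, 'g) graded_module \<Rightarrow> ('r, 'r, 'g) graded_module"
  where "self_module R = \<lparr>carrier = carrier R, mult = mult R, one = \<one>\<^bsub>R\<^esub>, ring.zero = \<zero>\<^bsub>R\<^esub>,
    add = add R, smult = mult R, component = component R\<rparr>"

lemma self_module_simps [simp]:
  "carrier (self_module R) = carrier R" "\<zero>\<^bsub>self_module R\<^esub> = \<zero>\<^bsub>R\<^esub>"
  "x \<oplus>\<^bsub>self_module R\<^esub> y = x \<oplus>\<^bsub>R\<^esub> y" "a \<odot>\<^bsub>self_module R\<^esub> x = a \<otimes>\<^bsub>R\<^esub> x"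
  "component (self_module R) = component R"
  by (simp_all add: self_module_def)

text \<open>Sums see only carrier, addition and zero. Restricting scalars, trivialising the action
  and passing from \<open>R\<close> to \<open>self_module R\<close> therefore leave all sums
  unchanged.\<close>

lemma finsum_cong_record:
  assumes "carrier M = carrier N" "add M = add N" "\<zero>\<^bsub>M\<^esub> = \<zero>\<^bsub>N\<^esub>"
  shows "finsum M = finsum N"
  unfolding finsum_def assms by (simp add: fun_eq_iff finprod_def)

lemma restrict_scalars_simps [simp]:
  "carrier (restrict_scalars R M) = carrier M" "\<zero>\<^bsub>restrict_scalars R M\<^esub> = \<zero>\<^bsub>M\<^esub>"
  "x \<oplus>\<^bsub>restrict_scalars R M\<^esub> y = x \<oplus>\<^bsub>M\<^esub> y" "component (restrict_scalars R M) = component M"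
  "c \<odot>\<^bsub>restrict_scalars R M\<^esub> x = (c \<odot>\<^bsub>R\<^esub> \<one>\<^bsub>R\<^esub>) \<odot>\<^bsub>M\<^esub> x"
  "finsum (restrict_scalars R M) = finsum M"
proof -
  show "finsum (restrict_scalars R M) = finsum M"
    by (rule finsum_cong_record) (simp_all add: restrict_scalars_def)
qed (simp_all add: restrict_scalars_def)

locale pdcf_algebra =
  fixes K :: "'k ring" and R :: "('k, 'r, 'g::ab_group_add) graded_module"
  assumes field_K: "field K" and graded_algebra: "graded_algebra K R"
    and domain_R: "domain R" and pdcf: "pdcf K R"
begin

sublocale K: field K by (rule field_K)
sublocale R: domain R by (rule domain_R)
sublocale A: algebra K R using graded_algebra by (simp add: graded_algebra_def)

lemma scalar_closed [simp]: "c \<in> carrier K \<Longrightarrow> c \<odot>\<^bsub>R\<^esub> \<one>\<^bsub>R\<^esub> \<in> carrier R"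
  by auto

lemma smult_eq_scalar_mult:
  "\<lbrakk>c \<in> carrier K; x \<in> carrier R\<rbrakk> \<Longrightarrow> (c \<odot>\<^bsub>R\<^esub> \<one>\<^bsub>R\<^esub>) \<otimes>\<^bsub>R\<^esub> x = c \<odot>\<^bsub>R\<^esub> x"
  by (simp add: A.smult_assoc2)

lemma scalar_mult:
  "\<lbrakk>c \<in> carrier K; d \<in> carrier K\<rbrakk> \<Longrightarrow> (c \<otimes>\<^bsub>K\<^esub> d) \<odot>\<^bsub>R\<^esub> \<one>\<^bsub>R\<^esub> = (c \<odot>\<^bsub>R\<^esub> \<one>\<^bsub>R\<^esub>) \<otimes>\<^bsub>R\<^esub> (d \<odot>\<^bsub>R\<^esub> \<one>\<^bsub>R\<^esub>)"
  by (simp add: A.smult_assoc1 smult_eq_scalar_mult)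

lemma component_0: "component R 0 = (\<lambda>c. c \<odot>\<^bsub>R\<^esub> \<one>\<^bsub>R\<^esub>) ` carrier K"
  using pdcf by (simp add: pdcf_def)

lemma one_component: "\<one>\<^bsub>R\<^esub> \<in> component R 0"
  unfolding component_0 by (rule image_eqI[of _ _ "\<one>\<^bsub>K\<^esub>"]) auto

lemma graded_space_R: "graded_space K R"
  using graded_algebra by (simp add: graded_algebra_def)

lemma R_component_closed: "x \<in> component R g \<Longrightarrow> x \<in> carrier R"
  by (rule graded_space_component_closed[OF graded_space_R])

lemma R_component_zero: "\<zero>\<^bsub>R\<^esub> \<in> component R g"
  using graded_space_R subgroup.one_closed[OF submodule.axioms(1), of "component R g" K R]
  by (simp add: graded_space_def)

lemma module_restrict_scalars:
  assumes "module R M"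
  shows "module K (restrict_scalars R M)"
proof -
  interpret M: module R M by fact
  have "abelian_group (restrict_scalars R M)"
  proof (rule abelian_groupI)
    fix x assume "x \<in> carrier (restrict_scalars R M)"
    then show "\<exists>y\<in>carrier (restrict_scalars R M). y \<oplus>\<^bsub>restrict_scalars R M\<^esub> x = \<zero>\<^bsub>restrict_scalars R M\<^esub>"
      by (intro bexI[of _ "\<ominus>\<^bsub>M\<^esub> x"]) (auto simp: M.M.l_neg)
  qed (auto simp: M.M.a_ac)
  then show ?thesis
    by (intro moduleI K.is_cring)
      (auto simp: M.smult_l_distr M.smult_r_distr M.smult_assoc1 A.smult_l_distr scalar_mult)
qed

end

locale graded_module_over = pdcf_algebra K R
  for K :: "'k ring" and R :: "('k, 'r, 'g::ab_group_add) graded_module" +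
  fixes M :: "('r, 'm, 'g) graded_module"
  assumes graded: "is_graded_module K R M"
begin

lemma module_M: "module R M"
  using graded by (simp add: is_graded_module_def)

sublocale M: module R M by (rule module_M)

sublocale V: kspace K "restrict_scalars R M"
  by (intro kspace.intro field_K module_restrict_scalars module_M)

lemma component_submodule: "submodule (component M g) K (restrict_scalars R M)"
  using graded by (simp add: is_graded_module_def graded_space_def)

lemma component_closed: "x \<in> component M g \<Longrightarrow> x \<in> carrier M"
  using V.submodule_subset[OF component_submodule] by simp

lemma component_zero [simp]: "\<zero>\<^bsub>M\<^esub> \<in> component M g"
  using V.submodule_zero_mem[OF component_submodule] by simp

lemma component_add: "\<lbrakk>x \<in> component M g; y \<in> component M g\<rbrakk> \<Longrightarrow> x \<oplus>\<^bsub>M\<^esub> y \<in> component M g"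
  using V.V.submoduleE(5)[OF component_submodule] by simp

lemma component_scalar:
  "\<lbrakk>c \<in> carrier K; x \<in> component M g\<rbrakk> \<Longrightarrow> (c \<odot>\<^bsub>R\<^esub> \<one>\<^bsub>R\<^esub>) \<odot>\<^bsub>M\<^esub> x \<in> component M g"
  using V.V.submoduleE(4)[OF component_submodule] by simp

lemma component_smult: "\<lbrakk>a \<in> component R q; x \<in> component M g\<rbrakk> \<Longrightarrow> a \<odot>\<^bsub>M\<^esub> x \<in> component M (q + g)"
  using graded by (simp add: is_graded_module_def)

lemma component_finsum:
  "(\<And>i. i \<in> I \<Longrightarrow> x i \<in> component M g) \<Longrightarrow> (\<Oplus>\<^bsub>M\<^esub>i\<in>I. x i) \<in> component M g"
proof (induction I rule: infinite_finite_induct)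
  case (insert a I)
  then show ?case using component_closed
    by (subst M.M.finsum_insert) (auto intro!: component_add)
qed auto

lemma decomposition:
  "m \<in> carrier M \<Longrightarrow> \<exists>!f. (\<forall>g. f g \<in> component M g) \<and> finite {g. f g \<noteq> \<zero>\<^bsub>M\<^esub>} \<and>
     m = (\<Oplus>\<^bsub>M\<^esub>g\<in>{g. f g \<noteq> \<zero>\<^bsub>M\<^esub>}. f g)"
  using graded unfolding is_graded_module_def graded_space_def by simp

lemma
  assumes "m \<in> carrier M"
  shows hp_component: "hp M m g \<in> component M g" and hp_finite: "finite {g. hp M m g \<noteq> \<zero>\<^bsub>M\<^esub>}"
    and hp_sum: "(\<Oplus>\<^bsub>M\<^esub>g\<in>{g. hp M m g \<noteq> \<zero>\<^bsub>M\<^esub>}. hp M m g) = m"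
  using theI'[OF decomposition[OF assms]] unfolding hp_def[symmetric] by auto

lemma hp_closed [simp, intro]: "m \<in> carrier M \<Longrightarrow> hp M m g \<in> carrier M"
  using hp_component component_closed by blast

lemma hp_sum_superset:
  assumes "m \<in> carrier M" "finite G" "{g. hp M m g \<noteq> \<zero>\<^bsub>M\<^esub>} \<subseteq> G"
  shows "(\<Oplus>\<^bsub>M\<^esub>g\<in>G. hp M m g) = m"
proof -
  have "(\<Oplus>\<^bsub>M\<^esub>g\<in>{g. hp M m g \<noteq> \<zero>\<^bsub>M\<^esub>}. hp M m g) = (\<Oplus>\<^bsub>M\<^esub>g\<in>G. hp M m g)"
    using assms by (intro M.M.add.finprod_mono_neutral_cong_left) auto
  then show ?thesis using hp_sum[OF assms(1)] by simp
qed

text \<open>The finite set \<open>G\<close> need only contain the degrees where \<open>f\<close> is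
  nonzero, which spares the applications an exact computation of these degrees.\<close>

lemma hp_unique:
  assumes "\<And>g. f g \<in> component M g" "finite G" "\<And>g. g \<notin> G \<Longrightarrow> f g = \<zero>\<^bsub>M\<^esub>" "m = (\<Oplus>\<^bsub>M\<^esub>g\<in>G. f g)"
  shows "hp M m = f"
proof -
  have sub: "{g. f g \<noteq> \<zero>\<^bsub>M\<^esub>} \<subseteq> G" using assms(3) by auto
  have c: "f g \<in> carrier M" for g using component_closed[OF assms(1)] .
  have "(\<Oplus>\<^bsub>M\<^esub>g\<in>{g. f g \<noteq> \<zero>\<^bsub>M\<^esub>}. f g) = (\<Oplus>\<^bsub>M\<^esub>g\<in>G. f g)"
    using assms sub c by (intro M.M.add.finprod_mono_neutral_cong_left) auto
  moreover have "m \<in> carrier M" using assms(4) c by (auto intro!: M.M.finsum_closed)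
  ultimately show ?thesis unfolding hp_def
    using assms(1,2,4) finite_subset[OF sub] by (intro the1_equality decomposition) auto
qed

lemma hp_homogeneous: "m \<in> component M h \<Longrightarrow> hp M m = (\<lambda>g. if g = h then m else \<zero>\<^bsub>M\<^esub>)"
  using component_closed[of m h] by (intro hp_unique[of _ "{h}"]) (auto simp: Pi_iff)

lemma hp_zero [simp]: "hp M \<zero>\<^bsub>M\<^esub> g = \<zero>\<^bsub>M\<^esub>"
  using hp_homogeneous[of "\<zero>\<^bsub>M\<^esub>" g] by auto

lemma hp_add:
  assumes "x \<in> carrier M" "y \<in> carrier M"
  shows "hp M (x \<oplus>\<^bsub>M\<^esub> y) g = hp M x g \<oplus>\<^bsub>M\<^esub> hp M y g"
proof -
  let ?G = "{g. hp M x g \<noteq> \<zero>\<^bsub>M\<^esub>} \<union> {g. hp M y g \<noteq> \<zero>\<^bsub>M\<^esub>}"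
  have fin: "finite ?G" using assms hp_finite by auto
  have "hp M (x \<oplus>\<^bsub>M\<^esub> y) = (\<lambda>g. hp M x g \<oplus>\<^bsub>M\<^esub> hp M y g)"
  proof (rule hp_unique[OF _ fin])
    have "(\<Oplus>\<^bsub>M\<^esub>g\<in>?G. hp M x g \<oplus>\<^bsub>M\<^esub> hp M y g) = (\<Oplus>\<^bsub>M\<^esub>g\<in>?G. hp M x g) \<oplus>\<^bsub>M\<^esub> (\<Oplus>\<^bsub>M\<^esub>g\<in>?G. hp M y g)"
      using assms by (intro M.M.finsum_addf) auto
    also have "(\<Oplus>\<^bsub>M\<^esub>g\<in>?G. hp M x g) = x" using assms fin by (intro hp_sum_superset) auto
    also have "(\<Oplus>\<^bsub>M\<^esub>g\<in>?G. hp M y g) = y" using assms fin by (intro hp_sum_superset) auto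
    finally show "x \<oplus>\<^bsub>M\<^esub> y = (\<Oplus>\<^bsub>M\<^esub>g\<in>?G. hp M x g \<oplus>\<^bsub>M\<^esub> hp M y g)" by simp
  qed (use assms in \<open>auto intro!: component_add hp_component\<close>)
  then show ?thesis by simp
qed

lemma hp_finsum:
  "(\<And>i. i \<in> I \<Longrightarrow> x i \<in> carrier M) \<Longrightarrow> hp M (\<Oplus>\<^bsub>M\<^esub>i\<in>I. x i) g = (\<Oplus>\<^bsub>M\<^esub>i\<in>I. hp M (x i) g)"
proof (induction I rule: infinite_finite_induct)
  case (insert a I)
  then have "(\<Oplus>\<^bsub>M\<^esub>i\<in>I. x i) \<in> carrier M" by (auto intro!: M.M.finsum_closed)
  moreover have "(\<Oplus>\<^bsub>M\<^esub>i\<in>insert a I. x i) = x a \<oplus>\<^bsub>M\<^esub> (\<Oplus>\<^bsub>M\<^esub>i\<in>I. x i)"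
    "(\<Oplus>\<^bsub>M\<^esub>i\<in>insert a I. hp M (x i) g) = hp M (x a) g \<oplus>\<^bsub>M\<^esub> (\<Oplus>\<^bsub>M\<^esub>i\<in>I. hp M (x i) g)"
    using insert by (auto intro!: M.M.finsum_insert)
  ultimately show ?case using insert by (simp add: hp_add)
qed auto

lemma hp_eqI:
  assumes "x \<in> carrier M" "y \<in> carrier M" "\<And>g. hp M x g = hp M y g"
  shows "x = y"
proof -
  have "hp M x = hp M y" using assms(3) by (rule ext)
  then show ?thesis using hp_sum[OF assms(1)] hp_sum[OF assms(2)] by metis
qed

lemma hp_smult:
  assumes a: "a \<in> component R q" and m: "m \<in> carrier M"
  shows "hp M (a \<odot>\<^bsub>M\<^esub> m) g = a \<odot>\<^bsub>M\<^esub> hp M m (g - q)"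
proof -
  let ?G = "{g. hp M m g \<noteq> \<zero>\<^bsub>M\<^esub>}"
  have ac: "a \<in> carrier R" using a by (rule R_component_closed)
  have "hp M (a \<odot>\<^bsub>M\<^esub> m) = (\<lambda>g. a \<odot>\<^bsub>M\<^esub> hp M m (g - q))"
  proof (rule hp_unique[of _ "(\<lambda>g. q + g) ` ?G"])
    show "a \<odot>\<^bsub>M\<^esub> hp M m (g - q) \<in> component M g" for g
      using component_smult[OF a hp_component[OF m, of "g - q"]] by simp
    show "finite ((\<lambda>g. q + g) ` ?G)" using hp_finite[OF m] by simp
    show "a \<odot>\<^bsub>M\<^esub> hp M m (g - q) = \<zero>\<^bsub>M\<^esub>" if "g \<notin> (\<lambda>g. q + g) ` ?G" for g
    proof -
      have "hp M m (g - q) = \<zero>\<^bsub>M\<^esub>" using that by (metis (mono_tags, lifting) add.commute diff_add_cancel image_eqI mem_Collect_eq)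
      then show ?thesis using ac by simp
    qed
    have "a \<odot>\<^bsub>M\<^esub> m = (\<Oplus>\<^bsub>M\<^esub>g\<in>?G. a \<odot>\<^bsub>M\<^esub> hp M m g)"
      using ac m hp_finite[OF m] by (subst (1) hp_sum[OF m, symmetric]) (intro M.finsum_smult_ldistr, auto)
    also have "\<dots> = (\<Oplus>\<^bsub>M\<^esub>g\<in>(\<lambda>g. q + g) ` ?G. a \<odot>\<^bsub>M\<^esub> hp M m (g - q))"
      using ac m by (subst M.M.finsum_reindex) auto
    finally show "a \<odot>\<^bsub>M\<^esub> m = (\<Oplus>\<^bsub>M\<^esub>g\<in>(\<lambda>g. q + g) ` ?G. a \<odot>\<^bsub>M\<^esub> hp M m (g - q))" .
  qed
  then show ?thesis by simp
qed

lemma hp_zero_outside: "\<lbrakk>m \<in> carrier M; g \<notin> support M\<rbrakk> \<Longrightarrow> hp M m g = \<zero>\<^bsub>M\<^esub>"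
  using hp_component[of m g] by (auto simp: support_def)

lemma component_zero_iff: "g \<notin> support M \<longleftrightarrow> component M g = {\<zero>\<^bsub>M\<^esub>}"
  by (auto simp: support_def)

end

section \<open>A criterion for gradings, and the ring as a module over itself\<close>

context pdcf_algebra begin

text \<open>Uniqueness of decompositions follows from the additivity of the candidate
  \<open>H\<close> and its values on homogeneous elements: applied to a finite sum of homogeneous
  elements of distinct degrees, \<open>H\<close> returns the summands. Components are closed under
  the scalars of \<open>K\<close> because these act through degree 0 of \<open>R\<close>.\<close>

lemma graded_moduleI:
  fixes M :: "('r, 'm, 'g) graded_module"
  assumes M: "module R M" and sub: "\<And>g. component M g \<subseteq> carrier M" and zero: "\<And>g. \<zero>\<^bsub>M\<^esub> \<in> component M g"
    and add: "\<And>g x y. x \<in> component M g \<Longrightarrow> y \<in> component M g \<Longrightarrow> x \<oplus>\<^bsub>M\<^esub> y \<in> component M g"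
    and smult: "\<And>g q a x. a \<in> component R q \<Longrightarrow> x \<in> component M g \<Longrightarrow> a \<odot>\<^bsub>M\<^esub> x \<in> component M (q + g)"
    and H: "\<And>m g. m \<in> carrier M \<Longrightarrow> H m g \<in> component M g"
      "\<And>m. m \<in> carrier M \<Longrightarrow> finite {g. H m g \<noteq> \<zero>\<^bsub>M\<^esub>}"
      "\<And>m. m \<in> carrier M \<Longrightarrow> (\<Oplus>\<^bsub>M\<^esub>g\<in>{g. H m g \<noteq> \<zero>\<^bsub>M\<^esub>}. H m g) = m"
      "\<And>x y g. x \<in> carrier M \<Longrightarrow> y \<in> carrier M \<Longrightarrow> H (x \<oplus>\<^bsub>M\<^esub> y) g = H x g \<oplus>\<^bsub>M\<^esub> H y g"
      "\<And>m g h. m \<in> component M h \<Longrightarrow> H m g = (if g = h then m else \<zero>\<^bsub>M\<^esub>)"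
  shows "is_graded_module K R M" "graded_module_over K R M" "\<And>m g. m \<in> carrier M \<Longrightarrow> hp M m g = H m g"
proof -
  interpret M: module R M by fact
  interpret V: kspace K "restrict_scalars R M"
    by (intro kspace.intro field_K module_restrict_scalars M)
  have c: "x \<in> carrier M" if "x \<in> component M g" for x g using sub that by blast
  have submod: "submodule (component M g) K (restrict_scalars R M)" for g
  proof (rule V.submoduleI')
    show "k \<odot>\<^bsub>restrict_scalars R M\<^esub> x \<in> component M g" if "k \<in> carrier K" "x \<in> component M g" for k x
      using smult[of "k \<odot>\<^bsub>R\<^esub> \<one>\<^bsub>R\<^esub>" 0 x g] that by (simp add: component_0)
  qed (use sub zero add in auto)
  have Hsum: "H (\<Oplus>\<^bsub>M\<^esub>g\<in>G. f g) h = (\<Oplus>\<^bsub>M\<^esub>g\<in>G. H (f g) h)" if "finite G" "\<And>g. f g \<in> component M g" for G f h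
    using that(1)
  proof induction
    case empty
    show ?case using H(5)[OF zero, of h h] by simp
  next
    case (insert a G)
    have HC: "H (f g) h \<in> carrier M" for g using H(1) c that(2) by blast
    have "(\<Oplus>\<^bsub>M\<^esub>g\<in>insert a G. f g) = f a \<oplus>\<^bsub>M\<^esub> (\<Oplus>\<^bsub>M\<^esub>g\<in>G. f g)" "(\<Oplus>\<^bsub>M\<^esub>g\<in>G. f g) \<in> carrier M"
      "(\<Oplus>\<^bsub>M\<^esub>g\<in>insert a G. H (f g) h) = H (f a) h \<oplus>\<^bsub>M\<^esub> (\<Oplus>\<^bsub>M\<^esub>g\<in>G. H (f g) h)"
      using insert.hyps c[OF that(2)] HC by (auto intro!: M.M.finsum_insert M.M.finsum_closed)
    then show ?case using insert.IH c[OF that(2)] by (simp add: H(4))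
  qed
  have "\<exists>!f. (\<forall>g. f g \<in> component M g) \<and> finite {g. f g \<noteq> \<zero>\<^bsub>M\<^esub>} \<and> m = (\<Oplus>\<^bsub>M\<^esub>g\<in>{g. f g \<noteq> \<zero>\<^bsub>M\<^esub>}. f g)"
    if m: "m \<in> carrier M" for m
  proof (rule ex1I[of _ "H m"])
    show "(\<forall>g. H m g \<in> component M g) \<and> finite {g. H m g \<noteq> \<zero>\<^bsub>M\<^esub>} \<and> m = (\<Oplus>\<^bsub>M\<^esub>g\<in>{g. H m g \<noteq> \<zero>\<^bsub>M\<^esub>}. H m g)"
      using H(1-3)[OF m] by auto
  next
    fix f assume f: "(\<forall>g. f g \<in> component M g) \<and> finite {g. f g \<noteq> \<zero>\<^bsub>M\<^esub>} \<and> m = (\<Oplus>\<^bsub>M\<^esub>g\<in>{g. f g \<noteq> \<zero>\<^bsub>M\<^esub>}. f g)"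
    show "f = H m"
    proof
      fix h
      let ?G = "{g. f g \<noteq> \<zero>\<^bsub>M\<^esub>}"
      have fc: "f g \<in> carrier M" for g using f c by blast
      have "H m h = (\<Oplus>\<^bsub>M\<^esub>g\<in>?G. H (f g) h)" using Hsum[of ?G f h] f by auto
      also have "\<dots> = (\<Oplus>\<^bsub>M\<^esub>g\<in>?G. if h = g then f g else \<zero>\<^bsub>M\<^esub>)"
        using f H(5) fc by (intro M.M.finsum_cong') (auto simp: Pi_iff)
      also have "\<dots> = f h"
      proof (cases "h \<in> ?G")
        case True
        then show ?thesis using f fc M.M.finsum_singleton[of h ?G f] by (auto simp: Pi_iff)
      next
        case False
        then have "(\<Oplus>\<^bsub>M\<^esub>g\<in>?G. if h = g then f g else \<zero>\<^bsub>M\<^esub>) = (\<Oplus>\<^bsub>M\<^esub>g\<in>?G. \<zero>\<^bsub>M\<^esub>)"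
          by (intro M.M.finsum_cong') auto
        then show ?thesis using False by simp
      qed
      finally show "f h = H m h" by simp
    qed
  qed
  then show G: "is_graded_module K R M"
    unfolding is_graded_module_def graded_space_def
    using M submod smult V.module_V by auto
  then show I: "graded_module_over K R M"
    by (intro graded_module_over.intro graded_module_over_axioms.intro pdcf_algebra_axioms)
  interpret N: graded_module_over K R M by (rule I)
  fix m g assume m: "m \<in> carrier M"
  have "hp M m = H m"
    using H(1-3)[OF m] by (intro N.hp_unique[of _ "{g. H m g \<noteq> \<zero>\<^bsub>M\<^esub>}"]) auto
  then show "hp M m g = H m g" by simp
qed

lemma graded_module_self: "graded_module_over K R (self_module R)"
proof -
  have M: "module R (self_module R)"
  proof (intro moduleI R.is_cring abelian_groupI)
    fix x assume "x \<in> carrier (self_module R)"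
    then show "\<exists>y\<in>carrier (self_module R). y \<oplus>\<^bsub>self_module R\<^esub> x = \<zero>\<^bsub>self_module R\<^esub>"
      by (intro bexI[of _ "\<ominus>\<^bsub>R\<^esub> x"]) (auto simp: R.l_neg)
  qed (auto simp: R.a_ac R.m_ac R.l_distr R.r_distr)
  interpret V: kspace K "restrict_scalars R (self_module R)"
    by (intro kspace.intro field_K module_restrict_scalars M)
  note S = graded_space_R[unfolded graded_space_def]
  have fs: "finsum (self_module R) = finsum R"
    by (rule finsum_cong_record) (auto simp: self_module_def)
  have "submodule (component R g) K (restrict_scalars R (self_module R))" for g
  proof (rule V.submoduleI')
    have sub: "submodule (component R g) K R" using S by blast
    note E = A.submoduleE[OF sub]
    show "component R g \<subseteq> carrier (restrict_scalars R (self_module R))" using E(1) by simp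
    show "\<zero>\<^bsub>restrict_scalars R (self_module R)\<^esub> \<in> component R g" using R_component_zero by simp
    show "x \<oplus>\<^bsub>restrict_scalars R (self_module R)\<^esub> y \<in> component R g"
      if "x \<in> component R g" "y \<in> component R g" for x y using E(5)[OF that] by simp
    show "c \<odot>\<^bsub>restrict_scalars R (self_module R)\<^esub> x \<in> component R g"
      if "c \<in> carrier K" "x \<in> component R g" for x c
      using E(4)[OF that] that R_component_closed by (simp add: smult_eq_scalar_mult)
  qed
  then have "is_graded_module K R (self_module R)"
    unfolding is_graded_module_def graded_space_def
    using M V.module_V S graded_algebra by (auto simp: fs graded_algebra_def)
  then show ?thesis
    by (intro graded_module_over.intro graded_module_over_axioms.intro pdcf_algebra_axioms)
qed

sublocale S: graded_module_over K R "self_module R" by (rule graded_module_self)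

lemma R_component_mult: "\<lbrakk>a \<in> component R p; b \<in> component R q\<rbrakk> \<Longrightarrow> a \<otimes>\<^bsub>R\<^esub> b \<in> component R (p + q)"
  using S.component_smult by simp

end

text \<open>The convolution formula for a product. The scalar is expanded by applying to its
  decomposition the homomorphism from \<open>R\<close> to \<open>M\<close> that multiplies
  \<open>m\<close> by a ring element.\<close>

lemma (in graded_module_over) hp_smult_sum:
  assumes a: "a \<in> carrier R" and m: "m \<in> carrier M" and "finite P" "{q. hp (self_module R) a q \<noteq> \<zero>\<^bsub>R\<^esub>} \<subseteq> P"
  shows "hp M (a \<odot>\<^bsub>M\<^esub> m) g = (\<Oplus>\<^bsub>M\<^esub>q\<in>P. hp (self_module R) a q \<odot>\<^bsub>M\<^esub> hp M m (g - q))"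
proof -
  let ?h = "hp (self_module R)"
  have hc: "?h a q \<in> carrier R" for q using S.hp_closed[of a] a by simp
  have sumR: "a = (\<Oplus>\<^bsub>self_module R\<^esub>q\<in>P. ?h a q)" using assms by (subst S.hp_sum_superset) auto
  have "a \<odot>\<^bsub>M\<^esub> m = (\<Oplus>\<^bsub>M\<^esub>q\<in>P. ?h a q \<odot>\<^bsub>M\<^esub> m)"
  proof -
    have "(\<lambda>x. x \<odot>\<^bsub>M\<^esub> m) \<in> module_hom R (self_module R) M"
      using m by (auto simp: module_hom_def M.smult_l_distr M.smult_assoc1)
    from module_hom_finsum[OF S.module_M module_M this assms(3), of "?h a"] show ?thesis
      using hc sumR by auto
  qed
  then have "hp M (a \<odot>\<^bsub>M\<^esub> m) g = (\<Oplus>\<^bsub>M\<^esub>q\<in>P. hp M (?h a q \<odot>\<^bsub>M\<^esub> m) g)"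
    using hc m by (simp add: hp_finsum)
  also have "\<dots> = (\<Oplus>\<^bsub>M\<^esub>q\<in>P. ?h a q \<odot>\<^bsub>M\<^esub> hp M m (g - q))"
    using hc m S.hp_component[of a] a by (intro M.M.finsum_cong') (auto simp: hp_smult)
  finally show ?thesis .
qed

section \<open>Graded homomorphisms\<close>

lemma (in kspace_map) has_dim_image:
  assumes "inj_on f W" "A.has_dim W n"
  shows "B.has_dim (f ` W) n"
proof -
  obtain b where b: "A.rel_basis {\<zero>\<^bsub>V\<^esub>} W n b" using assms(2) by (auto simp: A.has_dim_def)
  note Wc = A.submodule_subset[OF W]
  have bW: "b i \<in> W" if "i < n" for i using b that by (auto simp: A.rel_basis_def)
  have fc: "B.comb n c (\<lambda>i. f (b i)) = f (A.comb n c b)" if "\<forall>i<n. c i \<in> carrier K" for c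
    using that bW by (intro f_comb[symmetric]) auto
  have cW: "A.comb n c b \<in> W" if "\<forall>i<n. c i \<in> carrier K" for c
    using that bW by (intro A.comb_in_submodule[OF W]) auto
  have "\<exists>c. (\<forall>i<n. c i \<in> carrier K) \<and> f w = \<zero>\<^bsub>V'\<^esub> \<oplus>\<^bsub>V'\<^esub> B.comb n c (\<lambda>i. f (b i))" if "w \<in> W" for w
  proof -
    obtain c where c: "\<forall>i<n. c i \<in> carrier K" "w = \<zero>\<^bsub>V\<^esub> \<oplus>\<^bsub>V\<^esub> A.comb n c b"
      using b \<open>w \<in> W\<close> unfolding A.rel_basis_def by blast
    then have "f w = B.comb n c (\<lambda>i. f (b i))" using cW[OF c(1)] Wc fc[OF c(1)] by simp
    then show ?thesis using c(1) f_closed[OF \<open>w \<in> W\<close>] by (intro exI[of _ c]) auto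
  qed
  moreover have "c i = \<zero>\<^bsub>K\<^esub>"
    if c: "\<forall>i<n. c i \<in> carrier K" "B.comb n c (\<lambda>i. f (b i)) = \<zero>\<^bsub>V'\<^esub>" and "i < n" for c i
  proof -
    have "f (A.comb n c b) = f \<zero>\<^bsub>V\<^esub>" using c fc f_zero by simp
    then have "A.comb n c b = \<zero>\<^bsub>V\<^esub>"
      using assms(1) cW[OF c(1)] A.submodule_zero_mem[OF W] by (auto dest: inj_onD)
    then show ?thesis using c \<open>i < n\<close> by (intro A.rel_basis_independent[OF b, of c]) auto
  qed
  ultimately have "B.rel_basis {\<zero>\<^bsub>V'\<^esub>} (f ` W) n (\<lambda>i. f (b i))"
    unfolding B.rel_basis_def using bW by auto
  then show ?thesis by (auto simp: B.has_dim_def)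
qed

lemma graded_homD:
  assumes "\<phi> \<in> graded_hom R M N"
  shows "x \<in> carrier M \<Longrightarrow> \<phi> x \<in> carrier N"
    and "\<lbrakk>x \<in> carrier M; y \<in> carrier M\<rbrakk> \<Longrightarrow> \<phi> (x \<oplus>\<^bsub>M\<^esub> y) = \<phi> x \<oplus>\<^bsub>N\<^esub> \<phi> y"
    and "\<lbrakk>a \<in> carrier R; x \<in> carrier M\<rbrakk> \<Longrightarrow> \<phi> (a \<odot>\<^bsub>M\<^esub> x) = a \<odot>\<^bsub>N\<^esub> \<phi> x"
    and "x \<in> component M g \<Longrightarrow> \<phi> x \<in> component N g"
    and "\<phi> \<in> module_hom R M N"
  using assms by (auto simp: graded_hom_def module_hom_def image_subset_iff)

lemma graded_hom_comp:
  "\<lbrakk>\<phi> \<in> graded_hom R L M; \<psi> \<in> graded_hom R M N\<rbrakk> \<Longrightarrow> (\<lambda>x. \<psi> (\<phi> x)) \<in> graded_hom R L N"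
  by (auto simp: graded_hom_def module_hom_def Pi_iff image_subset_iff)

lemma graded_isomorphic_trans:
  assumes "graded_isomorphic R L M" "graded_isomorphic R M N"
  shows "graded_isomorphic R L N"
proof -
  obtain \<phi> \<psi> where "\<phi> \<in> graded_hom R L M" "bij_betw \<phi> (carrier L) (carrier M)"
    "\<psi> \<in> graded_hom R M N" "bij_betw \<psi> (carrier M) (carrier N)"
    using assms by (auto simp: graded_isomorphic_def)
  then show ?thesis unfolding graded_isomorphic_def
    using bij_betw_trans[of \<phi> "carrier L" "carrier M" \<psi> "carrier N"] graded_hom_comp[of \<phi> R L M \<psi> N]
    by (auto simp: comp_def)
qed

context pdcf_algebra begin

abbreviation grmod :: "('r, 'm, 'g) graded_module \<Rightarrow> bool"
  where "grmod M \<equiv> graded_module_over K R M"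

lemma grmod_iff: "grmod M \<longleftrightarrow> is_graded_module K R M"
  using pdcf_algebra_axioms
  by (auto simp: graded_module_over_def graded_module_over_axioms_def)

lemma hp_graded_hom:
  assumes "grmod M" "grmod N" "\<phi> \<in> graded_hom R M N" "m \<in> carrier M"
  shows "hp N (\<phi> m) g = \<phi> (hp M m g)"
proof -
  interpret M: graded_module_over K R M by fact
  interpret N: graded_module_over K R N by fact
  note h = graded_homD[OF assms(3)]
  let ?G = "{g. hp M m g \<noteq> \<zero>\<^bsub>M\<^esub>}"
  have "\<phi> m = \<phi> (\<Oplus>\<^bsub>M\<^esub>g\<in>?G. hp M m g)" using M.hp_sum[OF assms(4)] by simp
  also have "\<dots> = (\<Oplus>\<^bsub>N\<^esub>g\<in>?G. \<phi> (hp M m g))"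
    using assms M.hp_finite by (intro module_hom_finsum[OF M.module_M N.module_M h(5)]) auto
  finally have "hp N (\<phi> m) = (\<lambda>g. \<phi> (hp M m g))"
    using assms(4) M.hp_finite M.hp_component h(4) module_hom_zero[OF M.module_M N.module_M h(5)]
    by (intro N.hp_unique[of _ ?G]) auto
  then show ?thesis by simp
qed

text \<open>Compatibility with the action is only asked for homogeneous scalars on homogeneous
  elements, the form available for maps that depend on the degree. It extends over the homogeneous
  parts of \<open>m\<close>, and after that over those of \<open>a\<close>.\<close>

lemma graded_homI:
  assumes "grmod M" "grmod N" and closed: "\<And>x. x \<in> carrier M \<Longrightarrow> f x \<in> carrier N"
    and add: "\<And>x y. x \<in> carrier M \<Longrightarrow> y \<in> carrier M \<Longrightarrow> f (x \<oplus>\<^bsub>M\<^esub> y) = f x \<oplus>\<^bsub>N\<^esub> f y"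
    and comp: "\<And>g x. x \<in> component M g \<Longrightarrow> f x \<in> component N g"
    and smult: "\<And>q h a x. a \<in> component R q \<Longrightarrow> x \<in> component M h \<Longrightarrow> f (a \<odot>\<^bsub>M\<^esub> x) = a \<odot>\<^bsub>N\<^esub> f x"
  shows "f \<in> graded_hom R M N"
proof -
  interpret M: graded_module_over K R M by fact
  interpret N: graded_module_over K R N by fact
  have z: "f \<zero>\<^bsub>M\<^esub> = \<zero>\<^bsub>N\<^esub>" using add[of "\<zero>\<^bsub>M\<^esub>" "\<zero>\<^bsub>M\<^esub>"] closed[of "\<zero>\<^bsub>M\<^esub>"] by (simp add: N.M.add.r_cancel_one')
  have fs: "f (\<Oplus>\<^bsub>M\<^esub>i\<in>I. x i) = (\<Oplus>\<^bsub>N\<^esub>i\<in>I. f (x i))" if "finite I" "\<And>i. i \<in> I \<Longrightarrow> x i \<in> carrier M"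
    for I :: "'g set" and x
    using that
  proof induction
    case (insert a I)
    then have "(\<Oplus>\<^bsub>M\<^esub>i\<in>I. x i) \<in> carrier M" by (auto intro!: M.M.finsum_closed)
    moreover have "(\<Oplus>\<^bsub>M\<^esub>i\<in>insert a I. x i) = x a \<oplus>\<^bsub>M\<^esub> (\<Oplus>\<^bsub>M\<^esub>i\<in>I. x i)"
      "(\<Oplus>\<^bsub>N\<^esub>i\<in>insert a I. f (x i)) = f (x a) \<oplus>\<^bsub>N\<^esub> (\<Oplus>\<^bsub>N\<^esub>i\<in>I. f (x i))"
      using insert closed by (auto intro!: M.M.finsum_insert N.M.finsum_insert)
    ultimately show ?case using insert by (simp add: add)
  qed (simp add: z)
  have hom: "f (a \<odot>\<^bsub>M\<^esub> m) = a \<odot>\<^bsub>N\<^esub> f m" if a: "a \<in> component R q" and m: "m \<in> carrier M" for a q m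
  proof -
    have ac: "a \<in> carrier R" using a by (rule R_component_closed)
    let ?G = "{g. hp M m g \<noteq> \<zero>\<^bsub>M\<^esub>}"
    have "a \<odot>\<^bsub>M\<^esub> m = a \<odot>\<^bsub>M\<^esub> (\<Oplus>\<^bsub>M\<^esub>g\<in>?G. hp M m g)" using M.hp_sum[OF m] by simp
    also have "\<dots> = (\<Oplus>\<^bsub>M\<^esub>g\<in>?G. a \<odot>\<^bsub>M\<^esub> hp M m g)"
      using m ac M.hp_finite by (intro M.M.finsum_smult_ldistr) auto
    finally have "f (a \<odot>\<^bsub>M\<^esub> m) = (\<Oplus>\<^bsub>N\<^esub>g\<in>?G. f (a \<odot>\<^bsub>M\<^esub> hp M m g))"
      using m ac M.hp_finite by (simp add: fs)
    also have "\<dots> = (\<Oplus>\<^bsub>N\<^esub>g\<in>?G. a \<odot>\<^bsub>N\<^esub> f (hp M m g))"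
      using m ac closed smult[OF a M.hp_component[OF m]] by (intro N.M.finsum_cong') auto
    also have "\<dots> = a \<odot>\<^bsub>N\<^esub> (\<Oplus>\<^bsub>N\<^esub>g\<in>?G. f (hp M m g))"
      using m ac closed M.hp_finite by (intro N.M.finsum_smult_ldistr[symmetric]) auto
    also have "(\<Oplus>\<^bsub>N\<^esub>g\<in>?G. f (hp M m g)) = f m"
      using fs[OF M.hp_finite[OF m], of "hp M m"] m M.hp_sum[OF m] by simp
    finally show ?thesis .
  qed
  have "f (a \<odot>\<^bsub>M\<^esub> m) = a \<odot>\<^bsub>N\<^esub> f m" if a: "a \<in> carrier R" and m: "m \<in> carrier M" for a m
  proof -
    let ?h = "hp (self_module R) a" and ?G = "{q. hp (self_module R) a q \<noteq> \<zero>\<^bsub>R\<^esub>}"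
    have hc: "?h q \<in> carrier R" "?h q \<in> component R q" "finite ?G" for q
      using S.hp_closed[of a] S.hp_component[of a] S.hp_finite[of a] a by auto
    have expand: "a \<odot>\<^bsub>L\<^esub> x = (\<Oplus>\<^bsub>L\<^esub>q\<in>?G. ?h q \<odot>\<^bsub>L\<^esub> x)" if "module R L" "x \<in> carrier L" for L :: "('r, 'z, 'g) graded_module" and x
    proof -
      interpret L: module R L by fact
      have "(\<lambda>r. r \<odot>\<^bsub>L\<^esub> x) \<in> module_hom R (self_module R) L"
        using that by (auto simp: module_hom_def L.smult_l_distr L.smult_assoc1)
      from module_hom_finsum[OF S.module_M that(1) this hc(3), of ?h]
      show ?thesis using hc S.hp_sum[of a] a by auto
    qed
    have "f (a \<odot>\<^bsub>M\<^esub> m) = (\<Oplus>\<^bsub>N\<^esub>q\<in>?G. f (?h q \<odot>\<^bsub>M\<^esub> m))"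
      unfolding expand[OF M.module_M m] using hc m by (intro fs) auto
    also have "\<dots> = (\<Oplus>\<^bsub>N\<^esub>q\<in>?G. ?h q \<odot>\<^bsub>N\<^esub> f m)"
      using hc m closed hom[OF hc(2) m] by (intro N.M.finsum_cong') auto
    also have "\<dots> = a \<odot>\<^bsub>N\<^esub> f m" using expand[OF N.module_M] closed m by simp
    finally show ?thesis .
  qed
  then show ?thesis using closed add comp by (auto simp: graded_hom_def module_hom_def)
qed

text \<open>The maps on the components may be unrelated except through multiplication by homogeneous
  scalars, and still glue to one graded homomorphism. This yields the projection to a place
  depending on the degree, isomorphisms of trivialised modules, and the graded version of a
  section.\<close>

lemma glue_degreewise:
  assumes "grmod M" "grmod N" and \<phi>: "\<And>g x. x \<in> component M g \<Longrightarrow> \<phi> g x \<in> component N g"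
    and add: "\<And>g x y. x \<in> component M g \<Longrightarrow> y \<in> component M g \<Longrightarrow> \<phi> g (x \<oplus>\<^bsub>M\<^esub> y) = \<phi> g x \<oplus>\<^bsub>N\<^esub> \<phi> g y"
    and smult: "\<And>q h a x. a \<in> component R q \<Longrightarrow> x \<in> component M h \<Longrightarrow> \<phi> (q + h) (a \<odot>\<^bsub>M\<^esub> x) = a \<odot>\<^bsub>N\<^esub> \<phi> h x"
  obtains f where "f \<in> graded_hom R M N" "\<And>g x. x \<in> component M g \<Longrightarrow> f x = \<phi> g x"
    "\<And>g x. x \<in> carrier M \<Longrightarrow> hp N (f x) g = \<phi> g (hp M x g)"
proof -
  interpret M: graded_module_over K R M by fact
  interpret N: graded_module_over K R N by fact
  have z: "\<phi> g \<zero>\<^bsub>M\<^esub> = \<zero>\<^bsub>N\<^esub>" for g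
    using add[of "\<zero>\<^bsub>M\<^esub>" g "\<zero>\<^bsub>M\<^esub>"] N.component_closed[OF \<phi>[of "\<zero>\<^bsub>M\<^esub>" g]] by (simp add: N.M.add.r_cancel_one')
  define f where "f x = (\<Oplus>\<^bsub>N\<^esub>g\<in>{g. hp M x g \<noteq> \<zero>\<^bsub>M\<^esub>}. \<phi> g (hp M x g))" for x
  have pc: "\<phi> g (hp M x g) \<in> component N g" "\<phi> g (hp M x g) \<in> carrier N" if "x \<in> carrier M" for x g
    using \<phi>[OF M.hp_component[OF that]] N.component_closed by auto
  have fc: "f x \<in> carrier N" if "x \<in> carrier M" for x
    unfolding f_def using pc that by (intro N.M.finsum_closed) auto
  have hpf: "hp N (f x) = (\<lambda>g. \<phi> g (hp M x g))" if "x \<in> carrier M" for x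
    using pc that M.hp_finite z unfolding f_def by (intro N.hp_unique[of _ "{g. hp M x g \<noteq> \<zero>\<^bsub>M\<^esub>}"]) auto
  have f\<phi>: "f x = \<phi> g x" if x: "x \<in> component M g" for g x
  proof (rule N.hp_eqI)
    note xc = M.component_closed[OF x]
    show "f x \<in> carrier N" using xc fc by blast
    show "\<phi> g x \<in> carrier N" using \<phi>[OF x] N.component_closed by blast
    show "hp N (f x) h = hp N (\<phi> g x) h" for h
      using hpf[OF xc] M.hp_homogeneous[OF x] N.hp_homogeneous[OF \<phi>[OF x]] z by simp
  qed
  have "f \<in> graded_hom R M N"
  proof (rule graded_homI[OF assms(1,2) fc])
    show "f (x \<oplus>\<^bsub>M\<^esub> y) = f x \<oplus>\<^bsub>N\<^esub> f y" if xy: "x \<in> carrier M" "y \<in> carrier M" for x y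
    proof (rule N.hp_eqI)
      have s: "x \<oplus>\<^bsub>M\<^esub> y \<in> carrier M" using xy by simp
      show "f (x \<oplus>\<^bsub>M\<^esub> y) \<in> carrier N" using fc[OF s] .
      show "f x \<oplus>\<^bsub>N\<^esub> f y \<in> carrier N" using fc xy by simp
      show "hp N (f (x \<oplus>\<^bsub>M\<^esub> y)) g = hp N (f x \<oplus>\<^bsub>N\<^esub> f y) g" for g
        using hpf[OF s] hpf[OF xy(1)] hpf[OF xy(2)] xy fc M.hp_component
        by (simp add: M.hp_add N.hp_add add)
    qed
    show "f x \<in> component N g" if "x \<in> component M g" for x g using f\<phi>[OF that] \<phi>[OF that] by simp
    show "f (a \<odot>\<^bsub>M\<^esub> x) = a \<odot>\<^bsub>N\<^esub> f x" if "a \<in> component R q" "x \<in> component M h" for a q x h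
      using f\<phi>[OF M.component_smult[OF that]] f\<phi>[OF that(2)] smult[OF that] by simp
  qed
  with f\<phi> hpf show thesis by (intro that[of f]) auto
qed

text \<open>Sum preimages of the homogeneous parts over the degrees where \<open>n\<close> is
  nonzero. It is stated for a single element so that it also reaches the elements of a kernel in
  \<open>short_exact_degreewise\<close>, where \<open>\<phi>\<close> need not be onto.\<close>

lemma graded_hom_image:
  assumes "grmod M" "grmod N" "\<phi> \<in> graded_hom R M N"
    and "n \<in> carrier N" "\<And>g. hp N n g \<in> \<phi> ` component M g"
  shows "n \<in> \<phi> ` carrier M"
proof -
  interpret M: graded_module_over K R M by fact
  interpret N: graded_module_over K R N by fact
  note h = graded_homD[OF assms(3)]
  have "\<forall>g. \<exists>m. m \<in> component M g \<and> hp N n g = \<phi> m" using assms(5) by blast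
  then obtain m where m: "\<And>g. m g \<in> component M g" "\<And>g. hp N n g = \<phi> (m g)" by metis
  note mc = M.component_closed[OF m(1)]
  let ?G = "{g. hp N n g \<noteq> \<zero>\<^bsub>N\<^esub>}"
  have "\<phi> (\<Oplus>\<^bsub>M\<^esub>g\<in>?G. m g) = (\<Oplus>\<^bsub>N\<^esub>g\<in>?G. \<phi> (m g))"
    using mc N.hp_finite[OF assms(4)] by (intro module_hom_finsum[OF M.module_M N.module_M h(5)]) auto
  also have "\<dots> = (\<Oplus>\<^bsub>N\<^esub>g\<in>?G. hp N n g)" using m(2) by simp
  also have "\<dots> = n" by (rule N.hp_sum[OF assms(4)])
  finally have "n = \<phi> (\<Oplus>\<^bsub>M\<^esub>g\<in>?G. m g)" by simp
  moreover have "(\<Oplus>\<^bsub>M\<^esub>g\<in>?G. m g) \<in> carrier M" using mc by (intro M.M.finsum_closed) auto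
  ultimately show ?thesis by (rule image_eqI)
qed

lemma graded_hom_surj:
  assumes "grmod M" "grmod N" "\<phi> \<in> graded_hom R M N" "\<And>g. component N g \<subseteq> \<phi> ` component M g"
  shows "\<phi> ` carrier M = carrier N"
proof -
  interpret N: graded_module_over K R N by fact
  show ?thesis using graded_hom_image[OF assms(1-3)] assms(4) N.hp_component graded_homD(1)[OF assms(3)] by blast
qed

lemma graded_hom_inj:
  assumes "grmod M" "grmod N" "\<phi> \<in> graded_hom R M N" "\<And>g. inj_on \<phi> (component M g)"
  shows "inj_on \<phi> (carrier M)"
proof (rule inj_onI)
  interpret M: graded_module_over K R M by fact
  fix x y assume xy: "x \<in> carrier M" "y \<in> carrier M" "\<phi> x = \<phi> y"
  show "x = y"
  proof (rule M.hp_eqI[OF xy(1,2)])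
    fix g
    have "\<phi> (hp M x g) = \<phi> (hp M y g)" using hp_graded_hom[OF assms(1-3)] xy by metis
    then show "hp M x g = hp M y g" using inj_onD[OF assms(4)] M.hp_component xy by blast
  qed
qed

lemma graded_isomorphicI:
  assumes "grmod M" "grmod N" "\<phi> \<in> graded_hom R M N" "\<And>g. bij_betw \<phi> (component M g) (component N g)"
  shows "graded_isomorphic R M N"
  unfolding graded_isomorphic_def bij_betw_def
  using graded_hom_inj[OF assms(1-3)] graded_hom_surj[OF assms(1-3)] assms(3,4)
  by (intro bexI[of _ \<phi>]) (auto simp: bij_betw_def)

lemma graded_iso_component:
  assumes "grmod M" "grmod N" "\<phi> \<in> graded_hom R M N" "bij_betw \<phi> (carrier M) (carrier N)"
  shows "bij_betw \<phi> (component M g) (component N g)"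
proof -
  interpret M: graded_module_over K R M by fact
  interpret N: graded_module_over K R N by fact
  have inj: "inj_on \<phi> (carrier M)" using assms(4) by (simp add: bij_betw_def)
  have "n \<in> \<phi> ` component M g" if n: "n \<in> component N g" for n
  proof -
    obtain m where m: "m \<in> carrier M" "n = \<phi> m"
      using assms(4) N.component_closed[OF n] by (auto simp: bij_betw_def)
    have "\<phi> (hp M m g) = n"
      using hp_graded_hom[OF assms(1-3) m(1), of g] N.hp_homogeneous[OF n] m(2) by simp
    then show ?thesis using M.hp_component[OF m(1)] by blast
  qed
  moreover have "inj_on \<phi> (component M g)"
    by (rule inj_on_subset[OF inj]) (use M.component_closed in blast)
  ultimately show ?thesis using graded_homD(4)[OF assms(3)] by (auto simp: bij_betw_def)
qed

lemma graded_hom_inv_into: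
  assumes "grmod M" "grmod N" and \<phi>: "\<phi> \<in> graded_hom R M N" "bij_betw \<phi> (carrier M) (carrier N)"
  shows "inv_into (carrier M) \<phi> \<in> graded_hom R N M"
proof -
  interpret M: graded_module_over K R M by fact
  note h = graded_homD[OF \<phi>(1)]
  let ?\<psi> = "inv_into (carrier M) \<phi>"
  have \<psi>: "?\<psi> n \<in> carrier M" "\<phi> (?\<psi> n) = n" if "n \<in> carrier N" for n
    using \<phi>(2) that by (auto simp: bij_betw_def inv_into_into f_inv_into_f)
  have \<psi>\<phi>: "?\<psi> (\<phi> m) = m" if "m \<in> carrier M" for m using \<phi>(2) that by (auto simp: bij_betw_def)
  have "?\<psi> (x \<oplus>\<^bsub>N\<^esub> y) = ?\<psi> x \<oplus>\<^bsub>M\<^esub> ?\<psi> y" if "x \<in> carrier N" "y \<in> carrier N" for x y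
    using \<psi>[OF that(1)] \<psi>[OF that(2)] \<psi>\<phi>[of "?\<psi> x \<oplus>\<^bsub>M\<^esub> ?\<psi> y"] h(2) by simp
  moreover have "?\<psi> (a \<odot>\<^bsub>N\<^esub> x) = a \<odot>\<^bsub>M\<^esub> ?\<psi> x" if "a \<in> carrier R" "x \<in> carrier N" for a x
    using \<psi>[OF that(2)] that \<psi>\<phi>[of "a \<odot>\<^bsub>M\<^esub> ?\<psi> x"] h(3) by simp
  moreover have "?\<psi> n \<in> component M g" if n: "n \<in> component N g" for n g
  proof -
    obtain m where "m \<in> component M g" "n = \<phi> m"
      using graded_iso_component[OF assms(1,2) \<phi>, of g] n by (auto simp: bij_betw_def)
    then show ?thesis using \<psi>\<phi> M.component_closed by auto
  qed
  ultimately show ?thesis using \<psi> by (auto simp: graded_hom_def module_hom_def)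
qed

lemma graded_isomorphic_sym:
  "\<lbrakk>grmod M; grmod N; graded_isomorphic R M N\<rbrakk> \<Longrightarrow> graded_isomorphic R N M"
  using graded_hom_inv_into bij_betw_inv_into unfolding graded_isomorphic_def by blast

text \<open>Graded maps commute with taking homogeneous parts, hence injectivity, the kernel
  condition and surjectivity can be tested one degree at a time. In the telescope the maps are
  explicit on homogeneous tuples only.\<close>

lemma short_exact_degreewise:
  assumes "grmod L" "grmod M" "grmod N" and \<phi>: "\<phi> \<in> graded_hom R L M" and \<psi>: "\<psi> \<in> graded_hom R M N"
    and inj: "\<And>g. inj_on \<phi> (component L g)"
    and exact: "\<And>g. \<phi> ` component L g = {m \<in> component M g. \<psi> m = \<zero>\<^bsub>N\<^esub>}"
    and surj: "\<And>g. component N g \<subseteq> \<psi> ` component M g"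
  shows "short_exact R L \<phi> M \<psi> N"
proof -
  interpret L: graded_module_over K R L by fact
  interpret M: graded_module_over K R M by fact
  interpret N: graded_module_over K R N by fact
  have "\<psi> (\<phi> l) = \<zero>\<^bsub>N\<^esub>" if l: "l \<in> carrier L" for l
  proof (rule N.hp_eqI)
    show "\<psi> (\<phi> l) \<in> carrier N" using l graded_homD(1)[OF \<phi>] graded_homD(1)[OF \<psi>] by blast
    show "hp N (\<psi> (\<phi> l)) g = hp N \<zero>\<^bsub>N\<^esub> g" for g
    proof -
      have "hp N (\<psi> (\<phi> l)) g = \<psi> (\<phi> (hp L l g))"
        using hp_graded_hom[OF assms(2,3) \<psi>, of "\<phi> l"] hp_graded_hom[OF assms(1,2) \<phi> l] graded_homD(1)[OF \<phi> l] by simp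
      also have "\<dots> = \<zero>\<^bsub>N\<^esub>" using exact[of g] L.hp_component[OF l, of g] by blast
      finally show ?thesis by simp
    qed
  qed simp
  moreover have "m \<in> \<phi> ` carrier L" if m: "m \<in> carrier M" "\<psi> m = \<zero>\<^bsub>N\<^esub>" for m
  proof (rule graded_hom_image[OF assms(1,2) \<phi> m(1)])
    fix g
    have "\<psi> (hp M m g) = \<zero>\<^bsub>N\<^esub>" using hp_graded_hom[OF assms(2,3) \<psi> m(1), of g] m(2) by simp
    then show "hp M m g \<in> \<phi> ` component L g" using exact M.hp_component[OF m(1)] by blast
  qed
  ultimately show ?thesis unfolding short_exact_def
    using \<phi> \<psi> graded_hom_inj[OF assms(1,2) \<phi> inj] graded_hom_surj[OF assms(2,3) \<psi> surj] graded_homD(1)[OF \<phi>] by auto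
qed

section \<open>Hilbert functions and their additivity\<close>

definition hilbert :: "('r, 'm, 'g) graded_module \<Rightarrow> 'g \<Rightarrow> nat"
  where "hilbert M g = kspace.vdim K (restrict_scalars R M) (component M g)"

lemma kspace_map_graded:
  assumes "grmod M" "grmod N" "\<phi> \<in> graded_hom R M N"
  shows "kspace_map K (restrict_scalars R M) (restrict_scalars R N) (component M g) \<phi>"
proof -
  interpret M: graded_module_over K R M by fact
  interpret N: graded_module_over K R N by fact
  note h = graded_homD[OF assms(3)]
  show ?thesis
    by (intro kspace_map.intro kspace_map_axioms.intro M.V.kspace_axioms N.V.kspace_axioms M.component_submodule)
      (use M.component_closed h in auto)
qed

lemma component_has_dim:
  assumes "grmod M" "finite_dimensional K (restrict_scalars R M) (component M g)"
  shows "kspace.has_dim K (restrict_scalars R M) (component M g) (hilbert M g)"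
proof -
  interpret M: graded_module_over K R M by fact
  show ?thesis unfolding hilbert_def
    by (rule finite_dimensional_has_dim[OF M.V.kspace_axioms assms(2) M.component_submodule])
qed

lemma hilbert_eq:
  assumes "grmod M" "kspace.has_dim K (restrict_scalars R M) (component M g) n"
  shows "hilbert M g = n"
proof -
  interpret M: graded_module_over K R M by fact
  show ?thesis unfolding hilbert_def
    by (rule M.V.vdim_eq[OF _ assms(2)]) (use M.component_closed in auto)
qed

text \<open>Stated with \<open>has_dim\<close>, it also delivers finiteness of the middle component,
  which is how direct sums are seen to be BDF; \<open>hilbert_exact\<close> extracts the
  number.\<close>

lemma component_exact_has_dim:
  assumes "grmod L" "grmod M" "grmod N" "short_exact R L \<phi> M \<psi> N"
    and "finite_dimensional K (restrict_scalars R L) (component L g)"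
    and "finite_dimensional K (restrict_scalars R N) (component N g)"
  shows "kspace.has_dim K (restrict_scalars R M) (component M g) (hilbert L g + hilbert N g)"
proof -
  interpret L: graded_module_over K R L by fact
  interpret M: graded_module_over K R M by fact
  interpret N: graded_module_over K R N by fact
  have \<phi>: "\<phi> \<in> graded_hom R L M" and \<psi>: "\<psi> \<in> graded_hom R M N" and inj: "inj_on \<phi> (carrier L)"
    and ex: "\<phi> ` carrier L = {m\<in>carrier M. \<psi> m = \<zero>\<^bsub>N\<^esub>}" and surj: "\<psi> ` carrier M = carrier N"
    using assms(4) by (auto simp: short_exact_def)
  interpret f: kspace_map K "restrict_scalars R L" "restrict_scalars R M" "component L g" \<phi>
    by (rule kspace_map_graded[OF assms(1,2) \<phi>])
  interpret p: kspace_map K "restrict_scalars R M" "restrict_scalars R N" "component M g" \<psi>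
    by (rule kspace_map_graded[OF assms(2,3) \<psi>])
  have sub: "component L g \<subseteq> carrier L" using L.component_closed by blast
  have "m \<in> \<phi> ` component L g" if m: "m \<in> component M g" "\<psi> m = \<zero>\<^bsub>N\<^esub>" for m
  proof -
    obtain l where l: "l \<in> carrier L" "m = \<phi> l" using ex m M.component_closed by blast
    then have "\<phi> (hp L l g) = m"
      using hp_graded_hom[OF assms(1,2) \<phi> l(1), of g] M.hp_homogeneous[OF m(1)] by simp
    then show ?thesis using L.hp_component[OF l(1)] by blast
  qed
  then have ker: "{m \<in> component M g. \<psi> m = \<zero>\<^bsub>N\<^esub>} = \<phi> ` component L g"
    using ex sub graded_homD(4)[OF \<phi>] by auto
  have "n \<in> \<psi> ` component M g" if n: "n \<in> component N g" for n
  proof -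
    obtain m where m: "m \<in> carrier M" "n = \<psi> m" using surj N.component_closed[OF n] by blast
    then have "\<psi> (hp M m g) = n"
      using hp_graded_hom[OF assms(2,3) \<psi> m(1), of g] N.hp_homogeneous[OF n] by simp
    then show ?thesis using M.hp_component[OF m(1)] by blast
  qed
  then have im: "\<psi> ` component M g = component N g" using graded_homD(4)[OF \<psi>] by auto
  show ?thesis
  proof (rule p.has_dim_exact)
    show "M.V.has_dim {w \<in> component M g. \<psi> w = \<zero>\<^bsub>restrict_scalars R N\<^esub>} (hilbert L g)"
      using f.has_dim_image[OF inj_on_subset[OF inj sub] component_has_dim[OF assms(1,5)]] ker by simp
    show "N.V.has_dim (\<psi> ` component M g) (hilbert N g)"
      unfolding im by (rule component_has_dim[OF assms(3,6)])
  qed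
qed

lemma hilbert_exact:
  assumes "grmod L" "grmod M" "grmod N" "short_exact R L \<phi> M \<psi> N"
    and "finite_dimensional K (restrict_scalars R L) (component L g)"
    and "finite_dimensional K (restrict_scalars R N) (component N g)"
  shows "hilbert M g = hilbert L g + hilbert N g"
  by (rule hilbert_eq[OF assms(2) component_exact_has_dim[OF assms]])

lemma hilbert_iso:
  assumes "grmod M" "grmod N" "graded_isomorphic R M N"
    and "finite_dimensional K (restrict_scalars R M) (component M g)"
  shows "hilbert N g = hilbert M g"
proof -
  interpret N: graded_module_over K R N by fact
  obtain \<phi> where \<phi>: "\<phi> \<in> graded_hom R M N" "bij_betw \<phi> (carrier M) (carrier N)"
    using assms(3) by (auto simp: graded_isomorphic_def)
  interpret f: kspace_map K "restrict_scalars R M" "restrict_scalars R N" "component M g" \<phi>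
    by (rule kspace_map_graded[OF assms(1,2) \<phi>(1)])
  have b: "bij_betw \<phi> (component M g) (component N g)" by (rule graded_iso_component[OF assms(1,2) \<phi>])
  then have "N.V.has_dim (component N g) (hilbert M g)"
    using f.has_dim_image[OF _ component_has_dim[OF assms(1,4)]] by (auto simp: bij_betw_def)
  then show ?thesis by (rule hilbert_eq[OF assms(2)])
qed

section \<open>The degree order and BDF modules\<close>

lemma component_R_trivial: "q \<notin> support R \<Longrightarrow> a \<in> component R q \<Longrightarrow> a = \<zero>\<^bsub>R\<^esub>"
  by (auto simp: support_def)

lemma support_zero: "0 \<in> support R"
  using one_component R.one_not_zero by (auto simp: support_def)

text \<open>Here \<open>R\<close> being a domain enters: the product of two nonzero homogeneous
  elements is again nonzero and witnesses the sum of the degrees.\<close>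

lemma support_add:
  assumes "p \<in> support R" "q \<in> support R"
  shows "p + q \<in> support R"
proof -
  obtain a b where "a \<in> component R p" "a \<noteq> \<zero>\<^bsub>R\<^esub>" "b \<in> component R q" "b \<noteq> \<zero>\<^bsub>R\<^esub>"
    using assms R_component_zero unfolding support_def by blast
  moreover from this have "a \<otimes>\<^bsub>R\<^esub> b \<noteq> \<zero>\<^bsub>R\<^esub>" using R.integral R_component_closed by blast
  ultimately show ?thesis using R_component_mult unfolding support_def by blast
qed

lemma support_pointed: "\<lbrakk>p \<in> support R; - p \<in> support R\<rbrakk> \<Longrightarrow> p = 0"
  using pdcf unfolding pdcf_def pointed_def by (metis add.right_inverse)

lemma supp_le_refl [simp]: "supp_le R g g"
  using support_zero by (simp add: supp_le_def)

lemma supp_le_trans: "\<lbrakk>supp_le R f g; supp_le R g h\<rbrakk> \<Longrightarrow> supp_le R f h"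
  using support_add[of "g - f" "h - g"] by (simp add: supp_le_def)

lemma supp_le_antisym: "\<lbrakk>supp_le R g h; supp_le R h g\<rbrakk> \<Longrightarrow> g = h"
  using support_pointed[of "h - g"] by (simp add: supp_le_def)

text \<open>The up-set generated by \<open>P\<close>. A support is finitely bounded below iff it
  lies in \<open>upper P\<close> for a finite \<open>P\<close>, and the recursions over degrees run
  inside this set.\<close>

definition upper :: "'g set \<Rightarrow> 'g set"
  where "upper P = {u. \<exists>p\<in>P. supp_le R p u}"

lemma upper_supp_le: "\<lbrakk>u \<in> upper P; supp_le R u v\<rbrakk> \<Longrightarrow> v \<in> upper P"
  using supp_le_trans by (auto simp: upper_def)

lemma upper_mono: "P \<subseteq> P' \<Longrightarrow> upper P \<subseteq> upper P'"
  by (auto simp: upper_def)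

text \<open>An element \<open>u\<close> between some \<open>p\<close> in \<open>P\<close> and
  \<open>g\<close> corresponds to \<open>u - p\<close>, an element of \<open>support R\<close> below
  \<open>g - p\<close>. There are finitely many of these for each of the finitely many
  \<open>p\<close>.\<close>

lemma upper_downward_finite:
  assumes "finite P"
  shows "finite {u \<in> upper P. supp_le R u g}"
proof (rule finite_subset)
  show "{u \<in> upper P. supp_le R u g} \<subseteq> (\<Union>p\<in>P. (+) p ` {q \<in> support R. supp_le R q (g - p)})"
  proof safe
    fix u assume "u \<in> upper P" and u: "supp_le R u g"
    then obtain p where p: "p \<in> P" "u - p \<in> support R" by (auto simp: upper_def supp_le_def)
    have "supp_le R (u - p) (g - p)" using u by (simp add: supp_le_def)
    moreover have "u = p + (u - p)" by simp
    ultimately show "u \<in> (\<Union>p\<in>P. (+) p ` {q \<in> support R. supp_le R q (g - p)})"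
      using p by blast
  qed
  show "finite (\<Union>p\<in>P. (+) p ` {q \<in> support R. supp_le R q (g - p)})"
    using assms pdcf by (auto simp: pdcf_def downward_finite_def)
qed

text \<open>Given a finite bound, downward finiteness of the support is recovered from
  \<open>upper_downward_finite\<close>.\<close>

lemma bdf_iff:
  "bdf_module K R M \<longleftrightarrow> grmod M \<and> (\<exists>P. finite P \<and> support M \<subseteq> upper P) \<and>
    (\<forall>g. finite_dimensional K (restrict_scalars R M) (component M g))"
proof -
  have "downward_finite R (support M)" if "finite P" "support M \<subseteq> upper P" for P
    unfolding downward_finite_def
  proof
    fix g show "finite {u \<in> support M. supp_le R u g}"
      by (rule finite_subset[OF _ upper_downward_finite[OF that(1), of g]]) (use that(2) in auto)
  qed
  then show ?thesis unfolding bdf_module_def grmod_iff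
    by (auto simp: finitely_bounded_below_def upper_def subset_iff)
qed

lemma bdf_grmod: "bdf_module K R M \<Longrightarrow> grmod M"
  and bdf_fd: "bdf_module K R M \<Longrightarrow> finite_dimensional K (restrict_scalars R M) (component M g)"
  by (auto simp: bdf_iff)

lemma hilbert_zero_iff:
  assumes "bdf_module K R M"
  shows "hilbert M g = 0 \<longleftrightarrow> g \<notin> support M"
proof -
  interpret M: graded_module_over K R M by (rule bdf_grmod[OF assms])
  note d = component_has_dim[OF bdf_grmod[OF assms] bdf_fd[OF assms], of g]
  show ?thesis
  proof
    assume "hilbert M g = 0"
    with d have "component M g \<subseteq> {\<zero>\<^bsub>M\<^esub>}" using M.V.has_dim_zero_iff by simp
    then show "g \<notin> support M" using M.component_zero by (auto simp: support_def)
  next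
    assume "g \<notin> support M"
    then have "M.V.has_dim (component M g) 0" using M.V.has_dim_zero_iff by (simp add: support_def)
    then show "hilbert M g = 0" by (rule hilbert_eq[OF bdf_grmod[OF assms]])
  qed
qed

end

section \<open>Modules of tuples\<close>

text \<open>
  The tuple \<open>t\<close> has degree \<open>g\<close> if every \<open>t i\<close> has degree \<open>g - d i\<close>, and \<open>L g\<close> is the set of places that may
  be occupied in degree \<open>g\<close>.
\<close>

definition tuples ::
    "('r, 'm, 'g::ab_group_add) graded_module \<Rightarrow> ('i \<Rightarrow> 'g) \<Rightarrow> ('g \<Rightarrow> 'i set) \<Rightarrow> ('r, 'i \<Rightarrow> 'm, 'g) graded_module"
  where "tuples M d L = (let C = {t. finite {i. t i \<noteq> \<zero>\<^bsub>M\<^esub>} \<and> (\<forall>i. t i \<in> carrier M) \<and>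
      (\<forall>i g. hp M (t i) g \<noteq> \<zero>\<^bsub>M\<^esub> \<longrightarrow> i \<in> L (g + d i))} in
    \<lparr>carrier = C, mult = undefined, one = undefined, ring.zero = (\<lambda>_. \<zero>\<^bsub>M\<^esub>),
     add = (\<lambda>t u i. t i \<oplus>\<^bsub>M\<^esub> u i), smult = (\<lambda>a t i. a \<odot>\<^bsub>M\<^esub> t i),
     component = (\<lambda>g. {t\<in>C. \<forall>i. t i \<in> component M (g - d i)})\<rparr>)"

lemma tuples_simps [simp]:
  "\<zero>\<^bsub>tuples M d L\<^esub> = (\<lambda>_. \<zero>\<^bsub>M\<^esub>)" "t \<oplus>\<^bsub>tuples M d L\<^esub> u = (\<lambda>i. t i \<oplus>\<^bsub>M\<^esub> u i)"
  "a \<odot>\<^bsub>tuples M d L\<^esub> t = (\<lambda>i. a \<odot>\<^bsub>M\<^esub> t i)"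
  by (simp_all add: tuples_def Let_def)

lemma tuples_carrier:
  "t \<in> carrier (tuples M d L) \<longleftrightarrow> finite {i. t i \<noteq> \<zero>\<^bsub>M\<^esub>} \<and> (\<forall>i. t i \<in> carrier M) \<and>
      (\<forall>i g. hp M (t i) g \<noteq> \<zero>\<^bsub>M\<^esub> \<longrightarrow> i \<in> L (g + d i))"
  by (simp add: tuples_def Let_def)

context graded_module_over begin

text \<open>An entry of degree \<open>g - d i\<close> has no other nonzero homogeneous part, so the
  occupancy condition on the carrier only concerns \<open>L g\<close>.\<close>

lemma tuples_component:
  "t \<in> component (tuples M d L) g \<longleftrightarrow> finite {i. t i \<noteq> \<zero>\<^bsub>M\<^esub>} \<and> (\<forall>i. t i \<in> component M (g - d i)) \<and>
     (\<forall>i. t i \<noteq> \<zero>\<^bsub>M\<^esub> \<longrightarrow> i \<in> L g)"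
proof -
  have "t \<in> component (tuples M d L) g \<longleftrightarrow> t \<in> carrier (tuples M d L) \<and> (\<forall>i. t i \<in> component M (g - d i))"
    by (simp add: tuples_def Let_def)
  also have "\<dots> \<longleftrightarrow> finite {i. t i \<noteq> \<zero>\<^bsub>M\<^esub>} \<and> (\<forall>i. t i \<in> component M (g - d i)) \<and> (\<forall>i. t i \<noteq> \<zero>\<^bsub>M\<^esub> \<longrightarrow> i \<in> L g)"
  proof -
    have "(\<forall>h. hp M (t i) h \<noteq> \<zero>\<^bsub>M\<^esub> \<longrightarrow> i \<in> L (h + d i)) \<longleftrightarrow> (t i \<noteq> \<zero>\<^bsub>M\<^esub> \<longrightarrow> i \<in> L g)"
      if "t i \<in> component M (g - d i)" for i
      using hp_homogeneous[OF that] by auto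
    then show ?thesis using component_closed unfolding tuples_carrier by blast
  qed
  finally show ?thesis .
qed

text \<open>\<open>mono\<close> is what the action requires: multiplication by an element of degree
  \<open>q\<close> takes a tuple of degree \<open>g\<close> to degree \<open>q + g\<close> without
  moving its entries, so their places must still be allowed there. The homogeneous parts are taken
  place by place, shifted by \<open>d i\<close>.\<close>

lemma grmod_tuples:
  fixes d :: "'i \<Rightarrow> 'g"
  assumes mono: "\<And>g q i. i \<in> L g \<Longrightarrow> q \<in> support R \<Longrightarrow> i \<in> L (q + g)"
  shows "grmod (tuples M d L)"
proof -
  let ?T = "tuples M d L"
  have zero: "(\<lambda>_. \<zero>\<^bsub>M\<^esub>) \<in> carrier ?T" by (simp add: tuples_carrier)
  have add: "(\<lambda>i. t i \<oplus>\<^bsub>M\<^esub> u i) \<in> carrier ?T" if t: "t \<in> carrier ?T" and u: "u \<in> carrier ?T" for t u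
  proof -
    have "{i. t i \<oplus>\<^bsub>M\<^esub> u i \<noteq> \<zero>\<^bsub>M\<^esub>} \<subseteq> {i. t i \<noteq> \<zero>\<^bsub>M\<^esub>} \<union> {i. u i \<noteq> \<zero>\<^bsub>M\<^esub>}" using t by (auto simp: tuples_carrier)
    moreover have "finite ({i. t i \<noteq> \<zero>\<^bsub>M\<^esub>} \<union> {i. u i \<noteq> \<zero>\<^bsub>M\<^esub>})" using t u by (simp add: tuples_carrier)
    ultimately have "finite {i. t i \<oplus>\<^bsub>M\<^esub> u i \<noteq> \<zero>\<^bsub>M\<^esub>}" by (rule finite_subset)
    moreover have "i \<in> L (g + d i)" if "hp M (t i \<oplus>\<^bsub>M\<^esub> u i) g \<noteq> \<zero>\<^bsub>M\<^esub>" for i g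
    proof -
      have "hp M (t i) g \<noteq> \<zero>\<^bsub>M\<^esub> \<or> hp M (u i) g \<noteq> \<zero>\<^bsub>M\<^esub>" using that t u by (auto simp: tuples_carrier hp_add)
      then show ?thesis using t u by (auto simp: tuples_carrier)
    qed
    ultimately show ?thesis using t u by (simp add: tuples_carrier)
  qed
  have smult: "(\<lambda>i. a \<odot>\<^bsub>M\<^esub> t i) \<in> carrier ?T" if a: "a \<in> carrier R" and t: "t \<in> carrier ?T" for a t
  proof -
    have tc: "t i \<in> carrier M" for i using t by (simp add: tuples_carrier)
    have "{i. a \<odot>\<^bsub>M\<^esub> t i \<noteq> \<zero>\<^bsub>M\<^esub>} \<subseteq> {i. t i \<noteq> \<zero>\<^bsub>M\<^esub>}" using a by auto
    then have "finite {i. a \<odot>\<^bsub>M\<^esub> t i \<noteq> \<zero>\<^bsub>M\<^esub>}" by (rule finite_subset) (use t in \<open>simp add: tuples_carrier\<close>)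
    moreover have "i \<in> L (g + d i)" if nz: "hp M (a \<odot>\<^bsub>M\<^esub> t i) g \<noteq> \<zero>\<^bsub>M\<^esub>" for i g
    proof -
      \<comment> \<open>A nonzero part of the product comes from some degree \<open>q\<close> of
        \<open>a\<close> and a nonzero part of \<open>t i\<close> in degree \<open>g - q\<close>.
        The latter makes the place \<open>i\<close> allowed in degree \<open>g - q + d i\<close>,
        and \<open>mono\<close> adds \<open>q\<close>.\<close>
      let ?P = "{q. hp (self_module R) a q \<noteq> \<zero>\<^bsub>R\<^esub>}"
      have fin: "finite ?P" and ha: "hp (self_module R) a q \<in> carrier R" for q
        using a S.hp_finite[of a] S.hp_closed[of a] by auto
      have "(\<Oplus>\<^bsub>M\<^esub>q\<in>?P. hp (self_module R) a q \<odot>\<^bsub>M\<^esub> hp M (t i) (g - q)) \<noteq> \<zero>\<^bsub>M\<^esub>"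
        using nz hp_smult_sum[OF a tc fin] by simp
      then have "\<exists>q\<in>?P. hp (self_module R) a q \<odot>\<^bsub>M\<^esub> hp M (t i) (g - q) \<noteq> \<zero>\<^bsub>M\<^esub>"
        by (metis (no_types, lifting) M.M.add.finprod_one_eqI)
      then obtain q where "hp (self_module R) a q \<noteq> \<zero>\<^bsub>R\<^esub>"
        "hp (self_module R) a q \<odot>\<^bsub>M\<^esub> hp M (t i) (g - q) \<noteq> \<zero>\<^bsub>M\<^esub>" by blast
      moreover from this have "hp M (t i) (g - q) \<noteq> \<zero>\<^bsub>M\<^esub>" using M.smult_r_null[OF ha[of q]] by auto
      ultimately have q: "hp (self_module R) a q \<noteq> \<zero>\<^bsub>R\<^esub>" "hp M (t i) (g - q) \<noteq> \<zero>\<^bsub>M\<^esub>" by blast+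
      then have "q \<in> support R" using S.hp_zero_outside[of a q] a by (auto simp: support_def)
      moreover have "i \<in> L ((g - q) + d i)" using t q unfolding tuples_carrier by blast
      ultimately have "i \<in> L (q + ((g - q) + d i))" using mono by blast
      then show ?thesis by (simp add: algebra_simps)
    qed
    ultimately show ?thesis using a t by (simp add: tuples_carrier)
  qed
  have ev: "t i \<in> carrier M" if "t \<in> carrier ?T" for t i using that by (simp add: tuples_carrier)
  have "abelian_group ?T"
  proof (rule abelian_groupI)
    fix t assume t: "t \<in> carrier ?T"
    show "\<exists>u\<in>carrier ?T. u \<oplus>\<^bsub>?T\<^esub> t = \<zero>\<^bsub>?T\<^esub>"
    proof (rule bexI)
      show "(\<lambda>i. (\<ominus>\<^bsub>R\<^esub> \<one>\<^bsub>R\<^esub>) \<odot>\<^bsub>M\<^esub> t i) \<in> carrier ?T" by (rule smult) (use t in auto)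
      show "(\<lambda>i. (\<ominus>\<^bsub>R\<^esub> \<one>\<^bsub>R\<^esub>) \<odot>\<^bsub>M\<^esub> t i) \<oplus>\<^bsub>?T\<^esub> t = \<zero>\<^bsub>?T\<^esub>"
        using ev[OF t] by (simp add: M.smult_l_minus M.M.l_neg)
    qed
  qed (use add zero ev in \<open>auto simp: M.M.a_ac fun_eq_iff\<close>)
  then have mod: "module R ?T"
    by (intro moduleI R.is_cring)
      (use smult ev in \<open>auto simp: M.smult_l_distr M.smult_r_distr M.smult_assoc1\<close>)
  interpret T: module R ?T by (rule mod)
  have hom: "(\<lambda>t. t i) \<in> module_hom R ?T M" for i using ev by (auto simp: module_hom_def)
  define H where "H t g = (\<lambda>i. hp M (t i) (g - d i))" for t g
  have HC: "H t g \<in> component ?T g" if t: "t \<in> carrier ?T" for t g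
    unfolding tuples_component
  proof (intro conjI allI impI)
    show "finite {i. H t g i \<noteq> \<zero>\<^bsub>M\<^esub>}"
      by (rule finite_subset[of _ "{i. t i \<noteq> \<zero>\<^bsub>M\<^esub>}"]) (use t in \<open>auto simp: H_def tuples_carrier\<close>)
    show "H t g i \<in> component M (g - d i)" for i using hp_component ev[OF t] by (simp add: H_def)
    show "i \<in> L g" if "H t g i \<noteq> \<zero>\<^bsub>M\<^esub>" for i
    proof -
      have "i \<in> L ((g - d i) + d i)" using that t unfolding H_def tuples_carrier by blast
      then show ?thesis by simp
    qed
  qed
  have comp_carrier: "component ?T g \<subseteq> carrier ?T" for g
    by (auto simp: tuples_def Let_def)
  have fin: "finite {g. H t g \<noteq> \<zero>\<^bsub>?T\<^esub>}" if t: "t \<in> carrier ?T" for t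
  proof (rule finite_subset)
    show "{g. H t g \<noteq> \<zero>\<^bsub>?T\<^esub>} \<subseteq> (\<Union>i\<in>{i. t i \<noteq> \<zero>\<^bsub>M\<^esub>}. (\<lambda>h. h + d i) ` {h. hp M (t i) h \<noteq> \<zero>\<^bsub>M\<^esub>})"
    proof
      fix g assume "g \<in> {g. H t g \<noteq> \<zero>\<^bsub>?T\<^esub>}"
      then obtain i where i: "hp M (t i) (g - d i) \<noteq> \<zero>\<^bsub>M\<^esub>" by (auto simp: H_def)
      moreover from i have "t i \<noteq> \<zero>\<^bsub>M\<^esub>" by auto
      ultimately show "g \<in> (\<Union>i\<in>{i. t i \<noteq> \<zero>\<^bsub>M\<^esub>}. (\<lambda>h. h + d i) ` {h. hp M (t i) h \<noteq> \<zero>\<^bsub>M\<^esub>})"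
        by (intro UN_I[of i] image_eqI[of _ _ "g - d i"]) auto
    qed
    show "finite (\<Union>i\<in>{i. t i \<noteq> \<zero>\<^bsub>M\<^esub>}. (\<lambda>h. h + d i) ` {h. hp M (t i) h \<noteq> \<zero>\<^bsub>M\<^esub>})"
      using t hp_finite ev[OF t] by (auto simp: tuples_carrier)
  qed
  have sum: "(\<Oplus>\<^bsub>?T\<^esub>g\<in>{g. H t g \<noteq> \<zero>\<^bsub>?T\<^esub>}. H t g) = t" if t: "t \<in> carrier ?T" for t
  proof
    fix i
    have HT: "H t g \<in> carrier ?T" for g using HC[OF t] comp_carrier by blast
    have "(\<Oplus>\<^bsub>?T\<^esub>g\<in>{g. H t g \<noteq> \<zero>\<^bsub>?T\<^esub>}. H t g) i = (\<Oplus>\<^bsub>M\<^esub>g\<in>{g. H t g \<noteq> \<zero>\<^bsub>?T\<^esub>}. H t g i)"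
      using module_hom_finsum[OF mod module_M hom fin[OF t], of "H t"] HT by auto
    also have "\<dots> = (\<Oplus>\<^bsub>M\<^esub>g\<in>(\<lambda>g. g - d i) ` {g. H t g \<noteq> \<zero>\<^bsub>?T\<^esub>}. hp M (t i) g)"
      using ev[OF t] by (subst M.M.finsum_reindex) (auto simp: H_def inj_on_def)
    also have "\<dots> = t i"
    proof (rule hp_sum_superset[OF ev[OF t]])
      show "finite ((\<lambda>g. g - d i) ` {g. H t g \<noteq> \<zero>\<^bsub>?T\<^esub>})" using fin[OF t] by simp
      show "{g. hp M (t i) g \<noteq> \<zero>\<^bsub>M\<^esub>} \<subseteq> (\<lambda>g. g - d i) ` {g. H t g \<noteq> \<zero>\<^bsub>?T\<^esub>}"
      proof
        fix h assume "h \<in> {g. hp M (t i) g \<noteq> \<zero>\<^bsub>M\<^esub>}"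
        then have "H t (h + d i) i \<noteq> \<zero>\<^bsub>M\<^esub>" by (simp add: H_def)
        then have "H t (h + d i) \<noteq> \<zero>\<^bsub>?T\<^esub>" by auto
        then show "h \<in> (\<lambda>g. g - d i) ` {g. H t g \<noteq> \<zero>\<^bsub>?T\<^esub>}" by (intro image_eqI[of _ _ "h + d i"]) auto
      qed
    qed
    finally show "(\<Oplus>\<^bsub>?T\<^esub>g\<in>{g. H t g \<noteq> \<zero>\<^bsub>?T\<^esub>}. H t g) i = t i" .
  qed
  have comp_iff: "t \<in> component ?T g \<longleftrightarrow> t \<in> carrier ?T \<and> (\<forall>i. t i \<in> component M (g - d i))" for t g
    by (simp add: tuples_def Let_def)
  have cadd: "x \<oplus>\<^bsub>?T\<^esub> y \<in> component ?T g" if "x \<in> component ?T g" "y \<in> component ?T g" for x y g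
    using that add[of x y] component_add by (simp add: comp_iff)
  have csmult: "a \<odot>\<^bsub>?T\<^esub> x \<in> component ?T (q + g)" if a: "a \<in> component R q" and x: "x \<in> component ?T g" for a x q g
  proof -
    have "(\<lambda>i. a \<odot>\<^bsub>M\<^esub> x i) \<in> carrier ?T"
      using smult R_component_closed[OF a] x comp_carrier by blast
    moreover have "a \<odot>\<^bsub>M\<^esub> x i \<in> component M (q + g - d i)" for i
      using component_smult[OF a, of "x i" "g - d i"] x by (simp add: tuples_component algebra_simps)
    ultimately show ?thesis by (simp add: comp_iff)
  qed
  have czero: "\<zero>\<^bsub>?T\<^esub> \<in> component ?T g" for g by (simp add: tuples_component)
  have Hadd: "H (x \<oplus>\<^bsub>?T\<^esub> y) g = H x g \<oplus>\<^bsub>?T\<^esub> H y g" if "x \<in> carrier ?T" "y \<in> carrier ?T" for x y g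
    using ev that by (simp add: H_def hp_add)
  have Hhom: "H t g = (if g = h then t else \<zero>\<^bsub>?T\<^esub>)" if "t \<in> component ?T h" for t g h
  proof -
    have "hp M (t i) = (\<lambda>g. if g = h - d i then t i else \<zero>\<^bsub>M\<^esub>)" for i
      using that by (intro hp_homogeneous) (simp add: tuples_component)
    then show ?thesis by (auto simp: H_def)
  qed
  show "grmod ?T"
    by (rule graded_moduleI(2)[where H = H]) (fact mod comp_carrier czero cadd csmult HC fin sum Hadd Hhom)+
qed

text \<open>In degree \<open>g\<close> only the places in \<open>L g\<close> with
  \<open>g - d i\<close> in the support of \<open>M\<close> can be occupied, so the component is a
  space of functions as in \<open>has_dim_functions\<close>.\<close>

lemma tuples_component_has_dim:
  fixes d :: "'i \<Rightarrow> 'g"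
  assumes mono: "\<And>g q i. i \<in> L g \<Longrightarrow> q \<in> support R \<Longrightarrow> i \<in> L (q + g)"
    and fin: "finite {i \<in> L g. g - d i \<in> support M}"
    and fd: "\<And>h. finite_dimensional K (restrict_scalars R M) (component M h)"
  shows "kspace.has_dim K (restrict_scalars R (tuples M d L)) (component (tuples M d L) g)
    (\<Sum>i\<in>{i \<in> L g. g - d i \<in> support M}. hilbert M (g - d i))"
proof -
  let ?I = "{i \<in> L g. g - d i \<in> support M}"
  interpret T: graded_module_over K R "tuples M d L" by (rule grmod_tuples) (rule mono)
  have eq: "{t. (\<forall>i\<in>?I. t i \<in> component M (g - d i)) \<and> (\<forall>i. i \<notin> ?I \<longrightarrow> t i = \<zero>\<^bsub>restrict_scalars R M\<^esub>)} =
      component (tuples M d L) g" (is "?A = _")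
  proof (intro equalityI subsetI)
    fix t assume t: "t \<in> ?A"
    have "{i. t i \<noteq> \<zero>\<^bsub>M\<^esub>} \<subseteq> ?I" using t by auto
    then have "finite {i. t i \<noteq> \<zero>\<^bsub>M\<^esub>}" using fin by (rule finite_subset)
    moreover have "t i \<in> component M (g - d i)" for i using t by (cases "i \<in> ?I") auto
    moreover have "i \<in> L g" if "t i \<noteq> \<zero>\<^bsub>M\<^esub>" for i using t that by auto
    ultimately show "t \<in> component (tuples M d L) g" by (simp add: tuples_component)
  next
    fix t assume t: "t \<in> component (tuples M d L) g"
    have "t i = \<zero>\<^bsub>M\<^esub>" if "i \<notin> ?I" for i
      using that t unfolding tuples_component support_def by blast
    then show "t \<in> ?A" using t by (simp add: tuples_component)
  qed
  note * = has_dim_functions[OF V.kspace_axioms T.V.kspace_axioms, where I = ?I and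
      W = "\<lambda>i. component M (g - d i)" and d = "\<lambda>i. hilbert M (g - d i)", unfolded eq]
  show ?thesis
    by (rule conjunct2[OF *])
      (use fin component_submodule component_has_dim[OF graded_module_over_axioms fd] T.component_closed in auto)
qed

lemma support_tuples:
  assumes "g \<in> support (tuples M d L)"
  shows "\<exists>i\<in>L g. g - d i \<in> support M"
proof -
  have "(\<lambda>_. \<zero>\<^bsub>M\<^esub>) \<in> component (tuples M d L) g" by (simp add: tuples_component)
  then obtain t where t: "t \<in> component (tuples M d L) g" "t \<noteq> (\<lambda>_. \<zero>\<^bsub>M\<^esub>)"
    using assms by (auto simp: support_def)
  then obtain i where "t i \<noteq> \<zero>\<^bsub>M\<^esub>" by auto
  then show ?thesis using t(1) unfolding tuples_component support_def by blast
qed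

end

section \<open>The module with trivialised action\<close>

text \<open>\<open>R\<close> acts through its projection to degree 0, so only the graded vector
  space of \<open>M\<close> remains. This is a model of the direct sum of the quotients of the
  height filtration: degree \<open>g\<close> of \<open>M\<close> survives exactly in the quotient
  whose index is the height of \<open>g\<close>.\<close>

definition (in pdcf_algebra) triv :: "('r, 'm, 'g) graded_module \<Rightarrow> ('r, 'm, 'g) graded_module"
  where "triv M = M\<lparr>smult := \<lambda>a m. hp (self_module R) a 0 \<odot>\<^bsub>M\<^esub> m\<rparr>"

context pdcf_algebra begin

lemma triv_simps [simp]:
  "carrier (triv M) = carrier M" "\<zero>\<^bsub>triv M\<^esub> = \<zero>\<^bsub>M\<^esub>" "x \<oplus>\<^bsub>triv M\<^esub> y = x \<oplus>\<^bsub>M\<^esub> y"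
  "a \<odot>\<^bsub>triv M\<^esub> x = hp (self_module R) a 0 \<odot>\<^bsub>M\<^esub> x" "component (triv M) = component M"
  "finsum (triv M) = finsum M"
proof -
  show "finsum (triv M) = finsum M" by (rule finsum_cong_record) (simp_all add: triv_def)
qed (simp_all add: triv_def)

text \<open>Pointedness makes the projection to degree 0 multiplicative: a product of parts of
  degrees \<open>q\<close> and \<open>- q\<close> can be nonzero only for
  \<open>q = 0\<close>.\<close>

lemma hp_0_mult:
  assumes a: "a \<in> carrier R" and b: "b \<in> carrier R"
  shows "hp (self_module R) (a \<otimes>\<^bsub>R\<^esub> b) 0 = hp (self_module R) a 0 \<otimes>\<^bsub>R\<^esub> hp (self_module R) b 0"
proof -
  let ?h = "hp (self_module R)" and ?P = "insert 0 {q. hp (self_module R) a q \<noteq> \<zero>\<^bsub>R\<^esub>}"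
  have hc: "?h x q \<in> carrier R" if "x \<in> carrier R" for x q using S.hp_closed[of x] that by simp
  have fin: "finite ?P" using S.hp_finite[of a] a by simp
  have "?h (a \<otimes>\<^bsub>R\<^esub> b) 0 = (\<Oplus>\<^bsub>self_module R\<^esub>q\<in>?P. ?h a q \<otimes>\<^bsub>R\<^esub> ?h b (0 - q))"
    using S.hp_smult_sum[of a b ?P 0] a b fin by auto
  also have "\<dots> = (\<Oplus>\<^bsub>self_module R\<^esub>q\<in>?P. if 0 = q then ?h a q \<otimes>\<^bsub>R\<^esub> ?h b q else \<zero>\<^bsub>self_module R\<^esub>)"
  proof (rule S.M.M.finsum_cong')
    fix q assume "q \<in> ?P"
    show "?h a q \<otimes>\<^bsub>R\<^esub> ?h b (0 - q) = (if 0 = q then ?h a q \<otimes>\<^bsub>R\<^esub> ?h b q else \<zero>\<^bsub>self_module R\<^esub>)"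
    proof (cases "q = 0")
      case False
      then have "q \<notin> support R \<or> - q \<notin> support R" using support_pointed by blast
      then have "?h a q = \<zero>\<^bsub>R\<^esub> \<or> ?h b (- q) = \<zero>\<^bsub>R\<^esub>"
        using S.hp_zero_outside[of a q] S.hp_zero_outside[of b "- q"] a b by (auto simp: support_def)
      then show ?thesis using False hc a b by auto
    qed simp
  qed (use hc a b in auto)
  also have "\<dots> = ?h a 0 \<otimes>\<^bsub>R\<^esub> ?h b 0"
    by (rule S.M.M.finsum_singleton) (use fin hc a b in auto)
  finally show ?thesis .
qed

lemma grmod_triv:
  assumes "grmod M"
  shows "grmod (triv M)"
proof -
  interpret M: graded_module_over K R M by fact
  have h: "hp (self_module R) a 0 \<in> carrier R" if "a \<in> carrier R" for a
    using S.hp_closed[of a] that by simp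
  have "abelian_group (triv M)"
  proof (rule abelian_groupI)
    fix x assume "x \<in> carrier (triv M)"
    then show "\<exists>y\<in>carrier (triv M). y \<oplus>\<^bsub>triv M\<^esub> x = \<zero>\<^bsub>triv M\<^esub>"
      by (intro bexI[of _ "\<ominus>\<^bsub>M\<^esub> x"]) (auto simp: M.M.M.l_neg)
  qed (auto simp: M.M.M.a_ac)
  moreover have "hp (self_module R) \<one>\<^bsub>R\<^esub> 0 = \<one>\<^bsub>R\<^esub>"
    using S.hp_homogeneous[of "\<one>\<^bsub>R\<^esub>" 0] one_component by simp
  ultimately have mod: "module R (triv M)"
    using S.hp_add
    by (intro moduleI R.is_cring)
      (auto simp: h hp_0_mult M.M.smult_l_distr M.M.smult_r_distr M.M.smult_assoc1)
  show ?thesis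
  proof (rule graded_moduleI(2)[OF mod, of "hp M"])
    show "a \<odot>\<^bsub>triv M\<^esub> x \<in> component (triv M) (q + g)" if a: "a \<in> component R q" and x: "x \<in> component (triv M) g"
      for a x q g
    proof (cases "q = 0")
      case True
      then show ?thesis using S.hp_homogeneous[of a q] M.component_smult[of a q x g] a x by simp
    next
      case False
      then show ?thesis using S.hp_homogeneous[of a q] M.component_closed[of x g] a x by simp
    qed
  qed (use M.component_closed M.component_add M.hp_component M.hp_finite M.hp_sum M.hp_add M.hp_homogeneous in auto)
qed

text \<open>The scalars of \<open>K\<close> sit in degree 0 of \<open>R\<close>, which the
  projection fixes, so \<open>M\<close> and \<open>triv M\<close> agree as spaces over
  \<open>K\<close>.\<close>

lemma triv_component_has_dim:
  assumes "grmod M" "kspace.has_dim K (restrict_scalars R M) (component M g) n"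
  shows "kspace.has_dim K (restrict_scalars R (triv M)) (component (triv M) g) n"
proof -
  interpret M: graded_module_over K R M by fact
  interpret T: graded_module_over K R "triv M" by (rule grmod_triv) fact
  have "kspace_map K (restrict_scalars R M) (restrict_scalars R (triv M)) (component M g) (\<lambda>x. x)"
  proof (intro kspace_map.intro kspace_map_axioms.intro M.V.kspace_axioms T.V.kspace_axioms M.component_submodule)
    show "c \<odot>\<^bsub>restrict_scalars R M\<^esub> x = c \<odot>\<^bsub>restrict_scalars R (triv M)\<^esub> x"
      if "c \<in> carrier K" "x \<in> component M g" for c x
      using S.hp_homogeneous[of "c \<odot>\<^bsub>R\<^esub> \<one>\<^bsub>R\<^esub>" 0] that by (simp add: component_0)
  qed (use M.component_closed in auto)
  then interpret kspace_map K "restrict_scalars R M" "restrict_scalars R (triv M)" "component M g" "\<lambda>x. x" .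
  show ?thesis using has_dim_image[of n] assms(2) by simp
qed

lemma bdf_triv:
  assumes "bdf_module K R M"
  shows "bdf_module K R (triv M)" "hilbert (triv M) = hilbert M"
proof -
  interpret T: graded_module_over K R "triv M" by (rule grmod_triv[OF bdf_grmod[OF assms]])
  note d = triv_component_has_dim[OF bdf_grmod[OF assms] component_has_dim[OF bdf_grmod[OF assms] bdf_fd[OF assms]]]
  show "hilbert (triv M) = hilbert M"
    by (intro ext hilbert_eq[OF T.graded_module_over_axioms] d)
  have "finite_dimensional K (restrict_scalars R (triv M)) (component (triv M) g)" for g
    by (rule has_dim_finite_dimensional[OF T.V.kspace_axioms d]) (use T.component_closed in auto)
  moreover have "support (triv M) = support M" by (simp add: support_def)
  ultimately show "bdf_module K R (triv M)" using assms T.graded_module_over_axioms by (auto simp: bdf_iff)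
qed

text \<open>Once \<open>R_+\<close> acts as zero, linearity over \<open>R\<close> amounts to
  linearity over \<open>K\<close>, so any choice of linear bijections between the components glues
  to an isomorphism.\<close>

lemma triv_iso:
  assumes "bdf_module K R M" "bdf_module K R N" "hilbert M = hilbert N"
  shows "graded_isomorphic R (triv M) (triv N)"
proof -
  interpret M: graded_module_over K R M by (rule bdf_grmod) fact
  interpret N: graded_module_over K R N by (rule bdf_grmod) fact
  have "\<exists>f. kspace_map K (restrict_scalars R M) (restrict_scalars R N) (component M g) f \<and>
      bij_betw f (component M g) (component N g)" for g
  proof (rule has_dim_bij[OF M.V.kspace_axioms N.V.kspace_axioms M.component_submodule N.component_submodule])
    show "M.V.has_dim (component M g) (hilbert N g)"
      using component_has_dim[OF bdf_grmod bdf_fd, OF assms(1) assms(1)] assms(3) by simp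
    show "N.V.has_dim (component N g) (hilbert N g)"
      using component_has_dim[OF bdf_grmod bdf_fd, OF assms(2) assms(2)] by simp
  qed blast
  then obtain f where f: "\<And>g. kspace_map K (restrict_scalars R M) (restrict_scalars R N) (component M g) (f g)"
    "\<And>g. bij_betw (f g) (component M g) (component N g)" by metis
  have fc: "f g x \<in> component N g" if "x \<in> component M g" for g x using f(2) that by (auto simp: bij_betw_def)
  have f0: "f g \<zero>\<^bsub>M\<^esub> = \<zero>\<^bsub>N\<^esub>" for g using kspace_map.f_zero[OF f(1)] by simp
  have gM: "grmod (triv M)" and gN: "grmod (triv N)"
    by (rule grmod_triv M.graded_module_over_axioms N.graded_module_over_axioms)+
  obtain \<Phi> where \<Phi>: "\<Phi> \<in> graded_hom R (triv M) (triv N)" "\<And>g x. x \<in> component (triv M) g \<Longrightarrow> \<Phi> x = f g x"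
  proof (rule glue_degreewise[OF gM gN, of f])
    show "f g (x \<oplus>\<^bsub>triv M\<^esub> y) = f g x \<oplus>\<^bsub>triv N\<^esub> f g y" if "x \<in> component (triv M) g" "y \<in> component (triv M) g" for g x y
      using kspace_map.f_add[OF f(1)] that by simp
    show "f (q + h) (a \<odot>\<^bsub>triv M\<^esub> x) = a \<odot>\<^bsub>triv N\<^esub> f h x" if a: "a \<in> component R q" and x: "x \<in> component (triv M) h" for q h a x
    proof (cases "q = 0")
      case True
      then obtain c where c: "c \<in> carrier K" "a = c \<odot>\<^bsub>R\<^esub> \<one>\<^bsub>R\<^esub>" using a component_0 by auto
      have "hp (self_module R) a 0 = a" using S.hp_homogeneous[of a q] a True by simp
      then show ?thesis using kspace_map.f_smult[OF f(1) c(1), of x h] c(2) x True by simp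
    next
      case False
      then have "hp (self_module R) a 0 = \<zero>\<^bsub>R\<^esub>" using S.hp_homogeneous[of a q] a by simp
      then show ?thesis using x M.component_closed[of x h] N.component_closed[OF fc[of x h]] f0 by simp
    qed
  qed (use fc in auto)
  show ?thesis
  proof (rule graded_isomorphicI[OF gM gN \<Phi>(1)])
    show "bij_betw \<Phi> (component (triv M) g) (component (triv N) g)" for g
      using bij_betw_cong[of "component M g" \<Phi> "f g"] \<Phi>(2) f(2) by simp
  qed
qed

end

context pdcf_algebra begin

text \<open>Finiteness of the set of occupied places bounds the dimension in each degree, and
  \<open>P\<close> bounds the support. It serves both the modules of the telescope and the graded
  free modules.\<close>

lemma bdf_tuples:
  assumes M: "bdf_module K R M" and mono: "\<And>g q i. i \<in> L g \<Longrightarrow> q \<in> support R \<Longrightarrow> i \<in> L (q + g)"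
    and fin: "\<And>g. finite {i \<in> L g. g - d i \<in> support M}"
    and P: "finite P" "\<And>g i. i \<in> L g \<Longrightarrow> g - d i \<in> support M \<Longrightarrow> g \<in> upper P"
  shows "bdf_module K R (tuples M d L)"
    and "hilbert (tuples M d L) g = (\<Sum>i\<in>{i \<in> L g. g - d i \<in> support M}. hilbert M (g - d i))"
proof -
  interpret M: graded_module_over K R M by (rule bdf_grmod[OF M])
  have G: "grmod (tuples M d L)" by (rule M.grmod_tuples) (rule mono)
  interpret T: graded_module_over K R "tuples M d L" by (rule G)
  have d: "T.V.has_dim (component (tuples M d L) g) (\<Sum>i\<in>{i \<in> L g. g - d i \<in> support M}. hilbert M (g - d i))" for g
    by (rule M.tuples_component_has_dim) (use mono fin bdf_fd[OF M] in auto)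
  show "hilbert (tuples M d L) g = (\<Sum>i\<in>{i \<in> L g. g - d i \<in> support M}. hilbert M (g - d i))"
    by (rule hilbert_eq[OF G d])
  have "finite_dimensional K (restrict_scalars R (tuples M d L)) (component (tuples M d L) g)" for g
    by (rule has_dim_finite_dimensional[OF T.V.kspace_axioms d]) (use T.component_closed in auto)
  moreover have "support (tuples M d L) \<subseteq> upper P" using M.support_tuples P(2) by blast
  ultimately show "bdf_module K R (tuples M d L)" using G P(1) by (auto simp: bdf_iff)
qed

section \<open>Relations in the Grothendieck group of all modules\<close>

text \<open>A class contains only modules on the model type, and an empty class would carry no
  information. \<open>bdf_module_model\<close> supplies a member, through which equality of classes
  yields an isomorphism.\<close>

lemma bdf_class_eq_iff:
  assumes "bdf_module K R M" "bdf_module K R N"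
  shows "bdf_class K R M = bdf_class K R N \<longleftrightarrow> graded_isomorphic R M N"
proof
  assume eq: "bdf_class K R M = bdf_class K R N"
  obtain X :: "('k, 'r, 'g) model" where X: "bdf_module K R X" "graded_isomorphic R M X"
    using bdf_module_model[OF assms(1)] by blast
  then have "graded_isomorphic R N X" using eq by (auto simp: bdf_class_def)
  then show "graded_isomorphic R M N"
    by (rule graded_isomorphic_trans[OF X(2) graded_isomorphic_sym[OF bdf_grmod[OF assms(2)] bdf_grmod[OF X(1)]]])
next
  assume iso: "graded_isomorphic R M N"
  have iso': "graded_isomorphic R N M"
    by (rule graded_isomorphic_sym[OF bdf_grmod bdf_grmod iso]) (rule assms)+
  show "bdf_class K R M = bdf_class K R N"
    using graded_isomorphic_trans[OF iso] graded_isomorphic_trans[OF iso'] by (auto simp: bdf_class_def)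
qed

definition bdf_classes :: "('k, 'r, 'g) model set set"
  where "bdf_classes = {bdf_class K R M | M :: ('k, 'r, 'g) model. bdf_module K R M}"

definition coset :: "(('k, 'r, 'g) model set \<Rightarrow>\<^sub>0 int) \<Rightarrow> (('k, 'r, 'g) model set \<Rightarrow>\<^sub>0 int) set"
  where "coset x = exact_relations K R #>\<^bsub>bdf_free_group K R\<^esub> x"

lemma bdf_class_in_bdf_classes:
  assumes "bdf_module K R M"
  shows "bdf_class K R M \<in> bdf_classes"
proof -
  obtain X :: "('k, 'r, 'g) model" where X: "bdf_module K R X" "graded_isomorphic R M X"
    using bdf_module_model[OF assms] by blast
  then have "bdf_class K R M = bdf_class K R X" using bdf_class_eq_iff[OF assms X(1)] by blast
  with X show ?thesis unfolding bdf_classes_def by blast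
qed

lemma free_group_carrier: "x \<in> carrier (bdf_free_group K R) \<longleftrightarrow> Poly_Mapping.keys x \<subseteq> bdf_classes"
  by (simp add: bdf_free_group_def bdf_classes_def)

lemma free_group_simps [simp]:
  "x \<otimes>\<^bsub>bdf_free_group K R\<^esub> y = x + y" "\<one>\<^bsub>bdf_free_group K R\<^esub> = 0"
  by (simp_all add: bdf_free_group_def)

lemma free_group_inv: "x \<in> carrier (bdf_free_group K R) \<Longrightarrow> inv\<^bsub>bdf_free_group K R\<^esub> x = - x"
  by (simp add: bdf_free_group_def)

lemma comm_group_free: "comm_group (bdf_free_group K R)"
  by (simp add: bdf_free_group_def abelian_free_Abelian_group)

sublocale FG: comm_group "bdf_free_group K R" by (rule comm_group_free)

lemma frag_of_closed: "bdf_module K R M \<Longrightarrow> frag_of (bdf_class K R M) \<in> carrier (bdf_free_group K R)"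
  using bdf_class_in_bdf_classes by (simp add: free_group_carrier keys_frag_of)

lemma free_group_add: "\<lbrakk>x \<in> carrier (bdf_free_group K R); y \<in> carrier (bdf_free_group K R)\<rbrakk> \<Longrightarrow>
    x + y \<in> carrier (bdf_free_group K R)"
  using FG.m_closed by simp

lemma free_group_diff: "\<lbrakk>x \<in> carrier (bdf_free_group K R); y \<in> carrier (bdf_free_group K R)\<rbrakk> \<Longrightarrow>
    x - y \<in> carrier (bdf_free_group K R)"
  using FG.m_closed[of x "inv\<^bsub>bdf_free_group K R\<^esub> y"] FG.inv_closed[of y] by (simp add: free_group_inv)

lemma exact_relations_subgroup: "subgroup (exact_relations K R) (bdf_free_group K R)"
  unfolding exact_relations_def
proof (rule FG.generate_is_subgroup)
  show "{frag_of (bdf_class K R L) - frag_of (bdf_class K R M) + frag_of (bdf_class K R N) |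
       (L :: ('k, 'r, 'g) model) (M :: ('k, 'r, 'g) model) (N :: ('k, 'r, 'g) model) \<phi> \<psi>.
       bdf_module K R L \<and> bdf_module K R M \<and> bdf_module K R N \<and> short_exact R L \<phi> M \<psi> N}
    \<subseteq> carrier (bdf_free_group K R)"
    by (auto intro!: free_group_add free_group_diff frag_of_closed)
qed

lemma exact_relations_normal: "exact_relations K R \<lhd> bdf_free_group K R"
  using FG.subgroup_imp_normal exact_relations_subgroup by blast

lemma coset_eq_iff:
  assumes "x \<in> carrier (bdf_free_group K R)" "y \<in> carrier (bdf_free_group K R)"
  shows "coset x = coset y \<longleftrightarrow> x - y \<in> exact_relations K R"
proof -
  have "coset x = coset y \<longleftrightarrow> x \<in> coset y"
    unfolding coset_def using FG.repr_independence[OF _ assms(2) exact_relations_subgroup]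
      FG.rcos_self[OF assms(1) exact_relations_subgroup] by metis
  also have "\<dots> \<longleftrightarrow> x \<otimes>\<^bsub>bdf_free_group K R\<^esub> inv\<^bsub>bdf_free_group K R\<^esub> y \<in> exact_relations K R"
    unfolding coset_def by (rule subgroup.rcos_module[OF exact_relations_subgroup FG.is_group assms(2,1)])
  finally show ?thesis using assms(2) by (simp add: free_group_inv)
qed

lemma carrier_G0: "carrier (G0_BDF K R) = coset ` carrier (bdf_free_group K R)"
  unfolding G0_BDF_def coset_def by (rule carrier_FactGroup)

lemma coset_add:
  assumes "x \<in> carrier (bdf_free_group K R)" "y \<in> carrier (bdf_free_group K R)"
  shows "coset x \<otimes>\<^bsub>G0_BDF K R\<^esub> coset y = coset (x + y)"
  unfolding G0_BDF_def mult_FactGroup coset_def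
  using normal.rcos_sum[OF exact_relations_normal assms] by simp

lemma comm_group_G0: "comm_group (G0_BDF K R)"
proof -
  have "group (G0_BDF K R)" unfolding G0_BDF_def by (rule normal.factorgroup_is_group[OF exact_relations_normal])
  then show ?thesis
  proof (rule group.group_comm_groupI)
    fix X Y assume "X \<in> carrier (G0_BDF K R)" "Y \<in> carrier (G0_BDF K R)"
    then show "X \<otimes>\<^bsub>G0_BDF K R\<^esub> Y = Y \<otimes>\<^bsub>G0_BDF K R\<^esub> X"
      unfolding carrier_G0 by (auto simp: coset_add add.commute)
  qed
qed

sublocale G0: comm_group "G0_BDF K R" by (rule comm_group_G0)

lemma G0_class_eq_coset: "G0_class K R M = coset (frag_of (bdf_class K R M))"
  by (simp add: G0_class_def coset_def)

lemma G0_class_closed: "bdf_module K R M \<Longrightarrow> G0_class K R M \<in> carrier (G0_BDF K R)"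
  unfolding carrier_G0 G0_class_eq_coset by (rule imageI) (rule frag_of_closed)

lemma G0_class_iso:
  assumes "bdf_module K R M" "bdf_module K R N" "graded_isomorphic R M N"
  shows "G0_class K R M = G0_class K R N"
  using bdf_class_eq_iff[OF assms(1,2)] assms(3) by (simp add: G0_class_def)

text \<open>The relations in \<open>exact_relations\<close> only involve modules on the model type.
  Moving a sequence along isomorphisms lets \<open>G0_class_exact\<close> use sequences of tuples
  and of pairs.\<close>

lemma short_exact_iso:
  assumes "graded_isomorphic R L' L" "graded_isomorphic R M M'" "graded_isomorphic R N N'"
    and gr: "grmod L'" "grmod M" "grmod N" "grmod N'" "grmod M'" and ex: "short_exact R L \<phi> M \<psi> N"
  shows "\<exists>\<phi>' \<psi>'. short_exact R L' \<phi>' M' \<psi>' N'"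
proof -
  interpret N: graded_module_over K R N by fact
  interpret N': graded_module_over K R N' by fact
  obtain l m n where l: "l \<in> graded_hom R L' L" "bij_betw l (carrier L') (carrier L)"
    and m: "m \<in> graded_hom R M M'" "bij_betw m (carrier M) (carrier M')"
    and n: "n \<in> graded_hom R N N'" "bij_betw n (carrier N) (carrier N')"
    using assms(1-3) by (auto simp: graded_isomorphic_def)
  define m' where "m' = inv_into (carrier M) m"
  have m': "m' \<in> graded_hom R M' M" "bij_betw m' (carrier M') (carrier M)"
    "\<And>x. x \<in> carrier M \<Longrightarrow> m' (m x) = x" "\<And>x. x \<in> carrier M' \<Longrightarrow> m (m' x) = x"
    unfolding m'_def using graded_hom_inv_into[OF gr(2,5) m] bij_betw_inv_into[OF m(2)] m(2)
    by (auto simp: bij_betw_def f_inv_into_f)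
  have e: "\<phi> \<in> graded_hom R L M" "\<psi> \<in> graded_hom R M N" "inj_on \<phi> (carrier L)"
    "\<phi> ` carrier L = {x\<in>carrier M. \<psi> x = \<zero>\<^bsub>N\<^esub>}" "\<psi> ` carrier M = carrier N"
    using ex by (auto simp: short_exact_def)
  have nz: "n y = \<zero>\<^bsub>N'\<^esub> \<longleftrightarrow> y = \<zero>\<^bsub>N\<^esub>" if "y \<in> carrier N" for y
    using module_hom_zero[OF N.module_M N'.module_M graded_homD(5)[OF n(1)]] n(2) that
    by (metis N.M.M.zero_closed bij_betw_def inj_on_def)
  have "short_exact R L' (\<lambda>x. m (\<phi> (l x))) M' (\<lambda>x. n (\<psi> (m' x))) N'"
    unfolding short_exact_def
  proof (intro conjI)
    show "(\<lambda>x. m (\<phi> (l x))) \<in> graded_hom R L' M'"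
      using graded_hom_comp[OF graded_hom_comp[OF l(1) e(1)] m(1)] .
    show "(\<lambda>x. n (\<psi> (m' x))) \<in> graded_hom R M' N'"
      using graded_hom_comp[OF graded_hom_comp[OF m'(1) e(2)] n(1)] .
    have "inj_on (m \<circ> (\<phi> \<circ> l)) (carrier L')"
    proof (intro comp_inj_on)
      show "inj_on l (carrier L')" "inj_on \<phi> (l ` carrier L')" using l e by (auto simp: bij_betw_def)
      show "inj_on m ((\<phi> \<circ> l) ` carrier L')"
        by (rule inj_on_subset[of _ "carrier M"]) (use m graded_homD(1)[OF l(1)] graded_homD(1)[OF e(1)] in \<open>auto simp: bij_betw_def\<close>)
    qed
    then show "inj_on (\<lambda>x. m (\<phi> (l x))) (carrier L')" by (simp add: comp_def)
    have "(\<lambda>x. m (\<phi> (l x))) ` carrier L' = m ` \<phi> ` l ` carrier L'" by (simp add: image_image)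
    also have "\<dots> = m ` {x\<in>carrier M. \<psi> x = \<zero>\<^bsub>N\<^esub>}" using l e by (simp add: bij_betw_def)
    also have "\<dots> = {x \<in> carrier M'. n (\<psi> (m' x)) = \<zero>\<^bsub>N'\<^esub>}"
    proof (intro equalityI subsetI)
      fix y assume "y \<in> m ` {x\<in>carrier M. \<psi> x = \<zero>\<^bsub>N\<^esub>}"
      then show "y \<in> {x \<in> carrier M'. n (\<psi> (m' x)) = \<zero>\<^bsub>N'\<^esub>}"
        using m'(3) graded_homD(1)[OF m(1)] graded_homD(1)[OF e(2)] nz by auto
    next
      fix y assume y: "y \<in> {x \<in> carrier M'. n (\<psi> (m' x)) = \<zero>\<^bsub>N'\<^esub>}"
      then have "\<psi> (m' y) = \<zero>\<^bsub>N\<^esub>" using nz graded_homD(1)[OF m'(1)] graded_homD(1)[OF e(2)] by auto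
      then show "y \<in> m ` {x\<in>carrier M. \<psi> x = \<zero>\<^bsub>N\<^esub>}"
        using y m'(4)[of y] graded_homD(1)[OF m'(1)] by (intro image_eqI[of _ _ "m' y"]) auto
    qed
    finally show "(\<lambda>x. m (\<phi> (l x))) ` carrier L' = {x \<in> carrier M'. n (\<psi> (m' x)) = \<zero>\<^bsub>N'\<^esub>}" .
    have "(\<lambda>x. n (\<psi> (m' x))) ` carrier M' = n ` \<psi> ` m' ` carrier M'" by (simp add: image_image)
    then show "(\<lambda>x. n (\<psi> (m' x))) ` carrier M' = carrier N'" using m'(2) n(2) e(5) by (simp add: bij_betw_def)
  qed
  then show ?thesis by blast
qed

lemma G0_class_exact:
  assumes "bdf_module K R L" "bdf_module K R M" "bdf_module K R N" "short_exact R L \<phi> M \<psi> N"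
  shows "G0_class K R M = G0_class K R L \<otimes>\<^bsub>G0_BDF K R\<^esub> G0_class K R N"
proof -
  obtain L' M' N' :: "('k, 'r, 'g) model" where
    b: "bdf_module K R L'" "bdf_module K R M'" "bdf_module K R N'"
    and i: "graded_isomorphic R L L'" "graded_isomorphic R M M'" "graded_isomorphic R N N'"
    using bdf_module_model[OF assms(1)] bdf_module_model[OF assms(2)] bdf_module_model[OF assms(3)] by blast
  note gr = bdf_grmod[OF assms(1)] bdf_grmod[OF assms(2)] bdf_grmod[OF assms(3)]
    bdf_grmod[OF b(1)] bdf_grmod[OF b(2)] bdf_grmod[OF b(3)]
  obtain \<phi>' \<psi>' where ex: "short_exact R L' \<phi>' M' \<psi>' N'"
    using short_exact_iso[OF graded_isomorphic_sym[OF gr(1,4) i(1)] i(2,3) gr(4,2,3,6,5) assms(4)] by blast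
  let ?l = "frag_of (bdf_class K R L')" and ?m = "frag_of (bdf_class K R M')" and ?n = "frag_of (bdf_class K R N')"
  have "?l - ?m + ?n \<in> exact_relations K R"
    unfolding exact_relations_def by (rule generate.incl) (use b ex in blast)
  then have "coset (?l + ?n) = coset ?m"
    using frag_of_closed b free_group_add by (subst coset_eq_iff) (auto simp: algebra_simps)
  then have "G0_class K R M' = G0_class K R L' \<otimes>\<^bsub>G0_BDF K R\<^esub> G0_class K R N'"
    using coset_add[OF frag_of_closed[OF b(1)] frag_of_closed[OF b(3)]] by (simp add: G0_class_eq_coset)
  then show ?thesis using G0_class_iso assms b i by metis
qed

text \<open>The alternating sums of Hilbert functions vanish on the relations.\<close>

lemma G0_class_hilbert:
  assumes M: "bdf_module K R M" and N: "bdf_module K R N" and eq: "G0_class K R M = G0_class K R N"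
  shows "hilbert M = hilbert N"
proof
  fix g
  \<comment> \<open>The value is read off an arbitrary member of the class; by
    \<open>hilbert_iso\<close> the choice does not matter.\<close>
  define h :: "('k, 'r, 'g) model set \<Rightarrow> int" where "h X = int (hilbert (SOME N. N \<in> X) g)" for X
  have h: "h (bdf_class K R L) = int (hilbert L g)" if "bdf_module K R L" for L :: "('r, 'z, 'g) graded_module"
  proof -
    have "\<exists>X :: ('k, 'r, 'g) model. X \<in> bdf_class K R L"
      using bdf_module_model[OF that] by (auto simp: bdf_class_def)
    then have "(SOME X. X \<in> bdf_class K R L) \<in> bdf_class K R L" by (rule someI_ex)
    then have "hilbert (SOME X. X \<in> bdf_class K R L) g = hilbert L g"
      using that hilbert_iso[OF bdf_grmod bdf_grmod, OF that _ _ bdf_fd] by (auto simp: bdf_class_def)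
    then show ?thesis by (simp add: h_def)
  qed
  \<comment> \<open>The free abelian group on the single element of the unit type serves as the
    integers, so \<open>F\<close> is the additive extension of the dimension in degree
    \<open>g\<close>.\<close>
  define F where "F = frag_extend (\<lambda>X. frag_cmul (h X) (frag_of ()))"
  have F_gen: "F (frag_of (bdf_class K R L) - frag_of (bdf_class K R M) + frag_of (bdf_class K R N)) = 0"
    if b: "bdf_module K R L" "bdf_module K R M" "bdf_module K R N" "short_exact R L \<phi> M \<psi> N"
    for L M N :: "('k, 'r, 'g) model" and \<phi> \<psi>
  proof -
    have "hilbert M g = hilbert L g + hilbert N g"
      using hilbert_exact[OF bdf_grmod bdf_grmod bdf_grmod, OF b bdf_fd bdf_fd, OF b(1) b(3)] .
    then show ?thesis
      using b by (simp add: F_def frag_extend_add frag_extend_diff h frag_cmul_diff_distrib[symmetric]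
        frag_cmul_distrib[symmetric])
  qed
  have F0: "F x = 0" if "x \<in> exact_relations K R" for x
    using that unfolding exact_relations_def
  proof (induction rule: generate.induct)
    case one
    then show ?case by (simp add: F_def)
  next
    case (incl x)
    then show ?case using F_gen by blast
  next
    case (inv x)
    then have "x \<in> carrier (bdf_free_group K R)"
      by (auto intro!: free_group_add free_group_diff frag_of_closed)
    moreover have "F x = 0" using inv F_gen by blast
    ultimately show ?case by (simp add: free_group_inv F_def frag_extend_minus)
  next
    case (eng x y)
    then show ?case by (simp add: F_def frag_extend_add)
  qed
  have "frag_of (bdf_class K R M) - frag_of (bdf_class K R N) \<in> exact_relations K R"
    using eq coset_eq_iff[OF frag_of_closed[OF M] frag_of_closed[OF N]] by (simp add: G0_class_eq_coset)
  from F0[OF this] show "hilbert M g = hilbert N g"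
    using M N by (simp add: F_def frag_extend_diff h frag_cmul_diff_distrib[symmetric])
qed

section \<open>The telescope\<close>

lemma tuples_inclusion:
  assumes "\<And>g. L g \<subseteq> L' g"
  shows "(\<lambda>t. t) \<in> graded_hom R (tuples M d L) (tuples M d L')"
proof -
  have sub: "carrier (tuples M d L) \<subseteq> carrier (tuples M d L')"
  proof
    fix t assume "t \<in> carrier (tuples M d L)"
    then show "t \<in> carrier (tuples M d L')" using assms unfolding tuples_carrier by blast
  qed
  then have "component (tuples M d L) g \<subseteq> component (tuples M d L') g" for g
    by (auto simp: tuples_def Let_def)
  with sub show ?thesis by (auto simp: graded_hom_def module_hom_def)
qed

text \<open>
  With \<open>ht g\<close> the number of degrees of \<open>M\<close> below \<open>g\<close>, let \<open>T\<close> be the direct sum over \<open>i\<close> of the submodules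
  of \<open>M\<close> of degrees of height at least \<open>i\<close>. Projection to place \<open>0\<close> has the kernel \<open>T'\<close>, projection of
  degree \<open>g\<close> to place \<open>ht g\<close> has the kernel \<open>T''\<close>, and \<open>T'\<close> is \<open>T''\<close> shifted by one place.
\<close>

lemma G0_class_triv:
  fixes M :: "('r, 'm, 'g) graded_module"
  assumes M: "bdf_module K R M"
  shows "G0_class K R M = G0_class K R (triv M)"
proof -
  interpret M: graded_module_over K R M by (rule bdf_grmod[OF M])
  define ht where "ht g = card {u \<in> support M. supp_le R u g}" for g
  have fin: "finite {u \<in> support M. supp_le R u g}" for g
    using M by (simp add: bdf_module_def downward_finite_def)
  have ht_mono: "ht g \<le> ht (q + g)" if "q \<in> support R" for g q
    unfolding ht_def using that supp_le_trans[of _ g "q + g"]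
    by (intro card_mono fin) (auto simp: supp_le_def)
  \<comment> \<open>Strictness needs \<open>q + g\<close> in the support: this degree is then
    counted at \<open>q + g\<close>, but not at \<open>g\<close>.\<close>
  have ht_strict: "ht g < ht (q + g)" if "q \<in> support R" "q \<noteq> 0" "q + g \<in> support M" for g q
    unfolding ht_def
  proof (rule psubset_card_mono[OF fin])
    have "\<not> supp_le R (q + g) g" using support_pointed[OF that(1)] that(2) by (auto simp: supp_le_def)
    then have "q + g \<in> {u \<in> support M. supp_le R u (q + g)} - {u \<in> support M. supp_le R u g}"
      using that(3) by simp
    moreover have "supp_le R g (q + g)" using that(1) by (simp add: supp_le_def)
    ultimately show "{u \<in> support M. supp_le R u g} \<subset> {u \<in> support M. supp_le R u (q + g)}"
      using supp_le_trans[of _ g "q + g"] by blast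
  qed
  have ht_pos: "0 < ht g" if "g \<in> support M" for g
    unfolding ht_def card_gt_0_iff using fin that by (auto intro!: exI[of _ g])
  let ?tup = "\<lambda>L. tuples M (\<lambda>_ :: nat. 0) L"
  obtain P where P: "finite P" "support M \<subseteq> upper P" using M by (auto simp: bdf_iff)
  have bdf: "bdf_module K R (?tup L)"
    if "\<And>g q i. i \<in> L g \<Longrightarrow> q \<in> support R \<Longrightarrow> i \<in> L (q + g)" "\<And>g. finite (L g)" for L
    by (rule bdf_tuples(1)[OF M _ _ P(1)]) (use that P(2) in auto)
  \<comment> \<open>Degree \<open>g\<close> of \<open>T\<close> consists of \<open>ht g + 1\<close>
    copies of degree \<open>g\<close> of \<open>M\<close>, a finite number however long the height
    filtration is.\<close>
  define T where "T = ?tup (\<lambda>g. {..ht g})"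
  define T1 where "T1 = ?tup (\<lambda>g. {1..ht g})"
  define T2 where "T2 = ?tup (\<lambda>g. {..<ht g})"
  have bT: "bdf_module K R T" "bdf_module K R T1" "bdf_module K R T2"
    unfolding T_def T1_def T2_def by (intro bdf; use ht_mono in \<open>fastforce intro: order.trans order.strict_trans2\<close>)+
  note gr = bdf_grmod[OF bT(1)] bdf_grmod[OF bT(2)] bdf_grmod[OF bT(3)] M.graded_module_over_axioms
    bdf_grmod[OF bdf_triv(1)[OF M]]
  have cT: "t \<in> component T g \<longleftrightarrow> (\<forall>i. t i \<in> component M g) \<and> (\<forall>i. t i \<noteq> \<zero>\<^bsub>M\<^esub> \<longrightarrow> i \<le> ht g)" for t g
  proof -
    have "finite {i. t i \<noteq> \<zero>\<^bsub>M\<^esub>}" if "\<forall>i. t i \<noteq> \<zero>\<^bsub>M\<^esub> \<longrightarrow> i \<le> ht g"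
      by (rule finite_subset[of _ "{..ht g}"]) (use that in auto)
    then show ?thesis unfolding T_def M.tuples_component by auto
  qed
  have cT1: "t \<in> component T1 g \<longleftrightarrow> t \<in> component T g \<and> t 0 = \<zero>\<^bsub>M\<^esub>" for t g
    unfolding T_def T1_def M.tuples_component by (auto simp: Suc_le_eq) (metis gr0I)
  have cT2: "t \<in> component T2 g \<longleftrightarrow> t \<in> component T g \<and> t (ht g) = \<zero>\<^bsub>M\<^esub>" for t g
    unfolding T_def T2_def M.tuples_component by (auto simp: less_le)
  have sT: "t \<oplus>\<^bsub>T\<^esub> u = (\<lambda>i. t i \<oplus>\<^bsub>M\<^esub> u i)" "a \<odot>\<^bsub>T\<^esub> t = (\<lambda>i. a \<odot>\<^bsub>M\<^esub> t i)" for t u a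
    by (simp_all add: T_def)
  have single: "(\<lambda>i. if i = j then m else \<zero>\<^bsub>M\<^esub>) \<in> component T g" if "m \<in> component M g" "j \<le> ht g" for m g j
    using that by (auto simp: cT)
  have "graded_isomorphic R T1 T2"
  proof (rule graded_isomorphicI[OF gr(2,3)])
    have suc: "finite {i. t (Suc i) \<noteq> \<zero>\<^bsub>M\<^esub>}" if "finite {i. t i \<noteq> \<zero>\<^bsub>M\<^esub>}" for t
      using finite_vimageI[OF that, of Suc] by (simp add: vimage_def)
    have comp: "(\<lambda>i. t (Suc i)) \<in> component T2 g" if "t \<in> component T1 g" for t g
      using that suc unfolding T1_def T2_def M.tuples_component by fastforce
    show "(\<lambda>t i. t (Suc i)) \<in> graded_hom R T1 T2"
    proof (rule graded_homI[OF gr(2,3)])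
      show "(\<lambda>i. t (Suc i)) \<in> carrier T2" if "t \<in> carrier T1" for t
        using that suc unfolding T1_def T2_def tuples_carrier by fastforce
    qed (use comp in \<open>auto simp: T1_def T2_def\<close>)
    show "bij_betw (\<lambda>t i. t (Suc i)) (component T1 g) (component T2 g)" for g
    proof (rule bij_betw_byWitness[where f' = "\<lambda>t. case_nat \<zero>\<^bsub>M\<^esub> t"])
      show "\<forall>t\<in>component T1 g. case_nat \<zero>\<^bsub>M\<^esub> (\<lambda>i. t (Suc i)) = t"
        using cT1 by (auto simp: fun_eq_iff split: nat.split)
      show "(\<lambda>t i. t (Suc i)) ` component T1 g \<subseteq> component T2 g" using comp by auto
      have "case_nat \<zero>\<^bsub>M\<^esub> t \<in> component T1 g" if "t \<in> component T2 g" for t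
        using that unfolding cT1 cT cT2 by (auto split: nat.split) (metis Suc_leI less_le)
      then show "(\<lambda>t. case_nat \<zero>\<^bsub>M\<^esub> t) ` component T2 g \<subseteq> component T1 g" by auto
    qed simp
  qed
  then have G12: "G0_class K R T1 = G0_class K R T2" using bT by (intro G0_class_iso)
  have "short_exact R T1 (\<lambda>t. t) T (\<lambda>t. t 0) M"
  proof (rule short_exact_degreewise[OF gr(2,1,4)])
    show "(\<lambda>t. t) \<in> graded_hom R T1 T" unfolding T_def T1_def by (rule tuples_inclusion) auto
    show "(\<lambda>t. t 0) \<in> graded_hom R T M"
      by (rule graded_homI[OF gr(1,4)]) (auto simp: cT T_def[symmetric] sT, auto simp: T_def tuples_carrier)
    show "component M g \<subseteq> (\<lambda>t. t 0) ` component T g" for g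
    proof
      fix m assume "m \<in> component M g"
      then show "m \<in> (\<lambda>t. t 0) ` component T g"
        by (intro image_eqI[of _ _ "\<lambda>i. if i = 0 then m else \<zero>\<^bsub>M\<^esub>"] single) auto
    qed
  qed (use cT1 in auto)
  then have E1: "G0_class K R T = G0_class K R T1 \<otimes>\<^bsub>G0_BDF K R\<^esub> G0_class K R M"
    using bT M by (intro G0_class_exact)
  obtain \<pi> where \<pi>: "\<pi> \<in> graded_hom R T (triv M)" "\<And>g t. t \<in> component T g \<Longrightarrow> \<pi> t = t (ht g)"
  proof (rule glue_degreewise[OF gr(1,5), of "\<lambda>g t. t (ht g)"])
    show "t (ht g) \<in> component (triv M) g" if "t \<in> component T g" for t g using that by (simp add: cT)
    show "(a \<odot>\<^bsub>T\<^esub> t) (ht (q + g)) = a \<odot>\<^bsub>triv M\<^esub> t (ht g)" if a: "a \<in> component R q" and t: "t \<in> component T g" for q g a t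
    proof (cases "q = 0")
      case True
      then show ?thesis using S.hp_homogeneous[of a q] a by (simp add: sT)
    next
      \<comment> \<open>A nonzero value would put \<open>q + g\<close> in the support, so the height
        would rise strictly from \<open>g\<close> to \<open>q + g\<close>; but \<open>t\<close> has
        no entry at a place above \<open>ht g\<close>.\<close>
      case False
      have tc: "t i \<in> carrier M" for i using t M.component_closed unfolding cT by blast
      have ac: "a \<in> carrier R" using a by (rule R_component_closed)
      have "a \<odot>\<^bsub>M\<^esub> t (ht (q + g)) = \<zero>\<^bsub>M\<^esub>"
      proof (rule ccontr)
        assume nz: "a \<odot>\<^bsub>M\<^esub> t (ht (q + g)) \<noteq> \<zero>\<^bsub>M\<^esub>"
        have "a \<noteq> \<zero>\<^bsub>R\<^esub>" using nz tc by auto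
        then have "q \<in> support R" using a component_R_trivial by blast
        moreover have "a \<odot>\<^bsub>M\<^esub> t (ht (q + g)) \<in> component M (q + g)"
          using M.component_smult[OF a] t unfolding cT by blast
        with nz have "q + g \<in> support M" by (auto simp: support_def)
        ultimately have "ht g < ht (q + g)" using False by (intro ht_strict)
        moreover have "t (ht (q + g)) \<noteq> \<zero>\<^bsub>M\<^esub>" using nz ac by auto
        ultimately show False using t unfolding cT by force
      qed
      then show ?thesis using S.hp_homogeneous[of a q] a False tc by (simp add: sT)
    qed
  qed (auto simp: cT sT)
  have "short_exact R T2 (\<lambda>t. t) T \<pi> (triv M)"
  proof (rule short_exact_degreewise[OF gr(3,1,5)])
    show "(\<lambda>t. t) \<in> graded_hom R T2 T" unfolding T_def T2_def by (rule tuples_inclusion) auto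
    show "(\<lambda>t. t) ` component T2 g = {t \<in> component T g. \<pi> t = \<zero>\<^bsub>triv M\<^esub>}" for g
      using \<pi>(2) by (auto simp: cT2)
    show "component (triv M) g \<subseteq> \<pi> ` component T g" for g
    proof
      fix m assume "m \<in> component (triv M) g"
      then have "(\<lambda>i. if i = ht g then m else \<zero>\<^bsub>M\<^esub>) \<in> component T g" by (intro single) auto
      moreover from \<pi>(2)[OF this] have "\<pi> (\<lambda>i. if i = ht g then m else \<zero>\<^bsub>M\<^esub>) = m" by simp
      ultimately show "m \<in> \<pi> ` component T g" by (intro image_eqI) auto
    qed
  qed (use \<pi> in auto)
  then have E2: "G0_class K R T = G0_class K R T2 \<otimes>\<^bsub>G0_BDF K R\<^esub> G0_class K R (triv M)"
    using bT bdf_triv(1)[OF M] by (intro G0_class_exact)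
  \<comment> \<open>Both sequences have the middle term \<open>T\<close>, and their kernels have the
    same class, which cancels in the group.\<close>
  show ?thesis
    using E1 E2 G12 G0_class_closed bT M bdf_triv(1)[OF M] by (metis G0.m_comm G0.right_cancel)
qed

text \<open>By \<open>G0_class_triv\<close> both modules may be replaced by their trivialised
  versions, which equal Hilbert functions make isomorphic.\<close>

theorem G0_class_eq_iff_hilbert:
  assumes "bdf_module K R M" "bdf_module K R N"
  shows "G0_class K R M = G0_class K R N \<longleftrightarrow> hilbert M = hilbert N"
proof
  assume "hilbert M = hilbert N"
  then have "G0_class K R (triv M) = G0_class K R (triv N)"
    using assms by (intro G0_class_iso bdf_triv triv_iso)
  then show "G0_class K R M = G0_class K R N"
    using G0_class_triv[OF assms(1)] G0_class_triv[OF assms(2)] by simp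
qed (rule G0_class_hilbert[OF assms])

end

section \<open>Direct sums\<close>

lemma direct_sum_simps [simp]:
  "carrier (direct_sum M N) = carrier M \<times> carrier N" "\<zero>\<^bsub>direct_sum M N\<^esub> = (\<zero>\<^bsub>M\<^esub>, \<zero>\<^bsub>N\<^esub>)"
  "(x, y) \<oplus>\<^bsub>direct_sum M N\<^esub> (x', y') = (x \<oplus>\<^bsub>M\<^esub> x', y \<oplus>\<^bsub>N\<^esub> y')"
  "a \<odot>\<^bsub>direct_sum M N\<^esub> (x, y) = (a \<odot>\<^bsub>M\<^esub> x, a \<odot>\<^bsub>N\<^esub> y)"
  "component (direct_sum M N) g = component M g \<times> component N g"
  by (simp_all add: direct_sum_def)

lemma module_direct_sum:
  assumes "module R M" "module R N"
  shows "module R (direct_sum M N)"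
proof -
  interpret M: module R M by fact
  interpret N: module R N by fact
  have "abelian_group (direct_sum M N)"
  proof (rule abelian_groupI)
    fix z assume "z \<in> carrier (direct_sum M N)"
    then show "\<exists>w\<in>carrier (direct_sum M N). w \<oplus>\<^bsub>direct_sum M N\<^esub> z = \<zero>\<^bsub>direct_sum M N\<^esub>"
      by (intro bexI[of _ "(\<ominus>\<^bsub>M\<^esub> fst z, \<ominus>\<^bsub>N\<^esub> snd z)"]) (auto simp: M.M.l_neg N.M.l_neg)
  qed (auto simp: M.M.a_ac N.M.a_ac)
  then show ?thesis
    by (intro moduleI M.R.is_cring)
      (auto simp: M.smult_l_distr M.smult_r_distr M.smult_assoc1 N.smult_l_distr N.smult_r_distr N.smult_assoc1)
qed

lemma module_hom_direct_sum:
  assumes "module R M" "module R N"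
  shows "fst \<in> module_hom R (direct_sum M N) M" "snd \<in> module_hom R (direct_sum M N) N"
    and "(\<lambda>x. (x, \<zero>\<^bsub>N\<^esub>)) \<in> module_hom R M (direct_sum M N)"
    and "(\<lambda>y. (\<zero>\<^bsub>M\<^esub>, y)) \<in> module_hom R N (direct_sum M N)"
proof -
  interpret M: module R M by fact
  interpret N: module R N by fact
  show "fst \<in> module_hom R (direct_sum M N) M" "snd \<in> module_hom R (direct_sum M N) N"
    "(\<lambda>x. (x, \<zero>\<^bsub>N\<^esub>)) \<in> module_hom R M (direct_sum M N)" "(\<lambda>y. (\<zero>\<^bsub>M\<^esub>, y)) \<in> module_hom R N (direct_sum M N)"
    by (auto simp: module_hom_def)
qed

lemma module_hom_compose:
  "\<lbrakk>f \<in> module_hom R L M; h \<in> module_hom R M N\<rbrakk> \<Longrightarrow> (\<lambda>x. h (f x)) \<in> module_hom R L N"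
  by (auto simp: module_hom_def Pi_iff)

lemma module_homD:
  assumes "f \<in> module_hom R M N"
  shows "\<lbrakk>x \<in> carrier M; y \<in> carrier M\<rbrakk> \<Longrightarrow> f (x \<oplus>\<^bsub>M\<^esub> y) = f x \<oplus>\<^bsub>N\<^esub> f y"
    and "\<lbrakk>a \<in> carrier R; x \<in> carrier M\<rbrakk> \<Longrightarrow> f (a \<odot>\<^bsub>M\<^esub> x) = a \<odot>\<^bsub>N\<^esub> f x"
  using assms by (auto simp: module_hom_def)

text \<open>A homomorphism out of the sum is lifted on each summand. The test modules for the sum
  live on other types than those in the hypotheses, hence the use of
  \<open>projective_module_lift\<close>.\<close>

lemma projective_direct_sum:
  fixes R :: "('r, 's) ring_scheme" and M :: "('r, 'm, 'g) graded_module" and N :: "('r, 'n, 'g) graded_module"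
  assumes "projective_module R M" "projective_module R N"
  shows "projective_module R (direct_sum M N)"
  unfolding projective_module_def
proof (intro conjI allI impI)
  have mods: "module R M" "module R N" using assms by (auto simp: projective_module_def)
  interpret M: module R M by (rule mods)
  interpret N: module R N by (rule mods)
  show "module R (direct_sum M N)" by (rule module_direct_sum[OF mods])
  fix X :: "('r, 'm \<times> 'n \<Rightarrow> 'r) module" and Y :: "('r, 'm \<times> 'n) module" and p f
  assume as: "module R X \<and> module R Y \<and> p \<in> module_hom R X Y \<and> p ` carrier X = carrier Y \<and>
    f \<in> module_hom R (direct_sum M N) Y"
  then interpret X: module R X by simp
  from as interpret Y: module R Y by simp
  note i = module_hom_direct_sum(3,4)[OF mods]
  have "(\<lambda>x. f (x, \<zero>\<^bsub>N\<^esub>)) \<in> module_hom R M Y" "(\<lambda>y. f (\<zero>\<^bsub>M\<^esub>, y)) \<in> module_hom R N Y"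
    using as module_hom_compose[OF i(1)] module_hom_compose[OF i(2)] by blast+
  then obtain h k where h: "h \<in> module_hom R M X" "\<And>x. x \<in> carrier M \<Longrightarrow> p (h x) = f (x, \<zero>\<^bsub>N\<^esub>)"
    and k: "k \<in> module_hom R N X" "\<And>y. y \<in> carrier N \<Longrightarrow> p (k y) = f (\<zero>\<^bsub>M\<^esub>, y)"
    using projective_module_lift[OF assms(1), of X Y p "\<lambda>x. f (x, \<zero>\<^bsub>N\<^esub>)"]
      projective_module_lift[OF assms(2), of X Y p "\<lambda>y. f (\<zero>\<^bsub>M\<^esub>, y)"] as by auto
  note hk = h(1)[unfolded module_hom_def] k(1)[unfolded module_hom_def]
  let ?l = "\<lambda>(x, y). h x \<oplus>\<^bsub>X\<^esub> k y"
  have "?l \<in> module_hom R (direct_sum M N) X"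
    using hk by (auto simp: module_hom_def Pi_iff X.M.a_ac X.smult_r_distr)
  moreover have "p (?l z) = f z" if zD: "z \<in> carrier (direct_sum M N)" for z
  proof -
    obtain x y where z: "z = (x, y)" "x \<in> carrier M" "y \<in> carrier N" using zD by auto
    have "p (h x \<oplus>\<^bsub>X\<^esub> k y) = p (h x) \<oplus>\<^bsub>Y\<^esub> p (k y)"
      using as z module_hom_closed[OF h(1)] module_hom_closed[OF k(1)] by (simp add: module_hom_def)
    also have "\<dots> = f (x, \<zero>\<^bsub>N\<^esub>) \<oplus>\<^bsub>Y\<^esub> f (\<zero>\<^bsub>M\<^esub>, y)" using z h k by simp
    also have "\<dots> = f ((x, \<zero>\<^bsub>N\<^esub>) \<oplus>\<^bsub>direct_sum M N\<^esub> (\<zero>\<^bsub>M\<^esub>, y))"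
    proof -
      have "(x, \<zero>\<^bsub>N\<^esub>) \<in> carrier (direct_sum M N)" "(\<zero>\<^bsub>M\<^esub>, y) \<in> carrier (direct_sum M N)" using z by auto
      then show ?thesis using module_homD(1)[of f R "direct_sum M N" Y "(x, \<zero>\<^bsub>N\<^esub>)" "(\<zero>\<^bsub>M\<^esub>, y)"] as by simp
    qed
    finally show ?thesis using z by simp
  qed
  ultimately show "\<exists>h\<in>module_hom R (direct_sum M N) X. \<forall>x\<in>carrier (direct_sum M N). p (h x) = f x"
    by blast
qed

context pdcf_algebra begin

lemma grmod_direct_sum:
  assumes "grmod M" "grmod N"
  shows "grmod (direct_sum M N)"
proof -
  interpret M: graded_module_over K R M by fact
  interpret N: graded_module_over K R N by fact
  let ?D = "direct_sum M N"
  have mod: "module R ?D" by (rule module_direct_sum) (rule M.module_M N.module_M)+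
  interpret D: module R ?D by (rule mod)
  note pr = module_hom_direct_sum(1,2)[OF M.module_M N.module_M]
  let ?H = "\<lambda>z g. (hp M (fst z) g, hp N (snd z) g)"
  show ?thesis
  proof (rule graded_moduleI(2)[OF mod, of ?H])
    fix z assume "z \<in> carrier ?D"
    then have z: "fst z \<in> carrier M" "snd z \<in> carrier N" by auto
    let ?G = "{g. ?H z g \<noteq> \<zero>\<^bsub>?D\<^esub>}"
    have G: "?G = {g. hp M (fst z) g \<noteq> \<zero>\<^bsub>M\<^esub>} \<union> {g. hp N (snd z) g \<noteq> \<zero>\<^bsub>N\<^esub>}" by auto
    show fin: "finite ?G" unfolding G using z M.hp_finite N.hp_finite by auto
    have c: "?H z \<in> ?G \<rightarrow> carrier ?D" using z by auto
    have "fst (\<Oplus>\<^bsub>?D\<^esub>g\<in>?G. ?H z g) = fst z"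
      using module_hom_finsum[OF mod M.module_M pr(1) fin c] M.hp_sum_superset[OF z(1) fin] by auto
    moreover have "snd (\<Oplus>\<^bsub>?D\<^esub>g\<in>?G. ?H z g) = snd z"
      using module_hom_finsum[OF mod N.module_M pr(2) fin c] N.hp_sum_superset[OF z(2) fin] by auto
    ultimately show "(\<Oplus>\<^bsub>?D\<^esub>g\<in>?G. ?H z g) = z" by (simp add: prod_eq_iff)
  qed (auto simp: M.component_closed N.component_closed M.component_add N.component_add
      M.component_smult N.component_smult M.hp_component N.hp_component M.hp_add N.hp_add
      M.hp_homogeneous N.hp_homogeneous)
qed

lemma short_exact_direct_sum:
  assumes "grmod M" "grmod N"
  shows "short_exact R M (\<lambda>x. (x, \<zero>\<^bsub>N\<^esub>)) (direct_sum M N) snd N"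
proof -
  interpret M: graded_module_over K R M by fact
  interpret N: graded_module_over K R N by fact
  note h = module_hom_direct_sum[OF M.module_M N.module_M]
  show ?thesis unfolding short_exact_def graded_hom_def
    using h(2,3) by (auto simp: inj_on_def image_iff)
qed

lemma bdf_direct_sum:
  assumes "bdf_module K R M" "bdf_module K R N"
  shows "bdf_module K R (direct_sum M N)" "hilbert (direct_sum M N) g = hilbert M g + hilbert N g"
proof -
  note gr = bdf_grmod[OF assms(1)] bdf_grmod[OF assms(2)]
  note grD = grmod_direct_sum[OF gr]
  interpret D: graded_module_over K R "direct_sum M N" by (rule grD)
  note d = component_exact_has_dim[OF gr(1) grD gr(2) short_exact_direct_sum[OF gr]
      bdf_fd[OF assms(1)] bdf_fd[OF assms(2)]]
  show "hilbert (direct_sum M N) g = hilbert M g + hilbert N g" by (rule hilbert_eq[OF grD d])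
  have "finite_dimensional K (restrict_scalars R (direct_sum M N)) (component (direct_sum M N) g)" for g
    by (rule has_dim_finite_dimensional[OF D.V.kspace_axioms d]) (use D.component_closed in auto)
  moreover obtain P P' where "finite P" "support M \<subseteq> upper P" "finite P'" "support N \<subseteq> upper P'"
    using assms by (auto simp: bdf_iff)
  moreover have "support (direct_sum M N) \<subseteq> support M \<union> support N" by (auto simp: support_def)
  ultimately have "finite (P \<union> P')" "support (direct_sum M N) \<subseteq> upper (P \<union> P')"
      "\<And>g. finite_dimensional K (restrict_scalars R (direct_sum M N)) (component (direct_sum M N) g)"
    using upper_mono[of P "P \<union> P'"] upper_mono[of P' "P \<union> P'"] by blast+
  then show "bdf_module K R (direct_sum M N)" unfolding bdf_iff using grD by blast
qed

lemma G0_class_direct_sum: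
  assumes "bdf_module K R M" "bdf_module K R N"
  shows "G0_class K R (direct_sum M N) = G0_class K R M \<otimes>\<^bsub>G0_BDF K R\<^esub> G0_class K R N"
  by (rule G0_class_exact[OF assms(1) bdf_direct_sum(1)[OF assms] assms(2)
      short_exact_direct_sum[OF bdf_grmod bdf_grmod]]) (rule assms)+

lemma direct_sum_iso:
  assumes "graded_isomorphic R M M'" "graded_isomorphic R N N'"
  shows "graded_isomorphic R (direct_sum M N) (direct_sum M' N')"
proof -
  obtain \<phi> \<psi> where \<phi>: "\<phi> \<in> graded_hom R M M'" "bij_betw \<phi> (carrier M) (carrier M')"
    and \<psi>: "\<psi> \<in> graded_hom R N N'" "bij_betw \<psi> (carrier N) (carrier N')"
    using assms by (auto simp: graded_isomorphic_def)
  have "map_prod \<phi> \<psi> \<in> graded_hom R (direct_sum M N) (direct_sum M' N')"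
    using \<phi>(1) \<psi>(1) by (auto simp: graded_hom_def module_hom_def image_subset_iff)
  moreover have "bij_betw (map_prod \<phi> \<psi>) (carrier (direct_sum M N)) (carrier (direct_sum M' N'))"
    using bij_betw_map_prod[OF \<phi>(2) \<psi>(2)] by (simp add: map_prod_def)
  ultimately show ?thesis by (auto simp: graded_isomorphic_def)
qed

section \<open>Free modules\<close>

text \<open>Induction on the number of elements of \<open>upper P\<close> below \<open>g\<close>.
  The hypothesis covers predecessors in \<open>upper P\<close> only, while \<open>g\<close> is
  arbitrary; a degree outside \<open>upper P\<close> has no such predecessors.\<close>

lemma upper_induct [consumes 1, case_names less]:
  assumes "finite P" and "\<And>g. (\<And>h. h \<in> upper P \<Longrightarrow> supp_le R h g \<Longrightarrow> h \<noteq> g \<Longrightarrow> Q h) \<Longrightarrow> Q g"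
  shows "Q g"
proof (induction "card {u \<in> upper P. supp_le R u g}" arbitrary: g rule: less_induct)
  case less
  show ?case
  proof (rule assms(2))
    fix h assume h: "h \<in> upper P" "supp_le R h g" "h \<noteq> g"
    have "g \<in> {u \<in> upper P. supp_le R u g} - {u \<in> upper P. supp_le R u h}"
      using h upper_supp_le supp_le_antisym by auto
    then have "{u \<in> upper P. supp_le R u h} \<subset> {u \<in> upper P. supp_le R u g}"
      using supp_le_trans[OF _ h(2)] by blast
    from psubset_card_mono[OF upper_downward_finite[OF assms(1)] this] show "Q h" by (rule less)
  qed
qed

lemma bdf_self: "bdf_module K R (self_module R)"
proof -
  have fs: "finsum (self_module R) = finsum R"
    by (rule finsum_cong_record) (auto simp: self_module_def)
  have "finite_dimensional K (restrict_scalars R (self_module R)) (component R g)" for g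
  proof -
    have "finite_dimensional K R (component R g)" using pdcf by (simp add: pdcf_def)
    then obtain B where B: "finite B" "B \<subseteq> component R g"
      "\<forall>w\<in>component R g. \<exists>c\<in>B \<rightarrow> carrier K. w = (\<Oplus>\<^bsub>R\<^esub>b\<in>B. c b \<odot>\<^bsub>R\<^esub> b)"
      unfolding finite_dimensional_def by blast
    have Bc: "b \<in> carrier R" if "b \<in> B" for b using B(2) that R_component_closed by blast
    have eq: "(\<Oplus>\<^bsub>R\<^esub>b\<in>B. c b \<odot>\<^bsub>R\<^esub> b) = (\<Oplus>\<^bsub>R\<^esub>b\<in>B. (c b \<odot>\<^bsub>R\<^esub> \<one>\<^bsub>R\<^esub>) \<otimes>\<^bsub>R\<^esub> b)" if "c \<in> B \<rightarrow> carrier K" for c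
      using that Bc by (intro R.finsum_cong') (auto simp: smult_eq_scalar_mult Pi_iff)
    have "\<exists>c\<in>B \<rightarrow> carrier K. w = (\<Oplus>\<^bsub>R\<^esub>b\<in>B. (c b \<odot>\<^bsub>R\<^esub> \<one>\<^bsub>R\<^esub>) \<otimes>\<^bsub>R\<^esub> b)" if w: "w \<in> component R g" for w
    proof -
      obtain c where c: "c \<in> B \<rightarrow> carrier K" "w = (\<Oplus>\<^bsub>R\<^esub>b\<in>B. c b \<odot>\<^bsub>R\<^esub> b)" using bspec[OF B(3) w] by blast
      then show ?thesis unfolding eq[OF c(1)] by blast
    qed
    then show ?thesis unfolding finite_dimensional_def using B(1,2)
      by (intro exI[of _ B]) (simp only: restrict_scalars_simps self_module_simps fs simp_thms, blast)
  qed
  moreover have "support (self_module R) \<subseteq> upper {0}" by (auto simp: support_def upper_def supp_le_def)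
  ultimately show ?thesis using S.graded_module_over_axioms by (auto simp: bdf_iff)
qed

lemma support_self [simp]: "support (self_module R) = support R"
  by (simp add: support_def)

text \<open>This is connectedness. The value is the diagonal entry of the triangular system between
  multiplicities and Hilbert functions.\<close>

lemma hilbert_self_0: "hilbert (self_module R) 0 = 1"
proof (rule hilbert_eq[OF S.graded_module_over_axioms])
  have comb: "S.V.comb 1 c (\<lambda>_. \<one>\<^bsub>R\<^esub>) = c 0 \<odot>\<^bsub>R\<^esub> \<one>\<^bsub>R\<^esub>" if "c 0 \<in> carrier K" for c
    using that unfolding One_nat_def by (subst S.V.comb_Suc) auto
  have "S.V.rel_basis {\<zero>\<^bsub>restrict_scalars R (self_module R)\<^esub>} (component (self_module R) 0) 1 (\<lambda>_. \<one>\<^bsub>R\<^esub>)"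
    unfolding S.V.rel_basis_def
  proof (intro conjI ballI allI impI)
    fix w assume "w \<in> component (self_module R) 0"
    then obtain k where k: "k \<in> carrier K" "w = k \<odot>\<^bsub>R\<^esub> \<one>\<^bsub>R\<^esub>" by (auto simp: component_0)
    then show "\<exists>c. (\<forall>i<1. c i \<in> carrier K) \<and> (\<exists>u\<in>{\<zero>\<^bsub>restrict_scalars R (self_module R)\<^esub>}.
        w = u \<oplus>\<^bsub>restrict_scalars R (self_module R)\<^esub> S.V.comb 1 c (\<lambda>_. \<one>\<^bsub>R\<^esub>))"
      using comb[of "\<lambda>_. k"] by (intro exI[of _ "\<lambda>_. k"]) auto
  next
    fix c and i :: nat
    assume c: "\<forall>i<1. c i \<in> carrier K" "S.V.comb 1 c (\<lambda>_. \<one>\<^bsub>R\<^esub>) \<in> {\<zero>\<^bsub>restrict_scalars R (self_module R)\<^esub>}" and i: "i < 1"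
    have z: "c 0 \<odot>\<^bsub>R\<^esub> \<one>\<^bsub>R\<^esub> = \<zero>\<^bsub>R\<^esub>" using c comb[of c] by simp
    have "c 0 = \<zero>\<^bsub>K\<^esub>"
    proof (rule ccontr)
      assume "c 0 \<noteq> \<zero>\<^bsub>K\<^esub>"
      then have u: "c 0 \<in> Units K" using c by (simp add: K.field_Units)
      then have "\<one>\<^bsub>R\<^esub> = (inv\<^bsub>K\<^esub> (c 0) \<otimes>\<^bsub>K\<^esub> c 0) \<odot>\<^bsub>R\<^esub> \<one>\<^bsub>R\<^esub>" by simp
      also have "\<dots> = inv\<^bsub>K\<^esub> (c 0) \<odot>\<^bsub>R\<^esub> (c 0 \<odot>\<^bsub>R\<^esub> \<one>\<^bsub>R\<^esub>)" using u c by (subst A.smult_assoc1) auto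
      also have "\<dots> = \<zero>\<^bsub>R\<^esub>" using u by (simp add: z)
      finally show False using R.one_not_zero by simp
    qed
    then show "c i = \<zero>\<^bsub>K\<^esub>" using i by simp
  qed (simp add: one_component)
  then show "S.V.has_dim (component (self_module R) 0) 1" unfolding S.V.has_dim_def by blast
qed

text \<open>The place \<open>(h, n)\<close> stands for the basis element number \<open>n\<close> of
  degree \<open>h\<close>, of which there are \<open>c h\<close>; it is allowed in every degree. In
  degree \<open>g\<close> its entry is an element of \<open>R\<close> of degree
  \<open>g - h\<close>.\<close>

definition free :: "('g \<Rightarrow> nat) \<Rightarrow> ('r, 'g \<times> nat \<Rightarrow> 'r, 'g) graded_module"
  where "free c = tuples (self_module R) fst (\<lambda>_. {i. snd i < c (fst i)})"

text \<open>A basis element of degree \<open>h\<close> contributes the dimension of \<open>R\<close>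
  in degree \<open>g - h\<close>, so the Hilbert function is the convolution of \<open>c\<close>
  with that of \<open>R\<close>. The part of \<open>upper P\<close> below \<open>g\<close> is a
  finite range of summation; elsewhere \<open>c\<close> or the component of \<open>R\<close>
  vanishes.\<close>

lemma
  assumes P: "finite P" "{h. c h \<noteq> 0} \<subseteq> upper P"
  shows bdf_free: "bdf_module K R (free c)"
    and hilbert_free: "hilbert (free c) g =
      (\<Sum>h\<in>{u \<in> upper P. supp_le R u g}. c h * hilbert (self_module R) (g - h))"
proof -
  let ?L = "{i. snd i < c (fst i)} :: ('g \<times> nat) set"
  have Sig: "{i \<in> ?L. g - fst i \<in> support (self_module R)} =
    (SIGMA h:{u \<in> upper P. supp_le R u g}. {..<c h})" for g
    using P(2) by (auto simp: supp_le_def)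
  have fin: "finite {i \<in> ?L. g - fst i \<in> support (self_module R)}" for g
    unfolding Sig using upper_downward_finite[OF P(1)] by blast
  have up: "g \<in> upper P" if "i \<in> ?L" "g - fst i \<in> support (self_module R)" for g i
  proof (rule upper_supp_le)
    show "fst i \<in> upper P" using that(1) P(2) by fastforce
    show "supp_le R (fst i) g" using that(2) by (simp add: supp_le_def)
  qed
  show "bdf_module K R (free c)" unfolding free_def
    by (rule bdf_tuples(1)[OF bdf_self, where P = P]) (fact fin P(1) up | assumption)+
  have "hilbert (free c) g = (\<Sum>i\<in>(SIGMA h:{u \<in> upper P. supp_le R u g}. {..<c h}).
      hilbert (self_module R) (g - fst i))"
    unfolding free_def Sig[symmetric]
    by (rule bdf_tuples(2)[OF bdf_self, where P = P]) (fact fin P(1) up | assumption)+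
  also have "\<dots> = (\<Sum>h\<in>{u \<in> upper P. supp_le R u g}. \<Sum>n<c h. hilbert (self_module R) (g - h))"
    using upper_downward_finite[OF P(1)] by (subst sum.Sigma) (auto simp: case_prod_beta)
  finally show "hilbert (free c) g = (\<Sum>h\<in>{u \<in> upper P. supp_le R u g}. c h * hilbert (self_module R) (g - h))"
    by simp
qed

text \<open>Convolution with the Hilbert function of \<open>R\<close> is triangular with diagonal 1:
  the terms strictly below \<open>g\<close> agree by induction, and what remains is the multiplicity
  at \<open>g\<close>.\<close>

lemma hilbert_free_inject:
  assumes P: "finite P" "{h. c h \<noteq> 0} \<subseteq> upper P" "{h. d h \<noteq> 0} \<subseteq> upper P"
    and eq: "hilbert (free c) = hilbert (free d)"
  shows "c = d"
proof
  fix g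
  show "c g = d g" using P(1)
  proof (induction g rule: upper_induct)
    case (less g)
    show ?case
    proof (cases "g \<in> upper P")
      case False
      then have "c g = 0" "d g = 0" using P(2,3) by blast+
      then show ?thesis by simp
    next
      case True
      let ?A = "{u \<in> upper P. supp_le R u g}"
      have A: "finite ?A" "g \<in> ?A" using True upper_downward_finite[OF P(1)] by auto
      have split: "hilbert (free e) g = e g + (\<Sum>h\<in>?A - {g}. e h * hilbert (self_module R) (g - h))"
        if "{h. e h \<noteq> 0} \<subseteq> upper P" for e
        using hilbert_free[OF P(1) that, of g] sum.remove[OF A, of "\<lambda>h. e h * hilbert (self_module R) (g - h)"]
        by (simp add: hilbert_self_0)
      have "(\<Sum>h\<in>?A - {g}. c h * hilbert (self_module R) (g - h)) = (\<Sum>h\<in>?A - {g}. d h * hilbert (self_module R) (g - h))"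
        using less by (intro sum.cong) auto
      then show ?thesis using split[OF P(2)] split[OF P(3)] eq by simp
    qed
  qed
qed

text \<open>The multiplicities of a virtual free resolution are obtained by dividing by the Hilbert function of \<open>R\<close>.\<close>

lemma virtual_resolution:
  assumes M: "bdf_module K R M"
  obtains P a b where "finite P" "{h. a h \<noteq> 0} \<subseteq> upper P" "{h. b h \<noteq> 0} \<subseteq> upper P"
    "\<And>g. hilbert M g + hilbert (free b) g = hilbert (free a) g"
proof -
  obtain P where P: "finite P" "support M \<subseteq> upper P" using M by (auto simp: bdf_iff)
  define A where "A g = {u \<in> upper P. supp_le R u g}" for g
  have fin: "finite (A g)" for g using upper_downward_finite[OF P(1)] by (simp add: A_def)
  \<comment> \<open>This relates each degree in \<open>upper P\<close> to the strictly smaller ones;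
    the number of predecessors shows that recursion along it is well founded.\<close>
  define r where "r = {(h, g). g \<in> upper P \<and> h \<in> A g \<and> h \<noteq> g}"
  have "r \<subseteq> measure (\<lambda>g. card (A g))"
  proof (clarsimp simp: r_def)
    fix h g assume *: "g \<in> upper P" "h \<in> A g" "h \<noteq> g"
    then have "g \<in> A g - A h" using supp_le_antisym by (auto simp: A_def)
    moreover have "A h \<subseteq> A g" using * supp_le_trans by (auto simp: A_def)
    ultimately have "A h \<subset> A g" by blast
    then show "card (A h) < card (A g)" by (rule psubset_card_mono[OF fin])
  qed
  then have wf: "wf r" by (rule wf_subset[OF wf_measure])
  \<comment> \<open>The equation for degree \<open>g\<close> is solved for \<open>z g\<close>, whose
    coefficient is \<open>hilbert (self_module R) 0\<close>, that is 1. The value 0 is imposed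
    outside \<open>upper P\<close>, which confines both multiplicities to this set.\<close>
  have "\<exists>z. \<forall>g. z g = (if g \<in> upper P
      then int (hilbert M g) - (\<Sum>h\<in>A g - {g}. z h * int (hilbert (self_module R) (g - h))) else 0)"
    using wf
  proof (rule dependent_wf_choice)
    fix f f' :: "'g \<Rightarrow> int" and g x assume "\<And>h. (h, g) \<in> r \<Longrightarrow> f h = f' h"
    then show "(x = (if g \<in> upper P
        then int (hilbert M g) - (\<Sum>h\<in>A g - {g}. f h * int (hilbert (self_module R) (g - h))) else 0)) =
      (x = (if g \<in> upper P
        then int (hilbert M g) - (\<Sum>h\<in>A g - {g}. f' h * int (hilbert (self_module R) (g - h))) else 0))"
      by (auto simp: r_def intro!: sum.cong)
  qed simp
  then obtain z where z: "\<And>g. z g = (if g \<in> upper P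
      then int (hilbert M g) - (\<Sum>h\<in>A g - {g}. z h * int (hilbert (self_module R) (g - h))) else 0)" by blast
  have H: "int (hilbert M g) = (\<Sum>h\<in>A g. z h * int (hilbert (self_module R) (g - h)))" for g
  proof (cases "g \<in> upper P")
    case True
    then have "g \<in> A g" by (simp add: A_def)
    then show ?thesis using z[of g] True sum.remove[OF fin, of g g "\<lambda>h. z h * int (hilbert (self_module R) (g - h))"]
      by (simp add: hilbert_self_0)
  next
    case False
    then have "A g = {}" using upper_supp_le by (auto simp: A_def)
    moreover have "hilbert M g = 0" using False P(2) hilbert_zero_iff[OF M] by blast
    ultimately show ?thesis by simp
  qed
  let ?a = "\<lambda>h. nat (z h)" and ?b = "\<lambda>h. nat (- z h)"
  have sup: "{h. ?a h \<noteq> 0} \<subseteq> upper P" "{h. ?b h \<noteq> 0} \<subseteq> upper P" using z by (auto split: if_splits)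
  have "hilbert M g + hilbert (free ?b) g = hilbert (free ?a) g" for g
  proof -
    have "int (hilbert (free ?a) g) - int (hilbert (free ?b) g) =
      (\<Sum>h\<in>A g. int (?a h * hilbert (self_module R) (g - h)) - int (?b h * hilbert (self_module R) (g - h)))"
      unfolding hilbert_free[OF P(1) sup(1)] hilbert_free[OF P(1) sup(2)] A_def[symmetric]
      by (simp add: sum_subtractf)
    also have "\<dots> = int (hilbert M g)"
      unfolding H by (intro sum.cong) (auto simp: left_diff_distrib[symmetric])
    finally show ?thesis by linarith
  qed
  with P(1) sup show thesis by (rule that)
qed

end

section \<open>Projective modules\<close>

lemma (in graded_module_over) component_minus:
  assumes "x \<in> component M g"
  shows "\<ominus>\<^bsub>M\<^esub> x \<in> component M g"
proof -
  have "(\<ominus>\<^bsub>K\<^esub> \<one>\<^bsub>K\<^esub>) \<odot>\<^bsub>R\<^esub> \<one>\<^bsub>R\<^esub> = \<ominus>\<^bsub>R\<^esub> \<one>\<^bsub>R\<^esub>" by (simp add: A.smult_l_minus)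
  then show ?thesis
    using component_scalar[OF _ assms, of "\<ominus>\<^bsub>K\<^esub> \<one>\<^bsub>K\<^esub>"] component_closed[OF assms] by (simp add: M.smult_l_minus)
qed

section \<open>Bases and projectivity of graded free modules, and the graded Nakayama
  argument\<close>

context pdcf_algebra begin

declare split_paired_All [simp del] split_paired_Ex [simp del]

abbreviation places :: "('g \<Rightarrow> nat) \<Rightarrow> ('g \<times> nat) set"
  where "places c \<equiv> {i. snd i < c (fst i)}"

definition unit_tuple :: "'g \<times> nat \<Rightarrow> 'g \<times> nat \<Rightarrow> 'r"
  where "unit_tuple i = (\<lambda>j. if j = i then \<one>\<^bsub>R\<^esub> else \<zero>\<^bsub>R\<^esub>)"

lemma grmod_free: "grmod (free c)"
  unfolding free_def by (rule S.grmod_tuples)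

lemma free_simps [simp]:
  "\<zero>\<^bsub>free c\<^esub> = (\<lambda>_. \<zero>\<^bsub>R\<^esub>)" "t \<oplus>\<^bsub>free c\<^esub> u = (\<lambda>i. t i \<oplus>\<^bsub>R\<^esub> u i)" "a \<odot>\<^bsub>free c\<^esub> t = (\<lambda>i. a \<otimes>\<^bsub>R\<^esub> t i)"
  by (simp_all add: free_def)

lemma component_free:
  "t \<in> component (free c) g \<longleftrightarrow> finite {i. t i \<noteq> \<zero>\<^bsub>R\<^esub>} \<and> (\<forall>i. t i \<in> component R (g - fst i)) \<and>
    (\<forall>i. t i \<noteq> \<zero>\<^bsub>R\<^esub> \<longrightarrow> i \<in> places c)"
  unfolding free_def S.tuples_component by simp

lemma carrier_free:
  "t \<in> carrier (free c) \<longleftrightarrow> finite {i. t i \<noteq> \<zero>\<^bsub>R\<^esub>} \<and> (\<forall>i. t i \<in> carrier R) \<and> (\<forall>i. t i \<noteq> \<zero>\<^bsub>R\<^esub> \<longrightarrow> i \<in> places c)"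
proof -
  have "(\<forall>g. hp (self_module R) x g = \<zero>\<^bsub>R\<^esub>) \<longleftrightarrow> x = \<zero>\<^bsub>R\<^esub>" if "x \<in> carrier R" for x
    using S.hp_eqI[of x "\<zero>\<^bsub>R\<^esub>"] S.hp_zero that by (metis R.zero_closed self_module_simps(1,2))
  then show ?thesis unfolding free_def tuples_carrier by auto
qed

text \<open>Every place is allowed in every degree, so forgetting the grading leaves the ungraded
  free module on the places, and linear extension by \<open>free_lin\<close> can be reused.\<close>

lemma carrier_free_module: "carrier (free c) = carrier (free_module R (places c))"
proof -
  have "t \<in> carrier (free c) \<longleftrightarrow> t \<in> carrier (free_module R (places c))" for t
    unfolding carrier_free free_module_def by (simp add: image_subset_iff subset_iff[of "Collect _"]) blast
  then show ?thesis by blast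
qed

lemma free_lin_free_hom:
  assumes "module R N" "b \<in> places c \<rightarrow> carrier N"
  shows "free_lin R N b \<in> module_hom R (free c) N"
  using free_lin_hom[OF assms] unfolding module_hom_def carrier_free_module
  by (auto simp: free_module_def)

lemma unit_tuple_component: "i \<in> places c \<Longrightarrow> unit_tuple i \<in> component (free c) (fst i)"
  by (auto simp: component_free unit_tuple_def one_component R_component_zero)

lemma unit_tuple_closed: "i \<in> places c \<Longrightarrow> unit_tuple i \<in> carrier (free c)"
  using unit_tuple_component graded_module_over.component_closed[OF grmod_free] by blast

lemma free_lin_unit_tuple:
  assumes "module R N" "b \<in> places c \<rightarrow> carrier N" "i \<in> places c"
  shows "free_lin R N b (unit_tuple i) = b i"
proof -
  interpret N: module R N by fact
  have "{j. unit_tuple i j \<noteq> \<zero>\<^bsub>R\<^esub>} = {i}" using R.one_not_zero by (auto simp: unit_tuple_def)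
  moreover have "b i \<in> carrier N" using assms(2,3) by blast
  ultimately show ?thesis by (simp add: free_lin_def) (simp add: unit_tuple_def)
qed

text \<open>The expansion of \<open>t\<close> in unit tuples is checked coordinate by coordinate,
  the coordinates being homomorphisms to \<open>R\<close>. It serves to compare homomorphisms by
  their values on the basis, also when they do not respect degrees.\<close>

lemma free_hom_expand:
  assumes N: "module R N" and f: "f \<in> module_hom R (free c) N" and t: "t \<in> carrier (free c)"
  shows "f t = (\<Oplus>\<^bsub>N\<^esub>i\<in>{i. t i \<noteq> \<zero>\<^bsub>R\<^esub>}. t i \<odot>\<^bsub>N\<^esub> f (unit_tuple i))"
proof -
  interpret N: module R N by fact
  interpret F: graded_module_over K R "free c" by (rule grmod_free)
  let ?I = "{i. t i \<noteq> \<zero>\<^bsub>R\<^esub>}"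
  have fin: "finite ?I" and tc: "t i \<in> carrier R" and pl: "t i \<noteq> \<zero>\<^bsub>R\<^esub> \<Longrightarrow> i \<in> places c" for i
    using t by (auto simp: carrier_free)
  note uc = unit_tuple_closed[OF pl]
  have summand: "t i \<odot>\<^bsub>free c\<^esub> unit_tuple i \<in> carrier (free c)" if "i \<in> ?I" for i
    using uc that tc by (intro F.M.smult_closed) auto
  have "t = (\<Oplus>\<^bsub>free c\<^esub>i\<in>?I. t i \<odot>\<^bsub>free c\<^esub> unit_tuple i)"
  proof
    fix j
    have hom: "(\<lambda>u. u j) \<in> module_hom R (free c) (self_module R)" by (auto simp: module_hom_def carrier_free)
    have "(\<Oplus>\<^bsub>free c\<^esub>i\<in>?I. t i \<odot>\<^bsub>free c\<^esub> unit_tuple i) j = (\<Oplus>\<^bsub>self_module R\<^esub>i\<in>?I. t i \<otimes>\<^bsub>R\<^esub> unit_tuple i j)"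
      using module_hom_finsum[OF F.module_M S.module_M hom fin] summand by auto
    also have "\<dots> = (\<Oplus>\<^bsub>self_module R\<^esub>i\<in>?I. if j = i then t i else \<zero>\<^bsub>self_module R\<^esub>)"
      using tc by (intro S.M.M.finsum_cong') (auto simp: unit_tuple_def)
    also have "\<dots> = t j"
    proof (cases "j \<in> ?I")
      case True
      then show ?thesis using fin tc by (intro S.M.M.finsum_singleton) auto
    next
      case False
      then have "(\<Oplus>\<^bsub>self_module R\<^esub>i\<in>?I. if j = i then t i else \<zero>\<^bsub>self_module R\<^esub>) = \<zero>\<^bsub>self_module R\<^esub>"
        by (intro S.M.M.add.finprod_one_eqI) auto
      then show ?thesis using False by simp
    qed
    finally show "t j = (\<Oplus>\<^bsub>free c\<^esub>i\<in>?I. t i \<odot>\<^bsub>free c\<^esub> unit_tuple i) j" by simp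
  qed
  then have "f t = f (\<Oplus>\<^bsub>free c\<^esub>i\<in>?I. t i \<odot>\<^bsub>free c\<^esub> unit_tuple i)" by (rule arg_cong)
  also have "\<dots> = (\<Oplus>\<^bsub>N\<^esub>i\<in>?I. f (t i \<odot>\<^bsub>free c\<^esub> unit_tuple i))"
    using summand by (intro module_hom_finsum[OF F.module_M N f fin]) auto
  also have "\<dots> = (\<Oplus>\<^bsub>N\<^esub>i\<in>?I. t i \<odot>\<^bsub>N\<^esub> f (unit_tuple i))"
    using module_homD(2)[OF f tc uc] module_hom_closed[OF f uc] tc by (intro N.M.finsum_cong') auto
  finally show ?thesis .
qed

text \<open>Preimages of the images of the unit tuples extend linearly to a lift; that it lifts
  \<open>f\<close> everywhere is seen by expanding both sides with
  \<open>free_hom_expand\<close>.\<close>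

lemma projective_free:
  fixes c :: "'g \<Rightarrow> nat"
  shows "projective_module R (free c)"
  unfolding projective_module_def
proof (intro conjI allI impI)
  interpret F: graded_module_over K R "free c" by (rule grmod_free)
  show "module R (free c)" by (rule F.module_M)
  fix X :: "('r, ('g \<times> nat \<Rightarrow> 'r) \<Rightarrow> 'r) module" and Y :: "('r, 'g \<times> nat \<Rightarrow> 'r) module" and p f
  assume as: "module R X \<and> module R Y \<and> p \<in> module_hom R X Y \<and> p ` carrier X = carrier Y \<and>
    f \<in> module_hom R (free c) Y"
  then have X: "module R X" and Y: "module R Y" and p: "p \<in> module_hom R X Y"
    and f: "f \<in> module_hom R (free c) Y" by auto
  have "\<exists>x\<in>carrier X. p x = f (unit_tuple i)" if "i \<in> places c" for i
  proof -
    have "f (unit_tuple i) \<in> p ` carrier X" using as module_hom_closed[OF f unit_tuple_closed[OF that]] by auto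
    then show ?thesis by auto
  qed
  then have "\<forall>i\<in>places c. \<exists>x. x \<in> carrier X \<and> p x = f (unit_tuple i)" by blast
  from bchoice[OF this] obtain n where
    n: "\<And>i. i \<in> places c \<Longrightarrow> n i \<in> carrier X" "\<And>i. i \<in> places c \<Longrightarrow> p (n i) = f (unit_tuple i)" by blast
  have nP: "n \<in> places c \<rightarrow> carrier X" using n by auto
  have h: "free_lin R X n \<in> module_hom R (free c) X" by (rule free_lin_free_hom[OF X nP])
  have "p (free_lin R X n t) = f t" if t: "t \<in> carrier (free c)" for t
  proof -
    interpret Y: module R Y by (rule Y)
    have tc: "t i \<in> carrier R" "t i \<noteq> \<zero>\<^bsub>R\<^esub> \<Longrightarrow> i \<in> places c" for i using t by (auto simp: carrier_free)
    have "p (free_lin R X n t) = (\<Oplus>\<^bsub>Y\<^esub>i\<in>{i. t i \<noteq> \<zero>\<^bsub>R\<^esub>}. t i \<odot>\<^bsub>Y\<^esub> p (free_lin R X n (unit_tuple i)))"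
      by (rule free_hom_expand[OF Y module_hom_compose[OF h p] t])
    also have "\<dots> = (\<Oplus>\<^bsub>Y\<^esub>i\<in>{i. t i \<noteq> \<zero>\<^bsub>R\<^esub>}. t i \<odot>\<^bsub>Y\<^esub> f (unit_tuple i))"
      using free_lin_unit_tuple[OF X nP] tc n module_hom_closed[OF f unit_tuple_closed]
      by (intro Y.M.finsum_cong') auto
    also have "\<dots> = f t" by (rule free_hom_expand[OF Y f t, symmetric])
    finally show ?thesis .
  qed
  with h show "\<exists>h\<in>module_hom R (free c) X. \<forall>x\<in>carrier (free c). p (h x) = f x" by blast
qed

text \<open>The degree \<open>g\<close> part of \<open>R\<^sub>+ M\<close>.\<close>

definition irr :: "('r, 'm, 'g) graded_module \<Rightarrow> 'g \<Rightarrow> 'm set"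
  where "irr M g = \<Inter>{W. submodule W K (restrict_scalars R M) \<and> W \<subseteq> component M g \<and>
    (\<forall>q a m. q \<noteq> 0 \<longrightarrow> a \<in> component R q \<longrightarrow> m \<in> component M (g - q) \<longrightarrow> a \<odot>\<^bsub>M\<^esub> m \<in> W)}"

text \<open>The intersection gives the bound \<open>irr_least\<close> at once: it is enough to
  exhibit one subspace of the component that contains all products. The whole component is such a
  subspace, so the family is not empty.\<close>

lemma
  assumes "grmod M"
  shows irr_submodule: "submodule (irr M g) K (restrict_scalars R M)"
    and irr_smult: "\<lbrakk>q \<noteq> 0; a \<in> component R q; m \<in> component M (g - q)\<rbrakk> \<Longrightarrow> a \<odot>\<^bsub>M\<^esub> m \<in> irr M g"
    and irr_least: "\<lbrakk>submodule W K (restrict_scalars R M); W \<subseteq> component M g;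
      \<And>q a m. \<lbrakk>q \<noteq> 0; a \<in> component R q; m \<in> component M (g - q)\<rbrakk> \<Longrightarrow> a \<odot>\<^bsub>M\<^esub> m \<in> W\<rbrakk> \<Longrightarrow> irr M g \<subseteq> W"
proof -
  interpret M: graded_module_over K R M by fact
  let ?S = "{W. submodule W K (restrict_scalars R M) \<and> W \<subseteq> component M g \<and>
    (\<forall>q a m. q \<noteq> 0 \<longrightarrow> a \<in> component R q \<longrightarrow> m \<in> component M (g - q) \<longrightarrow> a \<odot>\<^bsub>M\<^esub> m \<in> W)}"
  have top: "component M g \<in> ?S"
    using M.component_submodule M.component_smult[of _ _ _ "g - _"] by fastforce
  have sub: "submodule W K (restrict_scalars R M)" if "W \<in> ?S" for W using that by blast
  note E = M.V.V.submoduleE[OF sub]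
  show "submodule (irr M g) K (restrict_scalars R M)"
  proof (rule M.V.submoduleI')
    show "irr M g \<subseteq> carrier (restrict_scalars R M)" using top E(1) unfolding irr_def by blast
    show "\<zero>\<^bsub>restrict_scalars R M\<^esub> \<in> irr M g" unfolding irr_def using M.V.submodule_zero_mem[OF sub] by blast
    show "x \<oplus>\<^bsub>restrict_scalars R M\<^esub> y \<in> irr M g" if "x \<in> irr M g" "y \<in> irr M g" for x y
      using that E(5) unfolding irr_def by blast
    show "k \<odot>\<^bsub>restrict_scalars R M\<^esub> x \<in> irr M g" if "k \<in> carrier K" "x \<in> irr M g" for k x
      using that E(4) unfolding irr_def by blast
  qed
  show "a \<odot>\<^bsub>M\<^esub> m \<in> irr M g" if "q \<noteq> 0" "a \<in> component R q" "m \<in> component M (g - q)" for q a m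
    using that unfolding irr_def by blast
  show "irr M g \<subseteq> W" if "submodule W K (restrict_scalars R M)" "W \<subseteq> component M g"
      "\<And>q a m. \<lbrakk>q \<noteq> 0; a \<in> component R q; m \<in> component M (g - q)\<rbrakk> \<Longrightarrow> a \<odot>\<^bsub>M\<^esub> m \<in> W" for W
    using that unfolding irr_def by blast
qed

text \<open>
  A minimal graded cover \<open>p\<close> of a projective module splits; the complementary projection has image in
  \<open>R\<^sub>+\<close> times the cover, hence vanishes by induction on the degree.
\<close>

theorem projective_bdf_free:
  fixes M :: "('r, 'm, 'g) graded_module"
  assumes M: "bdf_module K R M" and proj: "projective_module R M"
  obtains P c where "finite P" "{h. c h \<noteq> 0} \<subseteq> upper P" "graded_isomorphic R (free c) M"
proof -
  interpret M: graded_module_over K R M by (rule bdf_grmod[OF M])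
  obtain P where P: "finite P" "support M \<subseteq> upper P" using M by (auto simp: bdf_iff)
  have "\<exists>n b. M.V.rel_basis (irr M g) (component M g) n b" for g
  proof -
    obtain m b where "\<And>i. i < (m::nat) \<Longrightarrow> b i \<in> component M g"
      "\<And>w. w \<in> component M g \<Longrightarrow> \<exists>c. (\<forall>i<m. c i \<in> carrier K) \<and> w = M.V.comb m c b"
      using finite_dimensional_spanning[OF M.V.kspace_axioms bdf_fd[OF M]] M.component_closed
      by (metis (no_types, lifting) restrict_scalars_simps(1) subsetI)
    then show ?thesis
      by (rule M.V.rel_basis_exists[OF irr_submodule[OF M.graded_module_over_axioms] M.component_submodule])
  qed
  \<comment> \<open>Thus \<open>c g\<close> is the dimension of \<open>M\<close> modulo
    \<open>R_+ M\<close> in degree \<open>g\<close>, and the vectors \<open>b g n\<close> are the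
    minimal generators of that degree.\<close>
  then obtain c b where basis: "\<And>g. M.V.rel_basis (irr M g) (component M g) (c g) (b g)" by metis
  have bM: "b g n \<in> component M g" if "n < c g" for g n using basis[of g] that by (simp add: M.V.rel_basis_def)
  have c0: "{h. c h \<noteq> 0} \<subseteq> upper P"
  proof
    fix h assume h: "h \<in> {h. c h \<noteq> 0}"
    \<comment> \<open>In a zero component even the combination with all coefficients one lies in
      \<open>irr M h\<close>, so an independent family there must be empty.\<close>
    have "h \<in> support M"
    proof (rule ccontr)
      assume "h \<notin> support M"
      then have z: "component M h = {\<zero>\<^bsub>M\<^esub>}" using M.component_zero_iff by blast
      have bW: "b h n \<in> component M h" if "n < c h" for n using bM[OF that] .
      have "M.V.comb (c h) (\<lambda>_. \<one>\<^bsub>K\<^esub>) (b h) \<in> component M h"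
        by (rule M.V.comb_in_submodule[OF M.component_submodule]) (use bW in auto)
      then have "M.V.comb (c h) (\<lambda>_. \<one>\<^bsub>K\<^esub>) (b h) \<in> irr M h"
        using z M.V.submodule_zero_mem[OF irr_submodule[OF M.graded_module_over_axioms]] by auto
      then have "\<one>\<^bsub>K\<^esub> = \<zero>\<^bsub>K\<^esub>"
        using h by (intro M.V.rel_basis_independent[OF basis[of h], of "\<lambda>_. \<one>\<^bsub>K\<^esub>" 0]) auto
      then show False by simp
    qed
    then show "h \<in> upper P" using P by blast
  qed
  interpret F: graded_module_over K R "free c" by (rule grmod_free)
  define \<beta> where "\<beta> i = b (fst i) (snd i)" for i
  have \<beta>: "\<beta> i \<in> component M (fst i)" if "i \<in> places c" for i using bM that by (simp add: \<beta>_def)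
  have \<beta>P: "\<beta> \<in> places c \<rightarrow> carrier M" using \<beta> M.component_closed by blast
  define p where "p = free_lin R M \<beta>"
  have p_hom: "p \<in> module_hom R (free c) M" unfolding p_def by (rule free_lin_free_hom[OF M.module_M \<beta>P])
  have p_unit: "p (unit_tuple i) = \<beta> i" if "i \<in> places c" for i
    unfolding p_def by (rule free_lin_unit_tuple[OF M.module_M \<beta>P that])
  have p_expand: "p t = (\<Oplus>\<^bsub>M\<^esub>i\<in>{i. t i \<noteq> \<zero>\<^bsub>R\<^esub>}. t i \<odot>\<^bsub>M\<^esub> \<beta> i)" for t
    by (simp add: p_def free_lin_def)
  have p_comp: "p t \<in> component M g" if t: "t \<in> component (free c) g" for t g
    unfolding p_expand
  proof (rule M.component_finsum)
    fix i assume "i \<in> {i. t i \<noteq> \<zero>\<^bsub>R\<^esub>}"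
    then have "t i \<in> component R (g - fst i)" "i \<in> places c" using t unfolding component_free by auto
    then show "t i \<odot>\<^bsub>M\<^esub> \<beta> i \<in> component M g" using M.component_smult[OF _ \<beta>, of "t i" "g - fst i" i] by simp
  qed
  have p: "p \<in> graded_hom R (free c) M" using p_hom p_comp by (auto simp: graded_hom_def)
  interpret p: kspace_map K "restrict_scalars R (free c)" "restrict_scalars R M" "component (free c) g" p for g
    by (rule kspace_map_graded[OF grmod_free M.graded_module_over_axioms p])
  \<comment> \<open>The graded Nakayama lemma. By induction all products of degree \<open>g\<close>
    with a factor from \<open>R_+\<close> lie in the image, hence so does \<open>irr M g\<close>;
    together with the generators of degree \<open>g\<close> this gives the whole component.\<close>
  have p_surj: "component M g \<subseteq> p ` component (free c) g" for g
    using P(1)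
  proof (induction g rule: upper_induct)
    case (less g)
    let ?W = "p ` component (free c) g"
    note FE = F.V.V.submoduleE[OF F.component_submodule]
    have W: "submodule ?W K (restrict_scalars R M)"
    proof (rule M.V.submoduleI')
      show "?W \<subseteq> carrier (restrict_scalars R M)" using p_comp M.component_closed by auto
      show "\<zero>\<^bsub>restrict_scalars R M\<^esub> \<in> ?W" using p.f_zero by (intro image_eqI[OF _ F.component_zero]) simp
      show "x \<oplus>\<^bsub>restrict_scalars R M\<^esub> y \<in> ?W" if xy: "x \<in> ?W" "y \<in> ?W" for x y
      proof -
        obtain s t where "s \<in> component (free c) g" "t \<in> component (free c) g" "x = p s" "y = p t" using xy by auto
        then show ?thesis using p.f_add[of s g t] F.component_add[of s g t] by (intro image_eqI[of _ _ "s \<oplus>\<^bsub>free c\<^esub> t"]) auto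
      qed
      show "k \<odot>\<^bsub>restrict_scalars R M\<^esub> x \<in> ?W" if kx: "k \<in> carrier K" "x \<in> ?W" for k x
      proof -
        obtain s where s: "s \<in> component (free c) g" "x = p s" using kx by auto
        show ?thesis
          using p.f_smult[OF kx(1) s(1)] F.component_scalar[OF kx(1) s(1)] s
          by (intro image_eqI[of _ _ "(k \<odot>\<^bsub>R\<^esub> \<one>\<^bsub>R\<^esub>) \<odot>\<^bsub>free c\<^esub> s"]) auto
      qed
    qed
    have "irr M g \<subseteq> ?W"
    proof (rule irr_least[OF M.graded_module_over_axioms W])
      show "?W \<subseteq> component M g" using p_comp by auto
      fix q a m assume q: "q \<noteq> 0" and a: "a \<in> component R q" and m: "m \<in> component M (g - q)"
      have ac: "a \<in> carrier R" and mc: "m \<in> carrier M" using a m R_component_closed M.component_closed by auto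
      show "a \<odot>\<^bsub>M\<^esub> m \<in> ?W"
      proof (cases "a = \<zero>\<^bsub>R\<^esub> \<or> m = \<zero>\<^bsub>M\<^esub>")
        case True
        then have "a \<odot>\<^bsub>M\<^esub> m = \<zero>\<^bsub>M\<^esub>" using ac mc by auto
        then show ?thesis using M.V.submodule_zero_mem[OF W] by simp
      next
        case False
        have "q \<in> support R" using False a component_R_trivial by blast
        moreover have "g - q \<in> support M" using False m unfolding support_def by blast
        ultimately have "component M (g - q) \<subseteq> p ` component (free c) (g - q)"
          using less[of "g - q"] P(2) q by (auto simp: supp_le_def)
        then obtain t where t: "t \<in> component (free c) (g - q)" "m = p t" using m by blast
        have "a \<odot>\<^bsub>M\<^esub> m = p (a \<odot>\<^bsub>free c\<^esub> t)"
          using graded_homD(3)[OF p ac F.component_closed[OF t(1)]] t(2) by simp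
        moreover have "a \<odot>\<^bsub>free c\<^esub> t \<in> component (free c) g" using F.component_smult[OF a t(1)] by simp
        ultimately show ?thesis by (rule image_eqI)
      qed
    qed
    moreover have "b g n \<in> ?W" if "n < c g" for n
    proof -
      have i: "(g, n) \<in> places c" using that by simp
      show ?thesis using p_unit[OF i] unit_tuple_component[OF i] by (intro image_eqI[of _ _ "unit_tuple (g, n)"]) (auto simp: \<beta>_def)
    qed
    ultimately have "w \<in> ?W" if w: "w \<in> component M g" for w
    proof -
      obtain k u where k: "\<forall>i<c g. k i \<in> carrier K" "u \<in> irr M g" "w = u \<oplus>\<^bsub>restrict_scalars R M\<^esub> M.V.comb (c g) k (b g)"
        using basis[of g] w unfolding M.V.rel_basis_def by blast
      have "M.V.comb (c g) k (b g) \<in> ?W"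
        using k(1) \<open>\<And>n. n < c g \<Longrightarrow> b g n \<in> ?W\<close> by (intro M.V.comb_in_submodule[OF W]) auto
      then show ?thesis unfolding k(3) using k(2) \<open>irr M g \<subseteq> ?W\<close> M.V.V.submoduleE(5)[OF W] by blast
    qed
    then show ?case by blast
  qed
  \<comment> \<open>Minimality of the generators: in a relation of degree \<open>g\<close> the
    entries at generators of degree \<open>g\<close> are scalars, the other terms lie in
    \<open>irr M g\<close>, and independence modulo \<open>irr M g\<close> makes these scalars
    zero.\<close>
  have ker: "t (g, n) = \<zero>\<^bsub>R\<^esub>" if t: "t \<in> component (free c) g" and pt: "p t = \<zero>\<^bsub>M\<^esub>" for t g n
  proof (cases "n < c g")
    case False
    then show ?thesis using t unfolding component_free by force
  next
    case True
    have fin: "finite {i. t i \<noteq> \<zero>\<^bsub>R\<^esub>}" and tc: "t i \<in> component R (g - fst i)" "t i \<in> carrier R"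
      and pl: "t i \<noteq> \<zero>\<^bsub>R\<^esub> \<Longrightarrow> i \<in> places c" for i
      using t R_component_closed unfolding component_free by blast+
    have "\<exists>k. k \<in> carrier K \<and> t (g, n) = k \<odot>\<^bsub>R\<^esub> \<one>\<^bsub>R\<^esub>" for n
      using tc(1)[of "(g, n)"] by (auto simp: component_0)
    then obtain k where k: "\<And>n. k n \<in> carrier K" "\<And>n. t (g, n) = k n \<odot>\<^bsub>R\<^esub> \<one>\<^bsub>R\<^esub>" by metis
    \<comment> \<open>\<open>?I2\<close> lists all places of degree \<open>g\<close>, also those
      with entry zero, so that the sum over it becomes a full \<open>comb\<close> of length
      \<open>c g\<close>.\<close>
    let ?I1 = "{i. t i \<noteq> \<zero>\<^bsub>R\<^esub> \<and> fst i \<noteq> g}" and ?I2 = "{g} \<times> {..<c g}"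
    have t\<beta>: "t i \<odot>\<^bsub>M\<^esub> \<beta> i \<in> carrier M" if "i \<in> places c" for i
      using M.M.smult_closed[OF tc(2) funcset_mem[OF \<beta>P that]] .
    have \<beta>c: "\<beta> i \<in> carrier M" if "snd i < c (fst i)" for i using funcset_mem[OF \<beta>P] that by blast
    have t\<beta>': "t i \<odot>\<^bsub>M\<^esub> \<beta> i \<in> carrier M" if "snd i < c (fst i)" for i using t\<beta> that by blast
    have pl': "snd i < c (fst i)" if "t i \<noteq> \<zero>\<^bsub>R\<^esub>" for i using pl[OF that] by simp
    have "p t = (\<Oplus>\<^bsub>M\<^esub>i\<in>?I1 \<union> ?I2. t i \<odot>\<^bsub>M\<^esub> \<beta> i)"
      unfolding p_expand
    proof (rule M.M.M.add.finprod_mono_neutral_cong_left)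
      show "{i. t i \<noteq> \<zero>\<^bsub>R\<^esub>} \<subseteq> ?I1 \<union> ?I2" using pl by force
      show "finite (?I1 \<union> ?I2)" using fin by (auto intro: finite_subset[OF _ fin])
      show "t i \<odot>\<^bsub>M\<^esub> \<beta> i = \<zero>\<^bsub>M\<^esub>" if "i \<in> ?I1 \<union> ?I2 - {i. t i \<noteq> \<zero>\<^bsub>R\<^esub>}" for i using that \<beta>c by auto
      show "(\<lambda>i. t i \<odot>\<^bsub>M\<^esub> \<beta> i) \<in> ?I1 \<union> ?I2 \<rightarrow> carrier M" using t\<beta>' pl' by auto
    qed simp
    also have "\<dots> = (\<Oplus>\<^bsub>M\<^esub>i\<in>?I1. t i \<odot>\<^bsub>M\<^esub> \<beta> i) \<oplus>\<^bsub>M\<^esub> (\<Oplus>\<^bsub>M\<^esub>i\<in>?I2. t i \<odot>\<^bsub>M\<^esub> \<beta> i)"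
      using t\<beta>' pl' by (intro M.M.M.finsum_Un_disjoint) (auto intro: finite_subset[OF _ fin])
    also have "(\<Oplus>\<^bsub>M\<^esub>i\<in>?I2. t i \<odot>\<^bsub>M\<^esub> \<beta> i) = M.V.comb (c g) k (b g)"
    proof -
      have "?I2 = (\<lambda>n. (g, n)) ` {..<c g}" by auto
      then have "(\<Oplus>\<^bsub>M\<^esub>i\<in>?I2. t i \<odot>\<^bsub>M\<^esub> \<beta> i) = (\<Oplus>\<^bsub>M\<^esub>n\<in>{..<c g}. t (g, n) \<odot>\<^bsub>M\<^esub> \<beta> (g, n))"
        using t\<beta>' by (simp only:) (subst M.M.M.finsum_reindex, auto simp: inj_on_def)
      then show ?thesis by (simp add: M.V.comb_def k \<beta>_def)
    qed
    finally have sum: "\<zero>\<^bsub>M\<^esub> = (\<Oplus>\<^bsub>M\<^esub>i\<in>?I1. t i \<odot>\<^bsub>M\<^esub> \<beta> i) \<oplus>\<^bsub>M\<^esub> M.V.comb (c g) k (b g)" using pt by simp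
    note I = irr_submodule[OF M.graded_module_over_axioms, of g]
    note IE = M.V.V.submoduleE[OF I]
    have I1: "(\<Oplus>\<^bsub>M\<^esub>i\<in>?I1. t i \<odot>\<^bsub>M\<^esub> \<beta> i) \<in> irr M g"
    proof -
      have mem: "t i \<odot>\<^bsub>M\<^esub> \<beta> i \<in> irr M g" if "i \<in> ?I1" for i
        using irr_smult[OF M.graded_module_over_axioms, of "g - fst i" "t i" "\<beta> i" g] tc(1)[of i] \<beta>[of i] pl[of i] that
        by auto
      have "finite J \<Longrightarrow> J \<subseteq> ?I1 \<Longrightarrow> (\<Oplus>\<^bsub>M\<^esub>i\<in>J. t i \<odot>\<^bsub>M\<^esub> \<beta> i) \<in> irr M g" for J
      proof (induction J rule: finite_induct)
        case empty
        then show ?case using M.V.submodule_zero_mem[OF I] by simp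
      next
        case (insert x J)
        then have "(\<Oplus>\<^bsub>M\<^esub>i\<in>insert x J. t i \<odot>\<^bsub>M\<^esub> \<beta> i) = t x \<odot>\<^bsub>M\<^esub> \<beta> x \<oplus>\<^bsub>M\<^esub> (\<Oplus>\<^bsub>M\<^esub>i\<in>J. t i \<odot>\<^bsub>M\<^esub> \<beta> i)"
          using t\<beta>' pl' by (intro M.M.M.finsum_insert) auto
        then show ?case using insert mem[of x] IE(5) by simp
      qed
      then show ?thesis using finite_subset[OF _ fin, of ?I1] by blast
    qed
    have cc: "M.V.comb (c g) k (b g) \<in> carrier M"
      using k(1) M.component_closed[OF bM] by (intro M.V.comb_closed[simplified]) auto
    have "M.V.comb (c g) k (b g) = \<ominus>\<^bsub>M\<^esub> (\<Oplus>\<^bsub>M\<^esub>i\<in>?I1. t i \<odot>\<^bsub>M\<^esub> \<beta> i)"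
      using sum cc I1 IE(1) by (intro M.M.M.minus_equality[symmetric]) (auto simp: M.M.M.a_comm)
    also have "\<dots> = (\<ominus>\<^bsub>R\<^esub> \<one>\<^bsub>R\<^esub>) \<odot>\<^bsub>M\<^esub> (\<Oplus>\<^bsub>M\<^esub>i\<in>?I1. t i \<odot>\<^bsub>M\<^esub> \<beta> i)"
      using I1 IE(1) by (simp add: M.M.smult_l_minus subset_iff)
    also have "\<ominus>\<^bsub>R\<^esub> \<one>\<^bsub>R\<^esub> = (\<ominus>\<^bsub>K\<^esub> \<one>\<^bsub>K\<^esub>) \<odot>\<^bsub>R\<^esub> \<one>\<^bsub>R\<^esub>" by (simp add: A.smult_l_minus)
    also have "((\<ominus>\<^bsub>K\<^esub> \<one>\<^bsub>K\<^esub>) \<odot>\<^bsub>R\<^esub> \<one>\<^bsub>R\<^esub>) \<odot>\<^bsub>M\<^esub> (\<Oplus>\<^bsub>M\<^esub>i\<in>?I1. t i \<odot>\<^bsub>M\<^esub> \<beta> i) \<in> irr M g"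
      using IE(4)[OF _ I1, of "\<ominus>\<^bsub>K\<^esub> \<one>\<^bsub>K\<^esub>"] by simp
    finally have "M.V.comb (c g) k (b g) \<in> irr M g" .
    then have "k n = \<zero>\<^bsub>K\<^esub>" using k(1) True by (intro M.V.rel_basis_independent[OF basis[of g], of k]) auto
    then show ?thesis using k(2) by simp
  qed
  have id: "(\<lambda>x. x) \<in> module_hom R M M" by (auto simp: module_hom_def)
  obtain s where s: "s \<in> module_hom R M (free c)" "\<And>x. x \<in> carrier M \<Longrightarrow> p (s x) = x"
    using projective_module_lift[OF proj F.module_M M.module_M p_hom
        graded_hom_surj[OF grmod_free M.graded_module_over_axioms p p_surj] id] by blast
  have sc: "s x \<in> carrier (free c)" if "x \<in> component M g" for x g
    using module_hom_closed[OF s(1) M.component_closed[OF that]] .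
  \<comment> \<open>The section \<open>s\<close> need not respect degrees; keeping the part of
    degree \<open>g\<close> of \<open>s x\<close> for \<open>x\<close> of degree \<open>g\<close>
    turns it into a graded one.\<close>
  obtain s0 where s0: "s0 \<in> graded_hom R M (free c)" "\<And>g x. x \<in> component M g \<Longrightarrow> s0 x = hp (free c) (s x) g"
  proof (rule glue_degreewise[OF M.graded_module_over_axioms grmod_free, of "\<lambda>g x. hp (free c) (s x) g"])
    show "hp (free c) (s x) g \<in> component (free c) g" if "x \<in> component M g" for g x
      using F.hp_component[OF sc[OF that]] .
    show "hp (free c) (s (x \<oplus>\<^bsub>M\<^esub> y)) g = hp (free c) (s x) g \<oplus>\<^bsub>free c\<^esub> hp (free c) (s y) g"
      if "x \<in> component M g" "y \<in> component M g" for g x y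
      using module_homD(1)[OF s(1)] M.component_closed that F.hp_add sc by metis
    show "hp (free c) (s (a \<odot>\<^bsub>M\<^esub> x)) (q + h) = a \<odot>\<^bsub>free c\<^esub> hp (free c) (s x) h"
      if "a \<in> component R q" "x \<in> component M h" for q h a x
      using module_homD(2)[OF s(1) R_component_closed[OF that(1)] M.component_closed[OF that(2)]]
        F.hp_smult[OF that(1) sc[OF that(2)], of "q + h"] by simp
  qed (rule that; assumption)
  have ps0: "p (s0 x) = x" if x: "x \<in> component M g" for x g
    using hp_graded_hom[OF grmod_free M.graded_module_over_axioms p sc[OF x], of g] s(2)[OF M.component_closed[OF x]]
      M.hp_homogeneous[OF x] s0(2)[OF x] by simp
  note sp = graded_hom_comp[OF p s0(1)]
  have fixed: "s0 (p t) = t" if "t \<in> component (free c) g" for t g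
    using P(1) that
  proof (induction g arbitrary: t rule: upper_induct)
    case (less g)
    have tc: "t \<in> carrier (free c)" using F.component_closed[OF less.prems] .
    define y where "y = t \<oplus>\<^bsub>free c\<^esub> \<ominus>\<^bsub>free c\<^esub> s0 (p t)"
    have spt: "s0 (p t) \<in> component (free c) g" by (rule graded_homD(4)[OF sp less.prems])
    then have spc: "s0 (p t) \<in> carrier (free c)" by (rule F.component_closed)
    have yg: "y \<in> component (free c) g" unfolding y_def
      by (intro F.component_add less.prems F.component_minus spt)
    have py: "p y = \<zero>\<^bsub>M\<^esub>"
    proof -
      have "p y = p t \<oplus>\<^bsub>M\<^esub> p (\<ominus>\<^bsub>free c\<^esub> s0 (p t))" unfolding y_def using tc spc by (intro module_homD(1)[OF p_hom]) auto
      also have "p (\<ominus>\<^bsub>free c\<^esub> s0 (p t)) = \<ominus>\<^bsub>M\<^esub> p (s0 (p t))"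
        using spc module_homD(2)[OF p_hom, of "\<ominus>\<^bsub>R\<^esub> \<one>\<^bsub>R\<^esub>" "s0 (p t)"] module_hom_closed[OF p_hom spc]
        by (simp add: F.M.smult_l_minus M.M.smult_l_minus del: free_simps)
      also have "p (s0 (p t)) = p t" by (rule ps0[OF p_comp[OF less.prems]])
      finally show ?thesis using module_hom_closed[OF p_hom tc] by (simp add: M.M.M.r_neg)
    qed
    have yc: "y \<in> carrier (free c)" using F.component_closed[OF yg] .
    \<comment> \<open>By \<open>ker\<close> the nonzero entries of \<open>y\<close> sit at unit
      tuples of degree strictly below \<open>g\<close>, which the composite of \<open>p\<close> and
      \<open>s0\<close> fixes by induction. Hence \<open>y = s0 (p y)\<close>, which is
      zero.\<close>
    have "s0 (p y) = (\<Oplus>\<^bsub>free c\<^esub>i\<in>{i. y i \<noteq> \<zero>\<^bsub>R\<^esub>}. y i \<odot>\<^bsub>free c\<^esub> s0 (p (unit_tuple i)))"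
      by (rule free_hom_expand[OF F.module_M graded_homD(5)[OF sp] yc])
    also have "\<dots> = (\<Oplus>\<^bsub>free c\<^esub>i\<in>{i. y i \<noteq> \<zero>\<^bsub>R\<^esub>}. y i \<odot>\<^bsub>free c\<^esub> unit_tuple i)"
    proof (rule F.M.M.finsum_cong')
      have *: "s0 (p (unit_tuple i)) = unit_tuple i" "unit_tuple i \<in> carrier (free c)" "y i \<in> carrier R"
        if "i \<in> {i. y i \<noteq> \<zero>\<^bsub>R\<^esub>}" for i
      proof -
        have i: "i \<in> places c" "y i \<in> component R (g - fst i)" using yg that unfolding component_free by auto
        then have "g - fst i \<in> support R" using that component_R_trivial by auto
        moreover have "fst i \<noteq> g" using ker[OF yg py, of "snd i"] that by auto
        moreover have "fst i \<in> upper P" using c0 i(1) by auto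
        ultimately show "s0 (p (unit_tuple i)) = unit_tuple i"
          using less.IH[of "fst i" "unit_tuple i"] unit_tuple_component[OF i(1)] by (auto simp: supp_le_def)
        show "unit_tuple i \<in> carrier (free c)" by (rule unit_tuple_closed[OF i(1)])
        show "y i \<in> carrier R" using R_component_closed[OF i(2)] .
      qed
      show "y i \<odot>\<^bsub>free c\<^esub> s0 (p (unit_tuple i)) = y i \<odot>\<^bsub>free c\<^esub> unit_tuple i" if "i \<in> {i. y i \<noteq> \<zero>\<^bsub>R\<^esub>}" for i
        using *[OF that] by simp
      show "(\<lambda>i. y i \<odot>\<^bsub>free c\<^esub> unit_tuple i) \<in> {i. y i \<noteq> \<zero>\<^bsub>R\<^esub>} \<rightarrow> carrier (free c)"
        using * F.M.smult_closed by blast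
    qed simp
    also have "\<dots> = y"
      by (rule free_hom_expand[OF F.module_M _ yc, of "\<lambda>x. x", symmetric]) (auto simp: module_hom_def)
    finally have "y = s0 \<zero>\<^bsub>M\<^esub>" using py by simp
    also have "\<dots> = \<zero>\<^bsub>free c\<^esub>" by (rule module_hom_zero[OF M.module_M F.module_M graded_homD(5)[OF s0(1)]])
    finally have "t \<oplus>\<^bsub>free c\<^esub> \<ominus>\<^bsub>free c\<^esub> s0 (p t) = \<zero>\<^bsub>free c\<^esub>" by (simp add: y_def)
    then show ?case using tc spc F.M.M.r_neg F.M.M.a_inv_closed F.M.M.add.inv_solve_right'
      by (metis F.M.M.add.right_cancel)
  qed
  have "graded_isomorphic R (free c) M"
  proof (rule graded_isomorphicI[OF grmod_free M.graded_module_over_axioms p])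
    show "bij_betw p (component (free c) g) (component M g)" for g
      by (rule bij_betw_byWitness[where f' = s0])
        (use fixed ps0 p_comp graded_homD(4)[OF s0(1)] in auto)
  qed
  with P(1) c0 show thesis by (rule that)
qed

end

section \<open>Group completions\<close>

text \<open>An injective additive map \<open>f\<close> into an abelian group whose elements are all
  differences of values of \<open>f\<close> presents that group as the completion. The laws of
  \<open>A\<close> beyond closure and its unit are read off from \<open>G\<close> through
  \<open>f\<close>. The conclusion concerns all homomorphisms extending \<open>f\<close>, because
  they may differ off the carrier.\<close>

lemma hom_group_completion:
  fixes A :: "('a, 'z) monoid_scheme" and G :: "('b, 'y) monoid_scheme"
  assumes G: "comm_group G"
    and mult: "\<And>x y. x \<in> carrier A \<Longrightarrow> y \<in> carrier A \<Longrightarrow> x \<otimes>\<^bsub>A\<^esub> y \<in> carrier A" and one: "\<one>\<^bsub>A\<^esub> \<in> carrier A"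
    and f: "\<And>x. x \<in> carrier A \<Longrightarrow> f x \<in> carrier G" "f \<one>\<^bsub>A\<^esub> = \<one>\<^bsub>G\<^esub>"
      "\<And>x y. x \<in> carrier A \<Longrightarrow> y \<in> carrier A \<Longrightarrow> f (x \<otimes>\<^bsub>A\<^esub> y) = f x \<otimes>\<^bsub>G\<^esub> f y"
    and inj: "inj_on f (carrier A)"
    and surj: "\<And>g. g \<in> carrier G \<Longrightarrow> \<exists>a\<in>carrier A. \<exists>b\<in>carrier A. g = f a \<otimes>\<^bsub>G\<^esub> inv\<^bsub>G\<^esub> f b"
  defines "H \<equiv> {\<Phi> \<in> hom (group_completion A) G. \<forall>a\<in>carrier A. \<Phi> (completion_class A a) = f a}"
  shows "H \<noteq> {}" "H \<subseteq> iso (group_completion A) G"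
proof -
  interpret G: comm_group G by fact
  \<comment> \<open>\<open>\<Psi>\<close> evaluates a formal difference in \<open>G\<close>.
    Injectivity of \<open>f\<close> identifies \<open>completion_rel\<close> with equality under
    \<open>\<Psi>\<close>, which settles transitivity and compatibility with the product.\<close>
  define \<Psi> where "\<Psi> p = f (fst p) \<otimes>\<^bsub>G\<^esub> inv\<^bsub>G\<^esub> f (snd p)" for p
  let ?P = "carrier A \<times> carrier A"
  have \<Psi>c: "\<Psi> p \<in> carrier G" if "p \<in> ?P" for p using that f(1) by (auto simp: \<Psi>_def)
  have \<Psi>eq: "\<Psi> (a, b) = \<Psi> (c, d) \<longleftrightarrow> f (a \<otimes>\<^bsub>A\<^esub> d) = f (c \<otimes>\<^bsub>A\<^esub> b)"
    if "a \<in> carrier A" "b \<in> carrier A" "c \<in> carrier A" "d \<in> carrier A" for a b c d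
  proof -
    have c: "f a \<in> carrier G" "f b \<in> carrier G" "f c \<in> carrier G" "f d \<in> carrier G" using f(1) that by auto
    let ?k = "f b \<otimes>\<^bsub>G\<^esub> f d"
    have ab: "\<Psi> (a, b) \<otimes>\<^bsub>G\<^esub> f b = f a" and cd: "\<Psi> (c, d) \<otimes>\<^bsub>G\<^esub> f d = f c"
      using c by (simp_all add: \<Psi>_def G.m_assoc)
    have P: "\<Psi> (a, b) \<in> carrier G" "\<Psi> (c, d) \<in> carrier G" using \<Psi>c that by auto
    have "\<Psi> (a, b) \<otimes>\<^bsub>G\<^esub> ?k = f a \<otimes>\<^bsub>G\<^esub> f d" unfolding ab[symmetric] using P c by (simp add: G.m_assoc)
    moreover have "\<Psi> (c, d) \<otimes>\<^bsub>G\<^esub> ?k = f c \<otimes>\<^bsub>G\<^esub> f b"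
      unfolding cd[symmetric] using P c by (simp add: G.m_ac)
    moreover have "\<Psi> (a, b) = \<Psi> (c, d) \<longleftrightarrow> \<Psi> (a, b) \<otimes>\<^bsub>G\<^esub> ?k = \<Psi> (c, d) \<otimes>\<^bsub>G\<^esub> ?k"
      using P c by (intro G.right_cancel[symmetric]) auto
    ultimately show ?thesis using f(3) that by simp
  qed
  have rel: "completion_rel A = {(p, q). p \<in> ?P \<and> q \<in> ?P \<and> \<Psi> p = \<Psi> q}"
  proof -
    have rw: "(\<exists>e\<in>carrier A. a \<otimes>\<^bsub>A\<^esub> d \<otimes>\<^bsub>A\<^esub> e = c \<otimes>\<^bsub>A\<^esub> b \<otimes>\<^bsub>A\<^esub> e) \<longleftrightarrow> \<Psi> (a, b) = \<Psi> (c, d)"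
      if m: "a \<in> carrier A" "b \<in> carrier A" "c \<in> carrier A" "d \<in> carrier A" for a b c d
      unfolding \<Psi>eq[OF m]
    proof
      assume "\<exists>e\<in>carrier A. a \<otimes>\<^bsub>A\<^esub> d \<otimes>\<^bsub>A\<^esub> e = c \<otimes>\<^bsub>A\<^esub> b \<otimes>\<^bsub>A\<^esub> e"
      then obtain e where e: "e \<in> carrier A" "a \<otimes>\<^bsub>A\<^esub> d \<otimes>\<^bsub>A\<^esub> e = c \<otimes>\<^bsub>A\<^esub> b \<otimes>\<^bsub>A\<^esub> e" by blast
      have "f (a \<otimes>\<^bsub>A\<^esub> d) \<otimes>\<^bsub>G\<^esub> f e = f (c \<otimes>\<^bsub>A\<^esub> b) \<otimes>\<^bsub>G\<^esub> f e"
        using e m mult f(3)[of "a \<otimes>\<^bsub>A\<^esub> d" e] f(3)[of "c \<otimes>\<^bsub>A\<^esub> b" e] by simp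
      then show "f (a \<otimes>\<^bsub>A\<^esub> d) = f (c \<otimes>\<^bsub>A\<^esub> b)"
        using e m mult f(1) G.right_cancel[of "f e" "f (a \<otimes>\<^bsub>A\<^esub> d)" "f (c \<otimes>\<^bsub>A\<^esub> b)"] by simp
    next
      assume "f (a \<otimes>\<^bsub>A\<^esub> d) = f (c \<otimes>\<^bsub>A\<^esub> b)"
      then have "a \<otimes>\<^bsub>A\<^esub> d = c \<otimes>\<^bsub>A\<^esub> b" using inj m mult by (auto dest: inj_onD)
      then show "\<exists>e\<in>carrier A. a \<otimes>\<^bsub>A\<^esub> d \<otimes>\<^bsub>A\<^esub> e = c \<otimes>\<^bsub>A\<^esub> b \<otimes>\<^bsub>A\<^esub> e" using one by auto
    qed
    show ?thesis unfolding completion_rel_def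
      by (intro Set.set_eqI) (auto simp: case_prod_beta mem_Times_iff rw simp del: bex_simps cong: conj_cong)
  qed
  define cl where "cl p = completion_rel A `` {p}" for p
  have cl: "q \<in> cl p \<longleftrightarrow> q \<in> ?P \<and> \<Psi> q = \<Psi> p" if "p \<in> ?P" for p q using that by (auto simp: cl_def rel)
  have cl_eq: "cl p = cl q \<longleftrightarrow> \<Psi> p = \<Psi> q" if "p \<in> ?P" "q \<in> ?P" for p q
    using cl[OF that(1)] cl[OF that(2)] that by (auto simp: set_eq_iff)
  have carr: "carrier (group_completion A) = cl ` ?P"
    by (auto simp: group_completion_def quotient_def cl_def)
  have \<Psi>mult: "\<Psi> (a \<otimes>\<^bsub>A\<^esub> c, b \<otimes>\<^bsub>A\<^esub> d) = \<Psi> (a, b) \<otimes>\<^bsub>G\<^esub> \<Psi> (c, d)"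
    if "a \<in> carrier A" "b \<in> carrier A" "c \<in> carrier A" "d \<in> carrier A" for a b c d
    using that f by (simp add: \<Psi>_def G.inv_mult G.m_ac)
  have clmult: "cl (a, b) \<otimes>\<^bsub>group_completion A\<^esub> cl (c, d) = cl (a \<otimes>\<^bsub>A\<^esub> c, b \<otimes>\<^bsub>A\<^esub> d)"
    if m: "a \<in> carrier A" "b \<in> carrier A" "c \<in> carrier A" "d \<in> carrier A" for a b c d
  proof -
    have "completion_rel A `` {(x \<otimes>\<^bsub>A\<^esub> z, y \<otimes>\<^bsub>A\<^esub> w)} = cl (a \<otimes>\<^bsub>A\<^esub> c, b \<otimes>\<^bsub>A\<^esub> d)"
      if xy: "(x, y) \<in> cl (a, b)" and zw: "(z, w) \<in> cl (c, d)" for x y z w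
    proof -
      have mm: "x \<in> carrier A" "y \<in> carrier A" "z \<in> carrier A" "w \<in> carrier A"
        "\<Psi> (x, y) = \<Psi> (a, b)" "\<Psi> (z, w) = \<Psi> (c, d)" using cl[of "(a, b)"] cl[of "(c, d)"] xy zw m by auto
      then have "\<Psi> (x \<otimes>\<^bsub>A\<^esub> z, y \<otimes>\<^bsub>A\<^esub> w) = \<Psi> (a \<otimes>\<^bsub>A\<^esub> c, b \<otimes>\<^bsub>A\<^esub> d)" using m by (simp add: \<Psi>mult)
      then show ?thesis
        unfolding cl_def[symmetric] using mm m mult by (subst cl_eq) auto
    qed
    moreover have "(a, b) \<in> cl (a, b)" "(c, d) \<in> cl (c, d)" using cl[of "(a, b)"] cl[of "(c, d)"] m by auto
    ultimately show ?thesis unfolding group_completion_def by fastforce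
  qed
  have cc: "completion_class A a = cl (a, \<one>\<^bsub>A\<^esub>)" for a by (simp add: completion_class_def cl_def)
  have \<Psi>1: "\<Psi> (a, \<one>\<^bsub>A\<^esub>) = f a" if "a \<in> carrier A" for a using that f by (simp add: \<Psi>_def)
  \<comment> \<open>Any member of the class may be chosen, as \<open>\<Psi>\<close> is constant on
    classes.\<close>
  define \<Phi> where "\<Phi> X = \<Psi> (SOME p. p \<in> X)" for X
  have \<Phi>: "\<Phi> (cl p) = \<Psi> p" if "p \<in> ?P" for p
  proof -
    have "(SOME q. q \<in> cl p) \<in> cl p" by (rule someI[of _ p]) (use cl that in auto)
    then show ?thesis using cl that by (simp add: \<Phi>_def)
  qed
  have "\<Phi> \<in> hom (group_completion A) G"
  proof (rule homI)
    show "\<Phi> X \<in> carrier G" if "X \<in> carrier (group_completion A)" for X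
      using that \<Phi> \<Psi>c unfolding carr by fastforce
    show "\<Phi> (X \<otimes>\<^bsub>group_completion A\<^esub> Y) = \<Phi> X \<otimes>\<^bsub>G\<^esub> \<Phi> Y"
      if XY: "X \<in> carrier (group_completion A)" "Y \<in> carrier (group_completion A)" for X Y
    proof -
      obtain a b c d where m: "a \<in> carrier A" "b \<in> carrier A" "c \<in> carrier A" "d \<in> carrier A"
        and X: "X = cl (a, b)" "Y = cl (c, d)" using XY unfolding carr by auto
      then show ?thesis using mult by (simp add: clmult \<Phi> \<Psi>mult)
    qed
  qed
  then have "\<Phi> \<in> H" unfolding H_def using \<Phi> \<Psi>1 one by (auto simp: cc)
  then show "H \<noteq> {}" by blast
  show "H \<subseteq> iso (group_completion A) G"
  proof
    fix \<Theta> assume "\<Theta> \<in> H"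
    then have hom: "\<Theta> \<in> hom (group_completion A) G" and \<Theta>f: "\<And>a. a \<in> carrier A \<Longrightarrow> \<Theta> (cl (a, \<one>\<^bsub>A\<^esub>)) = f a"
      by (auto simp: H_def cc)
    \<comment> \<open>Every homomorphism extending \<open>f\<close> is forced: the product of the
      classes of \<open>(a, b)\<close> and \<open>(b, 1)\<close> is that of \<open>(a, 1)\<close>,
      whose value is \<open>f a\<close>.\<close>
    have \<Theta>: "\<Theta> (cl (a, b)) = \<Psi> (a, b)" if m: "a \<in> carrier A" "b \<in> carrier A" for a b
    proof -
      have inC: "cl (a, b) \<in> carrier (group_completion A)" "cl (b, \<one>\<^bsub>A\<^esub>) \<in> carrier (group_completion A)"
        using m one by (auto simp: carr)
      then have Tc: "\<Theta> (cl (a, b)) \<in> carrier G" using hom by (auto simp: hom_def)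
      have "\<Theta> (cl (a, b)) \<otimes>\<^bsub>G\<^esub> f b = \<Theta> (cl (a, b) \<otimes>\<^bsub>group_completion A\<^esub> cl (b, \<one>\<^bsub>A\<^esub>))"
        using hom_mult[OF hom inC] \<Theta>f m by simp
      also have "cl (a, b) \<otimes>\<^bsub>group_completion A\<^esub> cl (b, \<one>\<^bsub>A\<^esub>) = cl (a, \<one>\<^bsub>A\<^esub>)"
        using m one mult f by (subst clmult) (auto simp: cl_eq \<Psi>eq G.m_ac)
      also have "\<Theta> \<dots> = f a" using \<Theta>f m by simp
      finally show ?thesis
        using Tc f(1) m G.inv_solve_right[of "\<Theta> (cl (a, b))" "f a" "f b"] by (simp add: \<Psi>_def)
    qed
    have "bij_betw \<Theta> (carrier (group_completion A)) (carrier G)"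
      unfolding bij_betw_def
    proof
      show "inj_on \<Theta> (carrier (group_completion A))"
      proof (rule inj_onI)
        fix X Y assume X: "X \<in> carrier (group_completion A)" and Y: "Y \<in> carrier (group_completion A)" and eq: "\<Theta> X = \<Theta> Y"
        from X Y obtain p q where "p \<in> ?P" "X = cl p" "q \<in> ?P" "Y = cl q" unfolding carr by blast
        then show "X = Y" using \<Theta> eq cl_eq[of p q] by auto
      qed
      have "g \<in> \<Theta> ` carrier (group_completion A)" if g: "g \<in> carrier G" for g
      proof -
        obtain a b where m: "a \<in> carrier A" "b \<in> carrier A" "g = f a \<otimes>\<^bsub>G\<^esub> inv\<^bsub>G\<^esub> f b" using surj[OF g] by blast
        then have "g = \<Theta> (cl (a, b))" using \<Theta> by (simp add: \<Psi>_def)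
        moreover have "cl (a, b) \<in> carrier (group_completion A)" using m by (auto simp: carr)
        ultimately show ?thesis by (rule image_eqI)
      qed
      then show "\<Theta> ` carrier (group_completion A) = carrier G" using hom by (auto simp: hom_def)
    qed
    then show "\<Theta> \<in> iso (group_completion A) G" using hom by (simp add: iso_def)
  qed
qed

section \<open>The Cartan map\<close>

context pdcf_algebra begin

text \<open>A module and its model may have different carrier types, so their definitions of
  projectivity use different test modules; \<open>projective_module_lift\<close> bridges
  them.\<close>

lemma projective_iso:
  fixes M :: "('r, 'm, 'g) graded_module" and N :: "('r, 'n, 'g) graded_module"
  assumes "grmod M" "grmod N" "graded_isomorphic R M N" "projective_module R M"
  shows "projective_module R N"
  unfolding projective_module_def
proof (intro conjI allI impI)
  interpret N: graded_module_over K R N by fact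
  show "module R N" by (rule N.module_M)
  obtain \<phi> where \<phi>: "\<phi> \<in> graded_hom R M N" "bij_betw \<phi> (carrier M) (carrier N)"
    using assms(3) by (auto simp: graded_isomorphic_def)
  let ?\<psi> = "inv_into (carrier M) \<phi>"
  have \<psi>: "?\<psi> \<in> module_hom R N M" using graded_homD(5)[OF graded_hom_inv_into[OF assms(1,2) \<phi>]] .
  have \<phi>\<psi>: "\<phi> (?\<psi> y) = y" if "y \<in> carrier N" for y
    using \<phi>(2) that by (auto simp: bij_betw_def f_inv_into_f)
  fix X :: "('r, 'n \<Rightarrow> 'r) module" and Y :: "('r, 'n) module" and p f
  assume as: "module R X \<and> module R Y \<and> p \<in> module_hom R X Y \<and> p ` carrier X = carrier Y \<and> f \<in> module_hom R N Y"
  then obtain h where h: "h \<in> module_hom R M X" "\<forall>x\<in>carrier M. p (h x) = f (\<phi> x)"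
    using projective_module_lift[OF assms(4), of X Y p "\<lambda>x. f (\<phi> x)"]
      module_hom_compose[OF graded_homD(5)[OF \<phi>(1)], of f Y] by auto
  have "p (h (?\<psi> y)) = f y" if "y \<in> carrier N" for y
    using bspec[OF h(2) module_hom_closed[OF \<psi> that]] \<phi>\<psi>[OF that] by simp
  then show "\<exists>h\<in>module_hom R N X. \<forall>y\<in>carrier N. p (h y) = f y"
    using module_hom_compose[OF \<psi> h(1)] by (intro bexI[of _ "\<lambda>y. h (?\<psi> y)"]) auto
qed

lemma bdf_class_in_monoid:
  assumes "bdf_module K R M" "projective_module R M"
  shows "bdf_class K R M \<in> carrier (bdf_projective_monoid K R)"
proof -
  obtain X :: "('k, 'r, 'g) model" where X: "bdf_module K R X" "graded_isomorphic R M X"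
    using bdf_module_model[OF assms(1)] by blast
  then have "bdf_class K R M = bdf_class K R X" using bdf_class_eq_iff[OF assms(1) X(1)] by blast
  moreover have "projective_module R X"
    by (rule projective_iso[OF bdf_grmod[OF assms(1)] bdf_grmod[OF X(1)] X(2) assms(2)])
  ultimately show ?thesis using X(1) unfolding bdf_projective_monoid_def by auto
qed

text \<open>The product is a union over members of the two classes. All choices give the same class,
  and \<open>bdf_module_model\<close> shows that there is a choice.\<close>

lemma monoid_mult:
  assumes M: "bdf_module K R M" and N: "bdf_module K R N"
  shows "bdf_class K R M \<otimes>\<^bsub>bdf_projective_monoid K R\<^esub> bdf_class K R N = bdf_class K R (direct_sum M N)"
proof -
  have "bdf_class K R (direct_sum M' N') = bdf_class K R (direct_sum M N)"
    if "M' \<in> bdf_class K R M" "N' \<in> bdf_class K R N" for M' N'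
  proof -
    have M': "bdf_module K R M'" "graded_isomorphic R M M'" and N': "bdf_module K R N'" "graded_isomorphic R N N'"
      using that by (auto simp: bdf_class_def)
    show ?thesis
      using bdf_class_eq_iff[OF bdf_direct_sum(1)[OF M N] bdf_direct_sum(1)[OF M'(1) N'(1)]]
        direct_sum_iso[OF M'(2) N'(2)] by simp
  qed
  moreover obtain M' N' where "M' \<in> bdf_class K R M" "N' \<in> bdf_class K R N"
    using bdf_module_model[OF M] bdf_module_model[OF N] by (auto simp: bdf_class_def)
  ultimately show ?thesis unfolding bdf_projective_monoid_def by auto
qed

lemma zero_free: "bdf_module K R (free (\<lambda>_. 0))" "hilbert (free (\<lambda>_. 0)) = (\<lambda>_. 0)"
  using bdf_free[of "{}" "\<lambda>_. 0"] hilbert_free[of "{}" "\<lambda>_. 0"] by (auto simp: upper_def)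

text \<open>The unit is given as the set of all zero modules; as the class of the free module
  without generators it falls under the results on classes.\<close>

lemma monoid_one: "\<one>\<^bsub>bdf_projective_monoid K R\<^esub> = bdf_class K R (free (\<lambda>_. 0))"
proof -
  have z: "carrier (free (\<lambda>_. 0)) = {\<lambda>_. \<zero>\<^bsub>R\<^esub>}" by (auto simp: carrier_free)
  have "carrier N = {\<zero>\<^bsub>N\<^esub>} \<longleftrightarrow> graded_isomorphic R (free (\<lambda>_. 0)) N" if N: "bdf_module K R N"
    for N :: "('k, 'r, 'g) model"
  proof
    interpret N: graded_module_over K R N by (rule bdf_grmod[OF N])
    interpret F: graded_module_over K R "free (\<lambda>_. 0)" by (rule grmod_free)
    { assume c: "carrier N = {\<zero>\<^bsub>N\<^esub>}"
      have "(\<lambda>_. \<zero>\<^bsub>N\<^esub>) \<in> graded_hom R (free (\<lambda>_. 0)) N" by (auto simp: graded_hom_def module_hom_def)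
      moreover have "bij_betw (\<lambda>_. \<zero>\<^bsub>N\<^esub>) (carrier (free (\<lambda>_. 0))) (carrier N)"
        using c z by (auto simp: bij_betw_def)
      ultimately show "graded_isomorphic R (free (\<lambda>_. 0)) N" unfolding graded_isomorphic_def by blast }
    assume "graded_isomorphic R (free (\<lambda>_. 0)) N"
    then obtain \<phi> where "bij_betw \<phi> {\<lambda>_ :: 'g \<times> nat. \<zero>\<^bsub>R\<^esub>} (carrier N)" by (auto simp: graded_isomorphic_def z)
    then have "carrier N = {\<phi> (\<lambda>_. \<zero>\<^bsub>R\<^esub>)}" by (simp add: bij_betw_def)
    then show "carrier N = {\<zero>\<^bsub>N\<^esub>}" using N.M.M.zero_closed by auto
  qed
  then show ?thesis unfolding bdf_projective_monoid_def bdf_class_def by auto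
qed

lemma monoid_carrierE:
  assumes "X \<in> carrier (bdf_projective_monoid K R)"
  obtains M :: "('k, 'r, 'g) model" where "X = bdf_class K R M" "bdf_module K R M" "projective_module R M"
  using assms unfolding bdf_projective_monoid_def by auto

text \<open>Both modules are free, and the common bound \<open>upper (P \<union> P')\<close> for the
  degrees of their generators lets \<open>hilbert_free_inject\<close> compare the
  multiplicities.\<close>

lemma projective_hilbert_iso:
  assumes M: "bdf_module K R M" "projective_module R M" and N: "bdf_module K R N" "projective_module R N"
    and eq: "hilbert M = hilbert N"
  shows "graded_isomorphic R M N"
proof -
  obtain P c where c: "finite P" "{h. c h \<noteq> 0} \<subseteq> upper P" "graded_isomorphic R (free c) M"
    by (rule projective_bdf_free[OF M])
  obtain P' d where d: "finite P'" "{h. d h \<noteq> 0} \<subseteq> upper P'" "graded_isomorphic R (free d) N"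
    by (rule projective_bdf_free[OF N])
  note bc = bdf_free[OF c(1,2)] and bd = bdf_free[OF d(1,2)]
  have eq': "hilbert (free c) = hilbert (free d)"
    using hilbert_iso[OF grmod_free bdf_grmod[OF M(1)] c(3) bdf_fd[OF bc]]
      hilbert_iso[OF grmod_free bdf_grmod[OF N(1)] d(3) bdf_fd[OF bd]] eq by auto
  have sub: "{h. c h \<noteq> 0} \<subseteq> upper (P \<union> P')" "{h. d h \<noteq> 0} \<subseteq> upper (P \<union> P')"
    using c(2) d(2) upper_mono[of P "P \<union> P'"] upper_mono[of P' "P \<union> P'"] by auto
  have "c = d" by (rule hilbert_free_inject[OF finite_UnI[OF c(1) d(1)] sub eq'])
  then have "graded_isomorphic R (free c) N" using d(3) by simp
  then show ?thesis
    by (rule graded_isomorphic_trans[OF graded_isomorphic_sym[OF grmod_free bdf_grmod[OF M(1)] c(3)]])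
qed

text \<open>Everything is reduced to the map on classes of projective modules: it is injective
  because the Hilbert function determines such a module, and its differences exhaust the group
  because every BDF module has a virtual resolution.\<close>

theorem cartan_iso:
  "cartan_maps K R \<noteq> {} \<and> cartan_maps K R \<subseteq> iso (K0_BDF K R) (G0_BDF K R)"
proof -
  let ?A = "bdf_projective_monoid K R"
  define f where "f X = coset (frag_of X)" for X :: "('k, 'r, 'g) model set"
  have f_in: "f X \<in> carrier (G0_BDF K R)" if X: "X \<in> carrier ?A" for X
    by (rule monoid_carrierE[OF X]) (simp add: f_def G0_class_eq_coset[symmetric] G0_class_closed)
  have closed: "X \<otimes>\<^bsub>?A\<^esub> Y \<in> carrier ?A" "f (X \<otimes>\<^bsub>?A\<^esub> Y) = f X \<otimes>\<^bsub>G0_BDF K R\<^esub> f Y"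
    if X: "X \<in> carrier ?A" and Y: "Y \<in> carrier ?A" for X Y
  proof -
    obtain M :: "('k, 'r, 'g) model" where M: "X = bdf_class K R M" "bdf_module K R M" "projective_module R M"
      using X by (rule monoid_carrierE)
    obtain N :: "('k, 'r, 'g) model" where N: "Y = bdf_class K R N" "bdf_module K R N" "projective_module R N"
      using Y by (rule monoid_carrierE)
    note eq = monoid_mult[OF M(2) N(2), folded M(1) N(1)]
    show "X \<otimes>\<^bsub>?A\<^esub> Y \<in> carrier ?A"
      unfolding eq by (rule bdf_class_in_monoid[OF bdf_direct_sum(1)[OF M(2) N(2)] projective_direct_sum[OF M(3) N(3)]])
    show "f (X \<otimes>\<^bsub>?A\<^esub> Y) = f X \<otimes>\<^bsub>G0_BDF K R\<^esub> f Y"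
      unfolding eq using G0_class_direct_sum[OF M(2) N(2)] by (simp add: f_def G0_class_eq_coset M(1) N(1))
  qed
  have one: "\<one>\<^bsub>?A\<^esub> \<in> carrier ?A"
    unfolding monoid_one by (rule bdf_class_in_monoid[OF zero_free(1) projective_free])
  have f_one: "f \<one>\<^bsub>?A\<^esub> = \<one>\<^bsub>G0_BDF K R\<^esub>"
  proof -
    let ?Z = "free (\<lambda>_. 0)"
    \<comment> \<open>The sum of two zero modules has the same Hilbert function as one, so the class
      is idempotent and hence the unit of the group.\<close>
    have "G0_class K R (direct_sum ?Z ?Z) = G0_class K R ?Z"
      using bdf_direct_sum[OF zero_free(1) zero_free(1)] zero_free
      by (subst G0_class_eq_iff_hilbert) (auto simp: fun_eq_iff)
    then have "f \<one>\<^bsub>?A\<^esub> \<otimes>\<^bsub>G0_BDF K R\<^esub> f \<one>\<^bsub>?A\<^esub> = f \<one>\<^bsub>?A\<^esub>"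
      using G0_class_direct_sum[OF zero_free(1) zero_free(1)] by (simp add: monoid_one f_def G0_class_eq_coset)
    then show ?thesis using f_in[OF one] by simp
  qed
  have inj: "inj_on f (carrier ?A)"
  proof (rule inj_onI)
    fix X Y assume X: "X \<in> carrier ?A" and Y: "Y \<in> carrier ?A" and eq: "f X = f Y"
    obtain M :: "('k, 'r, 'g) model" where M: "X = bdf_class K R M" "bdf_module K R M" "projective_module R M"
      using X by (rule monoid_carrierE)
    obtain N :: "('k, 'r, 'g) model" where N: "Y = bdf_class K R N" "bdf_module K R N" "projective_module R N"
      using Y by (rule monoid_carrierE)
    have "hilbert M = hilbert N"
      using G0_class_hilbert[OF M(2) N(2)] eq by (simp add: f_def G0_class_eq_coset M(1) N(1))
    then show "X = Y"
      using bdf_class_eq_iff[OF M(2) N(2)] projective_hilbert_iso[OF M(2,3) N(2,3)] by (simp add: M(1) N(1))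
  qed
  have surj: "\<exists>a\<in>carrier ?A. \<exists>b\<in>carrier ?A. g = f a \<otimes>\<^bsub>G0_BDF K R\<^esub> inv\<^bsub>G0_BDF K R\<^esub> f b"
    if g: "g \<in> carrier (G0_BDF K R)" for g
  proof -
    obtain x where x: "x \<in> carrier (bdf_free_group K R)" "g = coset x" using g by (auto simp: carrier_G0)
    \<comment> \<open>Membership in the free group is carried along, since splitting the coset of a
      difference requires it for both terms.\<close>
    have "x \<in> carrier (bdf_free_group K R) \<and>
        (\<exists>a\<in>carrier ?A. \<exists>b\<in>carrier ?A. coset x = f a \<otimes>\<^bsub>G0_BDF K R\<^esub> inv\<^bsub>G0_BDF K R\<^esub> f b)"
      using x(1)[unfolded free_group_carrier]
    proof (induction x rule: frag_induction)
      case zero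
      have "0 \<in> carrier (bdf_free_group K R)" using FG.one_closed by simp
      moreover have "coset 0 = f \<one>\<^bsub>?A\<^esub> \<otimes>\<^bsub>G0_BDF K R\<^esub> inv\<^bsub>G0_BDF K R\<^esub> f \<one>\<^bsub>?A\<^esub>"
      proof -
        have "coset 0 \<otimes>\<^bsub>G0_BDF K R\<^esub> coset 0 = coset 0" using calculation by (simp add: coset_add)
        moreover have "coset 0 \<in> carrier (G0_BDF K R)" using \<open>0 \<in> _\<close> by (auto simp: carrier_G0)
        ultimately show ?thesis by (simp add: f_one)
      qed
      ultimately show ?case using one by blast
    next
      case (one X)
      then obtain M :: "('k, 'r, 'g) model" where M: "X = bdf_class K R M" "bdf_module K R M"
        unfolding bdf_classes_def by auto
      obtain P a b where ab: "finite P" "{h. a h \<noteq> 0} \<subseteq> upper P" "{h. b h \<noteq> 0} \<subseteq> upper P"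
        "\<And>g. hilbert M g + hilbert (free b) g = hilbert (free a) g"
        by (rule virtual_resolution[OF M(2)]) (rule that; assumption)
      note ba = bdf_free[OF ab(1,2)] and bb = bdf_free[OF ab(1,3)]
      let ?a = "bdf_class K R (free a)" and ?b = "bdf_class K R (free b)"
      have m: "?a \<in> carrier ?A" "?b \<in> carrier ?A" using ba bb bdf_class_in_monoid projective_free by blast+
      \<comment> \<open>Adding the negative multiplicities to \<open>M\<close> gives the Hilbert
        function of \<open>free a\<close>, and this determines the class.\<close>
      have "G0_class K R (direct_sum M (free b)) = G0_class K R (free a)"
        using G0_class_eq_iff_hilbert[OF bdf_direct_sum(1)[OF M(2) bb] ba] bdf_direct_sum(2)[OF M(2) bb] ab(4)
        by (simp add: fun_eq_iff)
      then have "coset (frag_of X) \<otimes>\<^bsub>G0_BDF K R\<^esub> f ?b = f ?a"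
        using G0_class_direct_sum[OF M(2) bb] by (simp add: f_def G0_class_eq_coset M(1))
      moreover have cX: "coset (frag_of X) \<in> carrier (G0_BDF K R)"
        using G0_class_closed[OF M(2)] by (simp add: G0_class_eq_coset M(1))
      ultimately have "coset (frag_of X) = f ?a \<otimes>\<^bsub>G0_BDF K R\<^esub> inv\<^bsub>G0_BDF K R\<^esub> f ?b"
        using f_in m G0.inv_solve_right[of "coset (frag_of X)" "f ?a" "f ?b"] by simp
      then show ?case using m frag_of_closed[OF M(2)] M(1) by blast
    next
      case (diff x y)
      then obtain a b c d where m: "a \<in> carrier ?A" "b \<in> carrier ?A" "c \<in> carrier ?A" "d \<in> carrier ?A"
        and xy: "x \<in> carrier (bdf_free_group K R)" "y \<in> carrier (bdf_free_group K R)"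
        and e: "coset x = f a \<otimes>\<^bsub>G0_BDF K R\<^esub> inv\<^bsub>G0_BDF K R\<^esub> f b" "coset y = f c \<otimes>\<^bsub>G0_BDF K R\<^esub> inv\<^bsub>G0_BDF K R\<^esub> f d"
        by blast
      have d: "x - y \<in> carrier (bdf_free_group K R)" using free_group_diff xy by blast
      have co: "coset x \<in> carrier (G0_BDF K R)" "coset y \<in> carrier (G0_BDF K R)" "coset (x - y) \<in> carrier (G0_BDF K R)"
        using xy d by (auto simp: carrier_G0)
      have "coset (x - y) \<otimes>\<^bsub>G0_BDF K R\<^esub> coset y = coset x" using coset_add[OF d xy(2)] by simp
      then have "coset (x - y) = coset x \<otimes>\<^bsub>G0_BDF K R\<^esub> inv\<^bsub>G0_BDF K R\<^esub> coset y"
        using co G0.inv_solve_right[of "coset (x - y)" "coset x" "coset y"] by simp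
      \<comment> \<open>The difference of \<open>a - b\<close> and \<open>c - d\<close> is rewritten
        as the single difference of \<open>a + d\<close> and \<open>b + c\<close>.\<close>
      also have "\<dots> = f (a \<otimes>\<^bsub>?A\<^esub> d) \<otimes>\<^bsub>G0_BDF K R\<^esub> inv\<^bsub>G0_BDF K R\<^esub> f (b \<otimes>\<^bsub>?A\<^esub> c)"
        using m f_in by (simp add: e closed(2) G0.inv_mult G0.m_ac)
      finally show ?case using d m closed(1) by blast
    qed
    then show ?thesis using x(2) by blast
  qed
  note main = hom_group_completion[OF comm_group_G0 closed(1) one f_in f_one closed(2) inj surj]
  have "cartan_maps K R = {\<Phi> \<in> hom (group_completion ?A) (G0_BDF K R).
      \<forall>a\<in>carrier ?A. \<Phi> (completion_class ?A a) = f a}"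
    unfolding cartan_maps_def K0_BDF_def K0_class_def
    by (auto simp: f_def G0_class_eq_coset intro: bdf_class_in_monoid elim!: monoid_carrierE)
  then show ?thesis using main unfolding K0_BDF_def by simp
qed

end

theorem theorem6:
  fixes K :: "'k ring"
    and R :: "('k, 'r, 'g::ab_group_add) graded_module"
    and r :: "nat \<Rightarrow> 'r"
  assumes "field K"
    and "graded_algebra K R"
    and "domain R"
    and "pdcf K R"
    and "regular_sequence R r"
    and "\<forall>i. \<exists>g. r i \<in> component R g"
    and "irrelevant_ideal R = Idl\<^bsub>R\<^esub> (range r)"
  shows "cartan_maps K R \<noteq> {} \<and> cartan_maps K R \<subseteq> iso (K0_BDF K R) (G0_BDF K R)"
proof -
  interpret pdcf_algebra K R
    using assms(1-4) by (rule pdcf_algebra.intro)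
  show ?thesis by (rule cartan_iso)
qed

end
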